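(* Let $\Gamma$ be a finite, simple, connected $4$-valent graph and let $G\le\mathrm{Aut}(\Gamma)$ act transitively on $\mathrm{E}(\Gamma)$. Then at least one of the following holds: (1) $G$ contains a semiregular element (a non-identity $g\in G$ such that $\langle g\rangle$ acts semiregularly on $\mathrm{V}(\Gamma)$); (2) $\Gamma\cong \mathrm{W}(2^n,2)$ for some $n\ge 2$; (3) $\Gamma\cong \mathbb{D}\Lambda$ for some arc-transitive $4$-valent graph $\Lambda$ whose number of vertices is a power of $2$.
   Context: All graphs are finite and simple. A group acting on a set is semiregular if all point stabilisers are trivial. The wreath graph $\mathrm{W}(n,2)$ ($n\ge3$) has vertex-set $\mathbb{Z}_n\times\mathbb{Z}_2$, with $(i,u)$ adjacent to $(j,v)$ if and only if $i-j\in\{-1,1\}$. For a graph $\Lambda$, the subdivided double $\mathbb{D}\Lambda$ is the bipartite graph with parts $\mathrm{E}(\Lambda)$ and $\mathrm{V}(\Lambda)\times\mathbb{Z}_2$, where an edge $e\in\mathrm{E}(\Lambda)$ is adjacent to $(v,i)$ whenever $v$ is an endvertex of $e$ in $\Lambda$. A graph is arc-transitive if its automorphism group acts transitively on ordered pairs of adjacent vertices. *)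

theory Defs
  imports Main "HOL-Combinatorics.Permutations"
begin

definition simple_graph :: "'a set \<Rightarrow> ('a \<Rightarrow> 'a \<Rightarrow> bool) \<Rightarrow> bool" where
  "simple_graph V E \<longleftrightarrow> finite V \<and> (\<forall>x y. E x y \<longrightarrow> x \<in> V \<and> y \<in> V)
     \<and> (\<forall>x y. E x y \<longrightarrow> E y x) \<and> (\<forall>x. \<not> E x x)"

definition connected_graph :: "'a set \<Rightarrow> ('a \<Rightarrow> 'a \<Rightarrow> bool) \<Rightarrow> bool" where
  "connected_graph V E \<longleftrightarrow> V \<noteq> {} \<and> (\<forall>x\<in>V. \<forall>y\<in>V. E\<^sup>*\<^sup>* x y)"

definition regular_graph :: "nat \<Rightarrow> 'a set \<Rightarrow> ('a \<Rightarrow> 'a \<Rightarrow> bool) \<Rightarrow> bool" where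
  "regular_graph k V E \<longleftrightarrow> (\<forall>v\<in>V. card {u. E v u} = k)"

definition edges :: "'a set \<Rightarrow> ('a \<Rightarrow> 'a \<Rightarrow> bool) \<Rightarrow> 'a set set" where
  "edges V E = {{u, v} | u v. u \<in> V \<and> v \<in> V \<and> E u v}"

definition automorphism :: "'a set \<Rightarrow> ('a \<Rightarrow> 'a \<Rightarrow> bool) \<Rightarrow> ('a \<Rightarrow> 'a) \<Rightarrow> bool" where
  "automorphism V E f \<longleftrightarrow> f permutes V \<and> (\<forall>x\<in>V. \<forall>y\<in>V. E (f x) (f y) \<longleftrightarrow> E x y)"

definition aut_subgroup :: "'a set \<Rightarrow> ('a \<Rightarrow> 'a \<Rightarrow> bool) \<Rightarrow> ('a \<Rightarrow> 'a) set \<Rightarrow> bool" where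
  "aut_subgroup V E G \<longleftrightarrow> (\<forall>g\<in>G. automorphism V E g) \<and> id \<in> G
     \<and> (\<forall>g\<in>G. \<forall>h\<in>G. g \<circ> h \<in> G) \<and> (\<forall>g\<in>G. inv g \<in> G)"

definition edge_transitive_on :: "'a set \<Rightarrow> ('a \<Rightarrow> 'a \<Rightarrow> bool) \<Rightarrow> ('a \<Rightarrow> 'a) set \<Rightarrow> bool" where
  "edge_transitive_on V E G \<longleftrightarrow>
     (\<forall>e\<in>edges V E. \<forall>e'\<in>edges V E. \<exists>g\<in>G. g ` e = e')"

definition arc_transitive :: "'a set \<Rightarrow> ('a \<Rightarrow> 'a \<Rightarrow> bool) \<Rightarrow> bool" where
  "arc_transitive V E \<longleftrightarrow>
     (\<forall>u v x y. E u v \<longrightarrow> E x y \<longrightarrow> (\<exists>f. automorphism V E f \<and> f u = x \<and> f v = y))"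

definition semiregular_element :: "'a set \<Rightarrow> ('a \<Rightarrow> 'a) \<Rightarrow> bool" where
  "semiregular_element V g \<longleftrightarrow> g \<noteq> id \<and>
     (\<forall>k::nat. (g ^^ k) \<noteq> id \<longrightarrow> (\<forall>v\<in>V. (g ^^ k) v \<noteq> v))"

definition graph_iso :: "'a set \<Rightarrow> ('a \<Rightarrow> 'a \<Rightarrow> bool) \<Rightarrow> 'b set \<Rightarrow> ('b \<Rightarrow> 'b \<Rightarrow> bool) \<Rightarrow> bool" where
  "graph_iso V E V' E' \<longleftrightarrow>
     (\<exists>f. bij_betw f V V' \<and> (\<forall>x\<in>V. \<forall>y\<in>V. E' (f x) (f y) \<longleftrightarrow> E x y))"

text \<open>Wreath graph W(m,2): vertices Z_m \<times> Z_2 (Z_2 modelled by bool).\<close>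
definition wreath_V :: "nat \<Rightarrow> (nat \<times> bool) set" where
  "wreath_V m = {0..<m} \<times> UNIV"

definition wreath_E :: "nat \<Rightarrow> nat \<times> bool \<Rightarrow> nat \<times> bool \<Rightarrow> bool" where
  "wreath_E m p q \<longleftrightarrow> p \<in> wreath_V m \<and> q \<in> wreath_V m \<and>
     ((fst p + 1) mod m = fst q \<or> (fst q + 1) mod m = fst p)"

text \<open>Subdivided double: parts E(\<Lambda>) (as Inl) and V(\<Lambda>) \<times> Z_2 (as Inr).\<close>
definition sdouble_V :: "'a set \<Rightarrow> ('a \<Rightarrow> 'a \<Rightarrow> bool) \<Rightarrow> ('a set + ('a \<times> bool)) set" where
  "sdouble_V V E = Inl ` edges V E \<union> Inr ` (V \<times> UNIV)"

definition sdouble_E :: "'a set \<Rightarrow> ('a \<Rightarrow> 'a \<Rightarrow> bool) \<Rightarrow>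
    ('a set + ('a \<times> bool)) \<Rightarrow> ('a set + ('a \<times> bool)) \<Rightarrow> bool" where
  "sdouble_E V E p q \<longleftrightarrow>
     (\<exists>e v i. e \<in> edges V E \<and> v \<in> V \<and> v \<in> e \<and>
        ((p = Inl e \<and> q = Inr (v, i)) \<or> (p = Inr (v, i) \<and> q = Inl e)))"

end

theory Submission
  imports Defs "HOL-Computational_Algebra.Computational_Algebra" "HOL-Algebra.Sylow"
    "HOL-Algebra.Multiplicative_Group"
begin

text \<open>
  An element of prime order $p \ge 5$ that fixes a vertex fixes its four neighbours, hence everything;
  so without semiregular elements $|G| = 2^a 3^b$. By Burnside's theorem $G$ then has normal subgroups
  $N \le M$ with $N$ a 2-group and $M/N$ a nontrivial 3-group, unless $G$ is itself a 2-group. An element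
  $x \in M$ of order 3 fixes some vertex $v$ and moves a neighbour of it, so the orbits of $M_v$ on the
  neighbours of $v$, which have equal size dividing 4, reduce to one; a Sylow 2-subgroup of $M_v$ is
  already transitive there, and it lies in $N$. Hence all orbits of $G$ on vertices have 2-power size, and a
  Sylow 2-subgroup of $G$ is transitive on each of them. A central involution of that Sylow subgroup is
  semiregular unless the graph is bipartite with $G$-orbits $A$ and $B$ as halves, and the involution fixes
  $A$ pointwise and nothing in $B$. Then every vertex of $B$ has a twin (a vertex with the same neighbours),
  and the sizes of the twin classes in $A$ and $B$ decide between the two families of exceptions.

  Burnside's theorem is only needed for an involution $g$ whose class $C$ has prime power size $q$. It is
  proved without characters: the operator $f \mapsto \sum_{c \in C} f(c\,\cdot)$ on real functions on
  the group is symmetric, and its spectral projections are convolutions with class functions $e_r$. Traces of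
  idempotents give the integrality that characters usually provide.
\<close>

section \<open>Spectral decomposition of symmetric kernels\<close>

text \<open>In character language \<open>e r\<close> is the sum of the central idempotents of those
  irreducible characters \<chi> with |C|\<chi>(g)/\<chi>(1) = r, and \<open>t r\<close> is the sum
  of their \<chi>(1)\<chi>(g). As g is an involution, every element of its class is its own inverse
  and all these numbers are rational integers; hence a symmetric real operator and traces of
  idempotents are enough. Involutions suffice: a central one of a Sylow 2-subgroup has a class of
  3-power size.

  On the graph side the obstacle is a group that is transitive on vertices and edges but not on the
  neighbours of a vertex. It orients the graph with in- and out-valency 2, so that an element of
  order 3 fixing a vertex would be trivial.

  The exceptional families have one source: an involution fixing A pointwise makes b and its image
  twins, so twin classes in B have size 2 or 4. Four twins force K_{4,4}, which is W(4,2). Classes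
  of size 2 on both sides form a cycle; singletons in A make the vertices of A the edges of a graph
  on the classes of B.\<close>

lemma linear_dependence_finite:
  fixes w :: "'i \<Rightarrow> 'x \<Rightarrow> 'f::field"
  assumes "finite X" "finite I" "card X < card I"
  shows "\<exists>c. (\<exists>i\<in>I. c i \<noteq> 0) \<and> (\<forall>x\<in>X. (\<Sum>i\<in>I. c i * w i x) = 0)"
  using assms
proof (induction X arbitrary: I w rule: finite_induct)
  case empty
  then obtain i where "i \<in> I" by (metis card.empty card_gt_0_iff equals0I)
  then show ?case by (intro exI[of _ "\<lambda>_. 1"]) auto
next
  case (insert x X)
  show ?case
  proof (cases "\<forall>i\<in>I. w i x = 0")
    case True
    have "card X < card I" using insert by simp
    from insert.IH[OF insert.prems(1) this, of w] obtain c where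
      "\<exists>i\<in>I. c i \<noteq> 0" "\<forall>x\<in>X. (\<Sum>i\<in>I. c i * w i x) = 0" by blast
    with True show ?thesis by (intro exI[of _ c]) auto
  next
    case False
    then obtain k where k: "k \<in> I" "w k x \<noteq> 0" by blast
    let ?I = "I - {k}"
    \<comment> \<open>Elimination with pivot \<open>w k\<close>: every \<open>w' i\<close> vanishes
      at \<open>x\<close>, so a relation on the remaining coordinates is enough.\<close>
    define w' where "w' = (\<lambda>i y. w i y - w i x / w k x * w k y)"
    have "finite ?I" "card X < card ?I" using insert k by (auto simp: card_Diff_singleton_if)
    from insert.IH[OF this, of w'] obtain c where
      c: "\<exists>i\<in>?I. c i \<noteq> 0" "\<forall>y\<in>X. (\<Sum>i\<in>?I. c i * w' i y) = 0" by blast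
    define c' where "c' = c(k := - (\<Sum>i\<in>?I. c i * w i x) / w k x)"
    have split: "(\<Sum>i\<in>I. c' i * w i y) = c' k * w k y + (\<Sum>i\<in>?I. c i * w i y)" for y
    proof -
      have "(\<Sum>i\<in>I. c' i * w i y) = c' k * w k y + (\<Sum>i\<in>?I. c' i * w i y)"
        using insert k by (subst sum.remove[of _ k]) auto
      then show ?thesis by (simp add: c'_def)
    qed
    have w': "(\<Sum>i\<in>?I. c i * w' i y) = (\<Sum>i\<in>?I. c i * w i y) + c' k * w k y" for y
      by (simp add: c'_def w'_def algebra_simps sum_subtractf sum_distrib_left sum_divide_distrib)
    have "(\<Sum>i\<in>I. c' i * w i x) = 0"
      using k by (simp only: split) (simp add: c'_def)
    moreover have "(\<Sum>i\<in>I. c' i * w i y) = 0" if "y \<in> X" for y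
      using w'[of y] c(2) that by (simp only: split) (simp add: add.commute)
    moreover have "\<exists>i\<in>I. c' i \<noteq> 0" using c(1) by (auto simp: c'_def)
    ultimately show ?thesis by (intro exI[of _ c']) auto
  qed
qed

text \<open>The trace counts the rank one idempotents that can be split off one after the other,
  each of which contributes 1. The number of nonzero columns serves as the measure.\<close>

lemma idempotent_trace_Nats:
  fixes P :: "'x \<Rightarrow> 'x \<Rightarrow> 'f::field"
  assumes "finite X" "\<And>x z. x \<in> X \<Longrightarrow> z \<in> X \<Longrightarrow> (\<Sum>y\<in>X. P x y * P y z) = P x z"
  shows "(\<Sum>x\<in>X. P x x) \<in> \<nat>"
  using assms(2)
proof (induction "card {y\<in>X. \<exists>x\<in>X. P x y \<noteq> 0}" arbitrary: P rule: less_induct)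
  case (less P)
  show ?case
  proof (cases "\<forall>x\<in>X. \<forall>y\<in>X. P x y = 0")
    case True
    then show ?thesis by simp
  next
    case False
    then obtain u w where uw: "u \<in> X" "w \<in> X" "P u w \<noteq> 0" by blast
    \<comment> \<open>Subtracting the rank one idempotent built from a nonzero entry kills a column.\<close>
    define Q where "Q = (\<lambda>x y. P x y - P x w * P u y / P u w)"
    have Q: "(\<Sum>y\<in>X. Q x y * Q y z) = Q x z" if "x \<in> X" "z \<in> X" for x z
    proof -
      let ?k = "P u z / P u w" and ?l = "P x w / P u w"
      have "Q x y * Q y z = P x y * P y z - P x y * P y w * ?k - ?l * (P u y * P y z)
          + ?l * (P u y * P y w) * ?k" for y
        by (simp add: Q_def algebra_simps)
      then have "(\<Sum>y\<in>X. Q x y * Q y z) = (\<Sum>y\<in>X. P x y * P y z)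
          - (\<Sum>y\<in>X. P x y * P y w) * ?k - ?l * (\<Sum>y\<in>X. P u y * P y z)
          + ?l * (\<Sum>y\<in>X. P u y * P y w) * ?k"
        by (simp only: sum.distrib sum_subtractf sum_distrib_left sum_distrib_right)
      also have "\<dots> = Q x z"
        using that uw by (simp add: less.prems Q_def)
      finally show ?thesis .
    qed
    have "{y\<in>X. \<exists>x\<in>X. Q x y \<noteq> 0} \<subset> {y\<in>X. \<exists>x\<in>X. P x y \<noteq> 0}"
    proof
      show "{y \<in> X. \<exists>x\<in>X. Q x y \<noteq> 0} \<subseteq> {y \<in> X. \<exists>x\<in>X. P x y \<noteq> 0}"
      proof clarify
        fix y x assume "y \<in> X" "x \<in> X" "Q x y \<noteq> 0"
        then have "P x y \<noteq> 0 \<or> P u y \<noteq> 0" by (auto simp: Q_def)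
        then show "\<exists>x\<in>X. P x y \<noteq> 0" using \<open>x \<in> X\<close> uw(1) by blast
      qed
      show "{y \<in> X. \<exists>x\<in>X. Q x y \<noteq> 0} \<noteq> {y \<in> X. \<exists>x\<in>X. P x y \<noteq> 0}"
      proof -
        have "Q x w = 0" for x using uw by (simp add: Q_def)
        then have "w \<notin> {y \<in> X. \<exists>x\<in>X. Q x y \<noteq> 0}" by simp
        moreover have "w \<in> {y \<in> X. \<exists>x\<in>X. P x y \<noteq> 0}" using uw by blast
        ultimately show ?thesis by blast
      qed
    qed
    then have "card {y\<in>X. \<exists>x\<in>X. Q x y \<noteq> 0} < card {y\<in>X. \<exists>x\<in>X. P x y \<noteq> 0}"
      using assms(1) by (intro psubset_card_mono) auto
    from less.hyps[OF this Q] have "(\<Sum>x\<in>X. Q x x) \<in> \<nat>" .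
    moreover have "(\<Sum>x\<in>X. P x x) = (\<Sum>x\<in>X. Q x x) + 1"
    proof -
      have "(\<Sum>x\<in>X. P x w * P u x / P u w) = (\<Sum>x\<in>X. P u x * P x w) / P u w"
        by (simp add: sum_divide_distrib mult.commute)
      also have "\<dots> = 1" using uw less.prems by simp
      finally show ?thesis by (simp add: Q_def sum_subtractf)
    qed
    ultimately show ?thesis by (metis Nats_1 Nats_add)
  qed
qed

section \<open>Diagonalisation of a real symmetric operator\<close>

locale symmetric_kernel =
  fixes X :: "'x set" and a :: "'x \<Rightarrow> 'x \<Rightarrow> real"
  assumes finite_X: "finite X" and sym: "x \<in> X \<Longrightarrow> y \<in> X \<Longrightarrow> a x y = a y x"
begin

text \<open>Functions are complex valued although the kernel is real, so that annihilating
  polynomials split into linear factors; \<open>real_diagonal\<close> returns to real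
  functions.\<close>

definition oper :: "('x \<Rightarrow> complex) \<Rightarrow> 'x \<Rightarrow> complex" where
  "oper f x = (\<Sum>y\<in>X. of_real (a x y) * f y)"

definition shift :: "complex \<Rightarrow> ('x \<Rightarrow> complex) \<Rightarrow> 'x \<Rightarrow> complex" where
  "shift t f x = oper f x - t * f x"

definition inner :: "('x \<Rightarrow> complex) \<Rightarrow> ('x \<Rightarrow> complex) \<Rightarrow> complex" where
  "inner f h = (\<Sum>x\<in>X. f x * cnj (h x))"

lemma inner_oper: "inner (oper f) h = inner f (oper h)"
proof -
  have "inner (oper f) h = (\<Sum>x\<in>X. \<Sum>y\<in>X. of_real (a x y) * f y * cnj (h x))"
    by (simp add: inner_def oper_def sum_distrib_right)
  also have "\<dots> = (\<Sum>y\<in>X. \<Sum>x\<in>X. of_real (a x y) * f y * cnj (h x))"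
    by (rule sum.swap)
  also have "\<dots> = inner f (oper h)"
    unfolding inner_def oper_def cnj_sum sum_distrib_left
    by (intro sum.cong refl) (auto simp: sym)
  finally show ?thesis .
qed

lemma inner_self_eq_0: "inner f f = 0 \<Longrightarrow> x \<in> X \<Longrightarrow> f x = 0"
proof -
  assume "inner f f = 0" "x \<in> X"
  then have "of_real (\<Sum>x\<in>X. (cmod (f x))\<^sup>2) = (0::complex)"
    by (simp add: inner_def flip: complex_norm_square)
  then have "(\<Sum>x\<in>X. (cmod (f x))\<^sup>2) = 0" using of_real_eq_0_iff by blast
  with \<open>x \<in> X\<close> finite_X show "f x = 0" by (simp add: sum_nonneg_eq_0_iff)
qed

lemma inner_cong: "(\<And>x. x \<in> X \<Longrightarrow> f x = f' x) \<Longrightarrow> (\<And>x. x \<in> X \<Longrightarrow> h x = h' x) \<Longrightarrow> inner f h = inner f' h'"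
  by (simp add: inner_def)

lemma oper_cong: "(\<And>x. x \<in> X \<Longrightarrow> f x = f' x) \<Longrightarrow> oper f = oper f'"
  by (simp add: oper_def fun_eq_iff)

lemma oper_minus: "oper (\<lambda>x. f x - h x) x = oper f x - oper h x"
  by (simp add: oper_def algebra_simps sum_subtractf)

lemma oper_scale: "oper (\<lambda>x. c * f x) x = c * oper f x"
  by (simp add: oper_def algebra_simps sum_distrib_left)

lemma oper_sum: "oper (\<lambda>x. \<Sum>i\<in>I. f i x) x = (\<Sum>i\<in>I. oper (f i) x)"
  unfolding oper_def sum_distrib_left by (rule sum.swap)

lemma oper_shift: "oper (shift t f) x = oper (oper f) x - t * oper f x"
  unfolding shift_def[abs_def] by (simp add: oper_minus oper_scale)

lemma real_of_eigenfunction: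
  assumes "\<And>x. x \<in> X \<Longrightarrow> shift t f x = 0" "u \<in> X" "f u \<noteq> 0"
  shows "t \<in> \<real>"
proof -
  have "oper f x = t * f x" if "x \<in> X" for x using assms(1)[OF that] by (simp add: shift_def)
  then have "inner (\<lambda>x. t * f x) f = inner f (\<lambda>x. t * f x)"
    using inner_oper[of f f] inner_cong by (smt (verit, best))
  then have "t * inner f f = cnj t * inner f f"
    by (simp add: inner_def sum_distrib_left algebra_simps)
  moreover have "inner f f \<noteq> 0" using inner_self_eq_0 assms by blast
  ultimately show ?thesis by (simp add: Reals_cnj_iff)
qed

text \<open>There are no Jordan blocks: for real t the operator A - t is self-adjoint, so the
  squared norm of (A - t)f is the inner product of f with (A - t)(A - t)f.\<close>

lemma shift_square_kernel:
  assumes "\<And>x. x \<in> X \<Longrightarrow> shift t (shift t f) x = 0" "t \<in> \<real>" "x \<in> X"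
  shows "shift t f x = 0"
proof -
  let ?h = "shift t f"
  have "inner (shift t k) h = inner k (shift t h)" for k h
  proof -
    have "inner (shift t k) h = inner (oper k) h - t * inner k h"
      by (simp add: inner_def shift_def sum_subtractf sum_distrib_left algebra_simps)
    also have "\<dots> = inner k (oper h) - cnj t * inner k h"
      using assms(2) by (simp add: inner_oper Reals_cnj_iff)
    also have "\<dots> = inner k (shift t h)"
      by (simp add: inner_def shift_def sum_subtractf sum_distrib_left algebra_simps)
    finally show ?thesis .
  qed
  then have "inner ?h ?h = inner f (shift t ?h)" by simp
  also have "\<dots> = 0" using assms(1) by (simp add: inner_def)
  finally show ?thesis using inner_self_eq_0 assms(3) by blast
qed

text \<open>A finite sum of eigenfunctions indexed by real eigenvalues. A summand \<open>v r\<close>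
  may vanish, and everything is asked on \<open>X\<close> only.\<close>

definition diagonal :: "('x \<Rightarrow> complex) \<Rightarrow> bool" where
  "diagonal f \<longleftrightarrow> (\<exists>S v. finite S \<and> (\<forall>x\<in>X. f x = (\<Sum>r\<in>S. v r x)) \<and>
     (\<forall>r\<in>S. \<forall>x\<in>X. shift (of_real r) (v r) x = 0))"

text \<open>Components of (A - t)f with eigenvalue r \<noteq> t are lifted to f by dividing by r -
  t. For the rest f' of f, the function (A - t)f' is the component with eigenvalue t, so (A - t)(A -
  t)f' = 0 and f' is itself an eigenfunction.\<close>

lemma diagonal_of_shift:
  assumes "diagonal (shift t f)"
  shows "diagonal f"
proof -
  obtain S w where S: "finite S" and w: "\<forall>x\<in>X. shift t f x = (\<Sum>r\<in>S. w r x)"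
    and ev: "\<And>r x. r\<in>S \<Longrightarrow> x\<in>X \<Longrightarrow> shift (of_real r) (w r) x = 0"
    using assms unfolding diagonal_def by blast
  define S' where "S' = {r\<in>S. of_real r \<noteq> t}"
  define v where "v = (\<lambda>r x. w r x / (of_real r - t))"
  define f' where "f' = (\<lambda>x. f x - (\<Sum>r\<in>S'. v r x))"
  have S': "finite S'" using S by (simp add: S'_def)
  have evv: "shift (of_real r) (v r) x = 0" if "r \<in> S'" "x \<in> X" for r x
    using ev[of r x] that oper_scale[of "1 / (of_real r - t)" "w r" x]
    by (simp add: shift_def v_def S'_def field_simps)
  have sv: "shift t (v r) x = w r x" if "r \<in> S'" "x \<in> X" for r x
  proof -
    have "shift t (v r) x = (of_real r - t) * v r x"
      using evv[OF that] by (simp add: shift_def algebra_simps)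
    with that show ?thesis by (simp add: v_def S'_def)
  qed
  have sf': "shift t f' x = (\<Sum>r\<in>S-S'. w r x)" if "x \<in> X" for x
  proof -
    have "shift t f' x = shift t f x - (\<Sum>r\<in>S'. shift t (v r) x)"
      by (simp add: f'_def shift_def oper_minus oper_sum sum_subtractf sum_distrib_left algebra_simps)
    also have "\<dots> = (\<Sum>r\<in>S. w r x) - (\<Sum>r\<in>S'. w r x)" using that w sv by simp
    also have "\<dots> = (\<Sum>r\<in>S-S'. w r x)" using S by (simp add: sum_diff S'_def)
    finally show ?thesis .
  qed
  show ?thesis
  proof (cases "t \<in> \<real>")
    case True
    then obtain s where s: "t = of_real s" by (auto simp: Reals_def)
    have "shift t (shift t f') x = 0" if "x \<in> X" for x
    proof -
      have "shift t (shift t f') x = shift t (\<lambda>x. \<Sum>r\<in>S-S'. w r x) x"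
        using oper_cong[of "shift t f'" "\<lambda>x. \<Sum>r\<in>S-S'. w r x"] sf' that by (simp add: shift_def)
      also have "\<dots> = (\<Sum>r\<in>S-S'. shift t (w r) x)"
        by (simp add: shift_def oper_sum sum_subtractf sum_distrib_left)
      also have "\<dots> = 0" using ev that by (intro sum.neutral) (auto simp: S'_def)
      finally show ?thesis .
    qed
    from shift_square_kernel[OF this True] have f'0: "shift t f' x = 0" if "x \<in> X" for x
      using that by blast
    have sS: "s \<notin> S'" by (simp add: S'_def s)
    show ?thesis unfolding diagonal_def
    proof (intro exI conjI ballI)
      show "finite (insert s S')" using S' by simp
      show "f x = (\<Sum>r\<in>insert s S'. (v(s := f')) r x)" for x
      proof -
        have "(\<Sum>r\<in>insert s S'. (v(s := f')) r x) = f' x + (\<Sum>r\<in>S'. (v(s := f')) r x)"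
          using S' sS by simp
        also have "(\<Sum>r\<in>S'. (v(s := f')) r x) = (\<Sum>r\<in>S'. v r x)"
          using sS by (intro sum.cong) auto
        finally show ?thesis by (simp add: f'_def)
      qed
      show "shift (of_real r) ((v(s := f')) r) x = 0" if "r \<in> insert s S'" "x \<in> X" for r x
        using that evv f'0 sS s by auto
    qed
  next
    case False
    \<comment> \<open>A nonreal t is the image of no r in \<open>S\<close>, so f' is annihilated by
      A - t and vanishes because eigenvalues are real.\<close>
    then have "S - S' = {}" by (auto simp: S'_def Reals_def)
    then have "shift t f' x = 0" if "x \<in> X" for x using sf'[OF that] by (metis sum.empty)
    then have "f' x = 0" if "x \<in> X" for x using real_of_eigenfunction[of t f'] False that by blast
    then show ?thesis unfolding diagonal_def using S' evv
      by (intro exI[of _ S'] exI[of _ v]) (auto simp: f'_def)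
  qed
qed

definition peval :: "complex poly \<Rightarrow> ('x \<Rightarrow> complex) \<Rightarrow> 'x \<Rightarrow> complex" where
  "peval p f x = (\<Sum>i\<le>Polynomial.degree p. Polynomial.coeff p i * (oper ^^ i) f x)"

lemma peval_bound: "Polynomial.degree p \<le> n \<Longrightarrow> peval p f x = (\<Sum>i\<le>n. Polynomial.coeff p i * (oper ^^ i) f x)"
  unfolding peval_def by (rule sum.mono_neutral_left) (auto simp: coeff_eq_0)

lemma peval_linear_factor: "peval ([:- t, 1:] * p) f = shift t (peval p f)"
proof
  fix x
  let ?n = "Suc (Polynomial.degree p)"
  have "Polynomial.degree ([:- t, 1:] * p) \<le> ?n" by (rule order.trans[OF degree_mult_le]) simp
  then have "peval ([:- t, 1:] * p) f x = (\<Sum>i\<le>?n. Polynomial.coeff ([:- t, 1:] * p) i * (oper ^^ i) f x)"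
    by (rule peval_bound)
  also have "\<dots> = (\<Sum>i\<le>?n. Polynomial.coeff (pCons 0 p) i * (oper ^^ i) f x) - t * (\<Sum>i\<le>?n. Polynomial.coeff p i * (oper ^^ i) f x)"
    by (simp add: algebra_simps sum_subtractf sum_distrib_left sum.distrib sum_negf)
  also have "(\<Sum>i\<le>?n. Polynomial.coeff (pCons 0 p) i * (oper ^^ i) f x) = (\<Sum>i\<le>Polynomial.degree p. Polynomial.coeff p i * oper ((oper ^^ i) f) x)"
    by (subst sum.atMost_Suc_shift) simp
  also have "\<dots> = oper (peval p f) x"
    unfolding peval_def[abs_def] by (simp add: oper_sum oper_scale)
  also have "(\<Sum>i\<le>?n. Polynomial.coeff p i * (oper ^^ i) f x) = peval p f x"
    by (rule peval_bound[symmetric]) simp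
  finally show "peval ([:- t, 1:] * p) f x = shift t (peval p f) x" by (simp add: shift_def)
qed

text \<open>Induction on the roots: if (A - t)q(A) annihilates f, then q(A) annihilates (A -
  t)f.\<close>

lemma diagonal_of_peval:
  "(\<And>x. x \<in> X \<Longrightarrow> peval (\<Prod>t\<leftarrow>ts. [:- t, 1:]) f x = 0) \<Longrightarrow> diagonal f"
proof (induction ts arbitrary: f)
  case Nil
  then have "f x = 0" if "x \<in> X" for x using that by (auto simp: peval_def)
  then show ?case unfolding diagonal_def by (intro exI[of _ "{}"]) auto
next
  case (Cons t ts)
  have lin: "peval p (shift t h) = shift t (peval p h)" for p h
  proof -
    have "(oper ^^ i) (shift t h) = shift t ((oper ^^ i) h)" for i
    proof (induction i)
      case (Suc i)
      show ?case
        by (rule ext) (simp add: Suc oper_shift, simp add: shift_def)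
    qed simp
    then have "(oper ^^ i) (shift t h) x = oper ((oper ^^ i) h) x - t * (oper ^^ i) h x" for i x
      by (simp add: shift_def)
    then show ?thesis unfolding peval_def[abs_def] fun_eq_iff
      by (simp add: shift_def oper_sum oper_scale right_diff_distrib sum_subtractf sum_distrib_left mult.left_commute)
  qed
  have "peval (\<Prod>t\<leftarrow>ts. [:- t, 1:]) (shift t f) x = 0" if "x \<in> X" for x
    using Cons.prems[OF that] by (simp add: lin peval_linear_factor del: mult_pCons_left)
  from diagonal_of_shift[OF Cons.IH[OF this]] show ?case .
qed

text \<open>The card X + 1 functions obtained from f by iterating the operator are linearly
  dependent on \<open>X\<close>. This gives a nonzero polynomial in the operator that annihilates f,
  and over the complex numbers it splits.\<close>

lemma diagonal: "diagonal f"
proof -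
  obtain c :: "nat \<Rightarrow> complex" where c: "\<exists>i\<le>card X. c i \<noteq> 0"
    "\<forall>x\<in>X. (\<Sum>i\<le>card X. c i * (oper ^^ i) f x) = 0"
    using linear_dependence_finite[OF finite_X, of "{..card X}" "\<lambda>i. (oper ^^ i) f"] by auto
  define p where "p = (\<Sum>i\<le>card X. Polynomial.monom (c i) i)"
  have cp: "Polynomial.coeff p i = (if i \<le> card X then c i else 0)" for i
    by (simp add: p_def coeff_sum)
  then have "p \<noteq> 0" using c(1) by (metis coeff_0)
  have "Polynomial.degree p \<le> card X" by (rule degree_le) (simp add: cp)
  then have p0: "peval p f x = 0" if "x \<in> X" for x
    using c(2) that by (simp add: peval_bound cp)
  obtain A where A: "p = Polynomial.smult (lead_coeff p) (\<Prod>x\<in>#A. [:- x, 1:])"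
    using alg_closed_imp_factorization[OF \<open>p \<noteq> 0\<close>] by blast
  obtain ts where ts: "mset ts = A" by (metis ex_mset)
  have eq: "p = Polynomial.smult (lead_coeff p) (\<Prod>t\<leftarrow>ts. [:- t, 1:])"
    using A ts by (metis mset_map prod_mset_prod_list)
  have "peval (Polynomial.smult k q) f x = k * peval q f x" for k q x
    by (cases "k = 0") (auto simp: peval_def sum_distrib_left algebra_simps)
  then have "lead_coeff p * peval (\<Prod>t\<leftarrow>ts. [:- t, 1:]) f x = 0" if "x \<in> X" for x
    using p0[OF that] eq by (metis (no_types, lifting))
  then show ?thesis using \<open>p \<noteq> 0\<close> by (intro diagonal_of_peval[of ts]) auto
qed

text \<open>Kernel and eigenvalues are real, so the real parts of the complex eigenfunctions are
  eigenfunctions too.\<close>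

lemma real_diagonal:
  fixes f :: "'x \<Rightarrow> real"
  obtains S v where "finite S" "\<And>x. x \<in> X \<Longrightarrow> f x = (\<Sum>r\<in>S. v r x)"
    "\<And>r x. r \<in> S \<Longrightarrow> x \<in> X \<Longrightarrow> (\<Sum>y\<in>X. a x y * v r y) = r * v r x"
proof -
  obtain S v where S: "finite S" "\<forall>x\<in>X. of_real (f x) = (\<Sum>r\<in>S. v r x)"
     "\<forall>r\<in>S. \<forall>x\<in>X. shift (of_real r) (v r) x = 0"
    using diagonal[of "\<lambda>x. of_real (f x)"] unfolding diagonal_def by blast
  show thesis
  proof
    show "finite S" by fact
    show "f x = (\<Sum>r\<in>S. Re (v r x))" if "x \<in> X" for x
    proof -
      have "f x = Re (\<Sum>r\<in>S. v r x)" using S(2) that by (metis Re_complex_of_real)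
      then show ?thesis by simp
    qed
    show "(\<Sum>y\<in>X. a x y * Re (v r y)) = r * Re (v r x)" if "r \<in> S" "x \<in> X" for r x
    proof -
      have "oper (v r) x = of_real r * v r x" using S(3) that by (simp add: shift_def)
      then have "Re (oper (v r) x) = r * Re (v r x)" by simp
      then show ?thesis by (simp add: oper_def)
    qed
  qed
qed

end

section \<open>Involutions with a conjugacy class of prime power size\<close>

text \<open>In lowest terms r = a/b, every power of b divides the fixed number N, so b = 1. It takes
  the place of the fact that a rational algebraic integer is an integer.\<close>

lemma Ints_of_bounded_denominator_powers:
  fixes r N :: real
  assumes "r \<in> \<rat>" "N \<in> \<int>" "N \<noteq> 0" "\<And>m. r ^ m * N \<in> \<int>"
  shows "r \<in> \<int>"
proof -
  obtain a b :: int where ab: "b > 0" "coprime a b" "r = of_int a / of_int b"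
    using assms(1) by (metis Rats_cases' )
  obtain n where n: "N = of_int n" using assms(2) by (elim Ints_cases)
  have "b ^ m dvd n" for m
  proof -
    obtain l where l: "r ^ m * N = of_int l" using assms(4)[of m] by (elim Ints_cases)
    then have "of_int (a ^ m * n) = (of_int (b ^ m * l) :: real)"
      using ab by (simp add: n field_simps)
    then have "a ^ m * n = b ^ m * l" using of_int_eq_iff by blast
    then have "b ^ m dvd a ^ m * n" by simp
    moreover have "coprime (b ^ m) (a ^ m)" using ab(2) by (simp add: coprime_commute)
    ultimately show ?thesis by (simp add: coprime_dvd_mult_right_iff)
  qed
  have "b = 1"
  proof (rule ccontr)
    assume "b \<noteq> 1"
    with ab have "b \<ge> 2" by simp
    have "n \<noteq> 0" using assms(3) n by simp
    then have "\<bar>b ^ nat \<bar>n\<bar>\<bar> \<le> \<bar>n\<bar>" using \<open>\<And>m. b ^ m dvd n\<close> by (simp add: dvd_imp_le_int)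
    moreover have "\<bar>n\<bar> < 2 ^ nat \<bar>n\<bar>" using of_nat_less_two_power[of "nat \<bar>n\<bar>", where 'a=int] by simp
    moreover have "(2::int) ^ nat \<bar>n\<bar> \<le> b ^ nat \<bar>n\<bar>" using \<open>b \<ge> 2\<close> by (intro power_mono) auto
    ultimately show False using ab by linarith
  qed
  then show ?thesis by (simp add: ab)
qed

lemma common_denominator:
  assumes "finite X" "\<And>x. x \<in> X \<Longrightarrow> f x \<in> (\<rat> :: real set)"
  obtains D :: real where "D \<in> \<int>" "D \<noteq> 0" "\<And>x. x \<in> X \<Longrightarrow> D * f x \<in> \<int>"
proof -
  have "\<exists>D::real. D \<in> \<int> \<and> D \<noteq> 0 \<and> (\<forall>x\<in>X. D * f x \<in> \<int>)"
    using assms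
  proof (induction X rule: finite_induct)
    case empty then show ?case by (intro exI[of _ 1]) auto
  next
    case (insert x X)
    then obtain D where D: "D \<in> \<int>" "D \<noteq> 0" "\<forall>x\<in>X. D * f x \<in> \<int>" by auto
    obtain a b :: int where ab: "b > 0" "f x = of_int a / of_int b"
      using insert.prems[of x] by (metis Rats_cases' insertI1)
    have "D * of_int b * f y \<in> \<int>" if "y \<in> insert x X" for y
    proof (cases "y = x")
      case True then show ?thesis using ab D by simp
    next
      case False
      then have "of_int b * (D * f y) \<in> \<int>" using D that Ints_mult[OF Ints_of_int, of "D * f y" b] by blast
      then show ?thesis by (metis mult.assoc mult.commute)
    qed
    then show ?case using D ab by (intro exI[of _ "D * of_int b"]) auto
  qed
  then show thesis using that by blast
qed

section \<open>The class operator of an involution and its eigenfunctions\<close>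

locale involution_class = group G for G (structure) +
  fixes g :: 'a
  assumes finite_carrier: "finite (carrier G)" and g_closed: "g \<in> carrier G"
    and g_square: "g \<otimes> g = \<one>"
begin

definition C :: "'a set" where "C = (\<lambda>x. x \<otimes> g \<otimes> inv x) ` carrier G"

lemma cancel_left: "x \<in> carrier G \<Longrightarrow> y \<in> carrier G \<Longrightarrow> inv x \<otimes> (x \<otimes> y) = y"
  "x \<in> carrier G \<Longrightarrow> y \<in> carrier G \<Longrightarrow> x \<otimes> (inv x \<otimes> y) = y"
  by (simp_all flip: m_assoc)

lemma C_closed: "c \<in> C \<Longrightarrow> c \<in> carrier G"
  using g_closed by (auto simp: C_def)

lemma g_in_C: "g \<in> C"
  unfolding C_def using g_closed by (intro image_eqI[of _ _ \<one>]) auto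

lemma C_square: "c \<in> C \<Longrightarrow> c \<otimes> c = \<one>"
  using g_closed g_square by (auto simp: C_def m_assoc cancel_left) (simp add: cancel_left flip: m_assoc)

lemma C_inv: "c \<in> C \<Longrightarrow> inv c = c"
  using C_square C_closed inv_equality by blast

lemma C_cancel: "c \<in> C \<Longrightarrow> x \<in> carrier G \<Longrightarrow> c \<otimes> (c \<otimes> x) = x"
  using C_square C_closed by (simp flip: m_assoc)

lemma C_conj: "x \<in> carrier G \<Longrightarrow> c \<in> C \<Longrightarrow> x \<otimes> c \<otimes> inv x \<in> C"
proof -
  assume "x \<in> carrier G" "c \<in> C"
  then obtain y where y: "y \<in> carrier G" "c = y \<otimes> g \<otimes> inv y" by (auto simp: C_def)
  then have "x \<otimes> c \<otimes> inv x = (x \<otimes> y) \<otimes> g \<otimes> inv (x \<otimes> y)"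
    using \<open>x \<in> carrier G\<close> g_closed by (simp add: m_assoc inv_mult_group)
  then show ?thesis unfolding C_def using y \<open>x \<in> carrier G\<close> by blast
qed

lemma C_conj': "x \<in> carrier G \<Longrightarrow> c \<in> C \<Longrightarrow> inv x \<otimes> c \<otimes> x \<in> C"
  using C_conj[of "inv x" c] by simp

lemma finite_C: "finite C"
  using finite_carrier by (simp add: C_def)

lemma sum_left: "u \<in> carrier G \<Longrightarrow> (\<Sum>y\<in>carrier G. f (u \<otimes> y)) = (\<Sum>y\<in>carrier G. f y :: real)"
  by (rule sum.reindex_bij_witness[where i="\<lambda>y. inv u \<otimes> y" and j="\<lambda>y. u \<otimes> y"]) (auto simp: cancel_left)

lemma sum_right: "u \<in> carrier G \<Longrightarrow> (\<Sum>y\<in>carrier G. f (y \<otimes> u)) = (\<Sum>y\<in>carrier G. f y :: real)"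
  by (rule sum.reindex_bij_witness[where i="\<lambda>y. y \<otimes> inv u" and j="\<lambda>y. y \<otimes> u"]) (auto simp: m_assoc)

lemma sum_C_conj: "x \<in> carrier G \<Longrightarrow> (\<Sum>c\<in>C. f (x \<otimes> c \<otimes> inv x)) = (\<Sum>c\<in>C. f c :: real)"
  by (rule sum.reindex_bij_witness[where i="\<lambda>y. inv x \<otimes> y \<otimes> x" and j="\<lambda>y. x \<otimes> y \<otimes> inv x"])
    (use C_conj C_conj' in \<open>auto simp: m_assoc cancel_left C_closed\<close>)

text \<open>The zero function counts as an eigenfunction for every r. This allows differences that
  will turn out to be zero to be fed to \<open>eig_unique\<close>.\<close>

definition eig :: "real \<Rightarrow> ('a \<Rightarrow> real) \<Rightarrow> bool" where
  "eig r f \<longleftrightarrow> (\<forall>x\<in>carrier G. (\<Sum>c\<in>C. f (c \<otimes> x)) = r * f x)"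

lemma eig_orthogonal:
  assumes "eig r f" "eig s h" "r \<noteq> s"
  shows "(\<Sum>x\<in>carrier G. f x * h x) = 0"
proof -
  have "r * (\<Sum>x\<in>carrier G. f x * h x) = (\<Sum>x\<in>carrier G. (\<Sum>c\<in>C. f (c \<otimes> x)) * h x)"
    using assms(1) by (simp add: eig_def sum_distrib_left algebra_simps)
  also have "\<dots> = (\<Sum>c\<in>C. \<Sum>x\<in>carrier G. f (c \<otimes> x) * h x)"
    unfolding sum_distrib_right by (rule sum.swap)
  also have "\<dots> = (\<Sum>c\<in>C. \<Sum>x\<in>carrier G. f x * h (c \<otimes> x))"
  proof (rule sum.cong[OF refl])
    fix c assume c: "c \<in> C"
    show "(\<Sum>x\<in>carrier G. f (c \<otimes> x) * h x) = (\<Sum>x\<in>carrier G. f x * h (c \<otimes> x))"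
      using sum_left[OF C_closed[OF c], of "\<lambda>x. f x * h (c \<otimes> x)"] c by (simp add: C_cancel)
  qed
  also have "\<dots> = (\<Sum>x\<in>carrier G. f x * (\<Sum>c\<in>C. h (c \<otimes> x)))"
    unfolding sum_distrib_left by (rule sum.swap)
  also have "\<dots> = s * (\<Sum>x\<in>carrier G. f x * h x)"
    using assms(2) by (simp add: eig_def sum_distrib_left algebra_simps)
  finally show ?thesis using assms(3) by simp
qed

text \<open>Pairing the vanishing sum with \<open>u s\<close> leaves, by orthogonality, the sum of
  the squares of \<open>u s\<close>. Symmetries of a decomposition into eigenfunctions are derived
  from this uniqueness.\<close>

lemma eig_unique:
  assumes "finite S" "\<And>r. r \<in> S \<Longrightarrow> eig r (u r)"
    "\<And>x. x \<in> carrier G \<Longrightarrow> (\<Sum>r\<in>S. u r x) = 0" "s \<in> S" "x \<in> carrier G"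
  shows "u s x = 0"
proof -
  have "0 = (\<Sum>y\<in>carrier G. (\<Sum>r\<in>S. u r y) * u s y)" using assms(3) by simp
  also have "\<dots> = (\<Sum>r\<in>S. \<Sum>y\<in>carrier G. u r y * u s y)"
    unfolding sum_distrib_right by (rule sum.swap)
  also have "\<dots> = (\<Sum>r\<in>S. if r = s then \<Sum>y\<in>carrier G. u s y * u s y else 0)"
  proof (rule sum.cong[OF refl])
    fix r assume "r \<in> S"
    then show "(\<Sum>y\<in>carrier G. u r y * u s y) = (if r = s then \<Sum>y\<in>carrier G. u s y * u s y else 0)"
      using eig_orthogonal[OF assms(2) assms(2)[OF assms(4)]] by auto
  qed
  also have "\<dots> = (\<Sum>y\<in>carrier G. u s y * u s y)" using assms by simp
  finally show ?thesis using assms(5) finite_carrier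
    by (subst (asm) eq_commute) (simp add: sum_nonneg_eq_0_iff)
qed

lemma eig_decomposition:
  obtains S e where "finite S" "\<And>r. r \<in> S \<Longrightarrow> eig r (e r)"
    "\<And>x. x \<in> carrier G \<Longrightarrow> (\<Sum>r\<in>S. e r x) = f x"
    "\<And>r. r \<in> S \<Longrightarrow> \<exists>x\<in>carrier G. e r x \<noteq> 0"
proof -
  \<comment> \<open>The adjacency matrix of the Cayley graph with connection set \<open>C\<close>.
    It is symmetric because the elements of \<open>C\<close> are their own inverses.\<close>
  define a :: "'a \<Rightarrow> 'a \<Rightarrow> real" where "a = (\<lambda>x y. if x \<otimes> inv y \<in> C then 1 else 0)"
  have C_flip: "x \<otimes> inv y \<in> C" if "y \<otimes> inv x \<in> C" "x \<in> carrier G" "y \<in> carrier G" for x y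
    using C_inv[OF that(1)] that by (simp add: inv_mult_group)
  interpret symmetric_kernel "carrier G" a
    by unfold_locales (use finite_carrier C_flip in \<open>auto simp: a_def\<close>)
  have a: "(\<Sum>y\<in>carrier G. a x y * h y) = (\<Sum>c\<in>C. h (c \<otimes> x))" if x: "x \<in> carrier G" for x h
  proof -
    have "(\<Sum>y\<in>carrier G. a x y * h y) = (\<Sum>y\<in>{y\<in>carrier G. y \<otimes> inv x \<in> C}. h y)"
      using finite_carrier C_flip x by (intro sum.mono_neutral_cong_right) (auto simp: a_def)
    also have "\<dots> = (\<Sum>c\<in>C. h (c \<otimes> x))"
      by (rule sum.reindex_bij_witness[where j="\<lambda>y. y \<otimes> inv x" and i="\<lambda>c. c \<otimes> x"])
        (auto simp: m_assoc x C_closed)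
    finally show ?thesis .
  qed
  obtain S v where S: "finite S" "\<And>x. x \<in> carrier G \<Longrightarrow> f x = (\<Sum>r\<in>S. v r x)"
    "\<And>r x. r \<in> S \<Longrightarrow> x \<in> carrier G \<Longrightarrow> (\<Sum>y\<in>carrier G. a x y * v r y) = r * v r x"
    using real_diagonal[of f] by blast
  show thesis
  proof
    show "finite {r\<in>S. \<exists>x\<in>carrier G. v r x \<noteq> 0}" using S by simp
    show "eig r (v r)" if "r \<in> {r\<in>S. \<exists>x\<in>carrier G. v r x \<noteq> 0}" for r
      using S(3) that by (simp add: eig_def a)
    show "(\<Sum>r\<in>{r\<in>S. \<exists>x\<in>carrier G. v r x \<noteq> 0}. v r x) = f x" if "x \<in> carrier G" for x
      unfolding S(2)[OF that] using S(1) that by (intro sum.mono_neutral_left) auto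
  qed auto
qed

text \<open>The operator minus s kills the component at s and multiplies every other component by r
  - s, which is rational and nonzero; so the number of components drops while rationality of the sum
  is kept.\<close>

lemma eig_rational:
  assumes "finite S" "S \<subseteq> \<rat>" "\<And>r. r \<in> S \<Longrightarrow> eig r (v r)"
    "\<And>x. x \<in> carrier G \<Longrightarrow> (\<Sum>r\<in>S. v r x) \<in> \<rat>" "r \<in> S" "x \<in> carrier G"
  shows "v r x \<in> \<rat>"
  using assms
proof (induction S arbitrary: v r x rule: finite_induct)
  case (insert s S)
  have IH: "v r x \<in> \<rat>" if "r \<in> S" "x \<in> carrier G" for r x
  proof -
    have "(r - s) * v r x \<in> \<rat>"
    proof (rule insert.IH[of "\<lambda>r x. (r - s) * v r x"])
      show "eig r (\<lambda>x. (r - s) * v r x)" if "r \<in> S" for r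
        using insert.prems(2)[of r] that by (simp add: eig_def mult.left_commute flip: sum_distrib_left)
      show "(\<Sum>r\<in>S. (r - s) * v r x) \<in> \<rat>" if x: "x \<in> carrier G" for x
      proof -
        have "(\<Sum>r\<in>insert s S. (r - s) * v r x) = (\<Sum>r\<in>insert s S. (\<Sum>c\<in>C. v r (c \<otimes> x)) - s * v r x)"
          using insert.prems(2) x by (intro sum.cong) (auto simp: eig_def algebra_simps)
        also have "\<dots> = (\<Sum>c\<in>C. \<Sum>r\<in>insert s S. v r (c \<otimes> x)) - s * (\<Sum>r\<in>insert s S. v r x)"
          by (simp only: sum_subtractf sum_distrib_left sum.swap[of _ "insert s S"])
        also have "\<dots> \<in> \<rat>"
        proof (rule Rats_diff)
          show "(\<Sum>c\<in>C. \<Sum>r\<in>insert s S. v r (c \<otimes> x)) \<in> \<rat>"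
            using x C_closed by (intro Rats_sum insert.prems(3)) auto
          show "s * (\<Sum>r\<in>insert s S. v r x) \<in> \<rat>"
            using insert.prems(1) x by (intro Rats_mult insert.prems(3)) auto
        qed
        finally show ?thesis using insert.hyps by simp
      qed
    qed (use that insert in auto)
    moreover have "r - s \<in> \<rat>" "r \<noteq> s" using insert that by auto
    ultimately have "(r - s) * v r x / (r - s) \<in> \<rat>" by (intro Rats_divide)
    then show ?thesis using \<open>r \<noteq> s\<close> by simp
  qed
  show ?case
  proof (cases "r = s")
    case True
    have "(\<Sum>r\<in>insert s S. v r x) - (\<Sum>r\<in>S. v r x) \<in> \<rat>"
      using insert.prems(5) IH by (intro Rats_diff insert.prems(3) Rats_sum)
    then show ?thesis using insert.hyps True by simp
  next
    case False
    then show ?thesis using IH insert.prems by auto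
  qed
qed simp

end

context involution_class
begin

text \<open>Both sides equal the sum of F(x c x^-1) over all pairs of x in the group and c in
  \<open>C\<close>.\<close>

lemma sum_conj: "real (card C) * (\<Sum>x\<in>carrier G. F (x \<otimes> g \<otimes> inv x)) = real (card (carrier G)) * (\<Sum>c\<in>C. F c)"
proof -
  have "(\<Sum>x\<in>carrier G. F (x \<otimes> c \<otimes> inv x)) = (\<Sum>x\<in>carrier G. F (x \<otimes> g \<otimes> inv x))" if c: "c \<in> C" for c
  proof -
    obtain y where y: "y \<in> carrier G" "c = y \<otimes> g \<otimes> inv y" using c by (auto simp: C_def)
    have "(\<Sum>x\<in>carrier G. F (x \<otimes> c \<otimes> inv x)) = (\<Sum>x\<in>carrier G. F ((x \<otimes> y) \<otimes> g \<otimes> inv (x \<otimes> y)))"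
      using y g_closed by (intro sum.cong) (auto simp: m_assoc inv_mult_group)
    also have "\<dots> = (\<Sum>x\<in>carrier G. F (x \<otimes> g \<otimes> inv x))"
      using sum_right[OF y(1), of "\<lambda>x. F (x \<otimes> g \<otimes> inv x)"] by simp
    finally show ?thesis .
  qed
  then have "real (card C) * (\<Sum>x\<in>carrier G. F (x \<otimes> g \<otimes> inv x)) = (\<Sum>c\<in>C. \<Sum>x\<in>carrier G. F (x \<otimes> c \<otimes> inv x))"
    by simp
  also have "\<dots> = (\<Sum>x\<in>carrier G. \<Sum>c\<in>C. F (x \<otimes> c \<otimes> inv x))" by (rule sum.swap)
  also have "\<dots> = real (card (carrier G)) * (\<Sum>c\<in>C. F c)" using sum_C_conj[of _ F] by simp
  finally show ?thesis .
qed

text \<open>The unit for convolution. Splitting it into eigenfunctions \<open>e r\<close> splits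
  every function at once, since convolution with \<open>e r\<close> is the projection onto the
  eigenspace of r.\<close>

definition delta :: "'a \<Rightarrow> real" where "delta x = (if x = \<one> then 1 else 0)"

end

section \<open>Integrality of the eigencomponents\<close>

locale central_decomposition = involution_class +
  fixes S :: "real set" and e :: "real \<Rightarrow> 'a \<Rightarrow> real"
  assumes finite_S: "finite S" and eig_e: "r \<in> S \<Longrightarrow> eig r (e r)"
    and sum_e: "x \<in> carrier G \<Longrightarrow> (\<Sum>r\<in>S. e r x) = delta x"
    and e_nonzero: "r \<in> S \<Longrightarrow> \<exists>x\<in>carrier G. e r x \<noteq> 0"
begin

abbreviation "q \<equiv> real (card C)"

lemma eigD: "r \<in> S \<Longrightarrow> x \<in> carrier G \<Longrightarrow> (\<Sum>c\<in>C. e r (c \<otimes> x)) = r * e r x"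
  using eig_e by (simp add: eig_def)

text \<open>Conjugation permutes \<open>C\<close> and fixes \<open>delta\<close>, so it takes the
  decomposition of \<open>delta\<close> to another one, and decompositions are unique.
  \<open>e_inv\<close> follows the same pattern.\<close>

lemma e_conj:
  assumes "r \<in> S" "x \<in> carrier G" "y \<in> carrier G"
  shows "e r (y \<otimes> x \<otimes> inv y) = e r x"
proof -
  have "e r (y \<otimes> x \<otimes> inv y) - e r x = 0"
  proof (rule eig_unique[OF finite_S, of "\<lambda>r x. e r (y \<otimes> x \<otimes> inv y) - e r x"])
    fix r assume r: "r \<in> S"
    show "eig r (\<lambda>x. e r (y \<otimes> x \<otimes> inv y) - e r x)"
      unfolding eig_def
    proof
      fix x assume x: "x \<in> carrier G"
      have "(\<Sum>c\<in>C. e r (y \<otimes> (c \<otimes> x) \<otimes> inv y)) = (\<Sum>c\<in>C. e r ((y \<otimes> c \<otimes> inv y) \<otimes> (y \<otimes> x \<otimes> inv y)))"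
        using x assms(3) C_closed by (intro sum.cong) (auto simp: m_assoc cancel_left)
      also have "\<dots> = r * e r (y \<otimes> x \<otimes> inv y)"
        using sum_C_conj[OF assms(3), of "\<lambda>c. e r (c \<otimes> (y \<otimes> x \<otimes> inv y))"] eigD r x assms(3) by simp
      finally show "(\<Sum>c\<in>C. e r (y \<otimes> (c \<otimes> x) \<otimes> inv y) - e r (c \<otimes> x)) = r * (e r (y \<otimes> x \<otimes> inv y) - e r x)"
        using eigD[OF r x] by (simp add: sum_subtractf algebra_simps)
    qed
  next
    fix x assume x: "x \<in> carrier G"
    have "y \<otimes> x \<otimes> inv y = \<one> \<longleftrightarrow> x = \<one>"
      using x assms(3) by (metis inv_closed inv_solve_right l_cancel_one l_one m_closed one_closed r_cancel_one r_inv)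
    then show "(\<Sum>r\<in>S. e r (y \<otimes> x \<otimes> inv y) - e r x) = 0"
      using x assms(3) by (simp add: sum_subtractf sum_e delta_def)
  qed (use assms in auto)
  then show ?thesis by simp
qed

lemma e_commute:
  assumes "r \<in> S" "x \<in> carrier G" "y \<in> carrier G"
  shows "e r (x \<otimes> y) = e r (y \<otimes> x)"
  using e_conj[of r "x \<otimes> y" y] assms by (simp add: m_assoc)

lemma e_inv:
  assumes "r \<in> S" "x \<in> carrier G"
  shows "e r (inv x) = e r x"
proof -
  have "e r (inv x) - e r x = 0"
  proof (rule eig_unique[OF finite_S, of "\<lambda>r x. e r (inv x) - e r x"])
    fix r assume r: "r \<in> S"
    show "eig r (\<lambda>x. e r (inv x) - e r x)"
      unfolding eig_def
    proof
      fix x assume x: "x \<in> carrier G"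
      have "(\<Sum>c\<in>C. e r (inv (c \<otimes> x))) = (\<Sum>c\<in>C. e r (c \<otimes> inv x))"
        using x r C_closed by (intro sum.cong) (auto simp: inv_mult_group C_inv e_commute)
      then show "(\<Sum>c\<in>C. e r (inv (c \<otimes> x)) - e r (c \<otimes> x)) = r * (e r (inv x) - e r x)"
        using eigD[OF r x] eigD[OF r inv_closed[OF x]] by (simp add: sum_subtractf algebra_simps)
    qed
  next
    fix x assume x: "x \<in> carrier G"
    then show "(\<Sum>r\<in>S. e r (inv x) - e r x) = 0"
      by (simp add: sum_subtractf sum_e delta_def inv_eq_1_iff)
  qed (use assms in auto)
  then show ?thesis by simp
qed

text \<open>The value of \<open>e r\<close> at z x^-1 is obtained by pairing y \<mapsto> e r (y
  x^-1) with \<open>delta\<close> translated to z. When that \<open>delta\<close> is expanded into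
  the translated \<open>e s\<close>, orthogonality leaves only s = r.\<close>

lemma e_idempotent:
  assumes "r \<in> S" "x \<in> carrier G" "z \<in> carrier G"
  shows "(\<Sum>y\<in>carrier G. e r (x \<otimes> inv y) * e r (y \<otimes> inv z)) = e r (x \<otimes> inv z)"
proof -
  have eig_shift: "eig s (\<lambda>y. e s (y \<otimes> inv w))" if "s \<in> S" "w \<in> carrier G" for s w
    using eigD[OF that(1)] that C_closed by (simp add: eig_def m_assoc)
  have flip: "e r (x \<otimes> inv y) = e r (y \<otimes> inv x)" if "x \<in> carrier G" "y \<in> carrier G" for x y
    using e_inv[of r "x \<otimes> inv y"] assms(1) that by (simp add: inv_mult_group)
  have "e r (z \<otimes> inv x) = (\<Sum>y\<in>carrier G. if y = z then e r (y \<otimes> inv x) else 0)"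
    using finite_carrier assms by simp
  also have "\<dots> = (\<Sum>y\<in>carrier G. e r (y \<otimes> inv x) * delta (y \<otimes> inv z))"
  proof (rule sum.cong[OF refl])
    fix y assume "y \<in> carrier G"
    moreover from this have "y \<otimes> inv z = \<one> \<longleftrightarrow> y = z"
      using assms(3) by (metis inv_equality inv_inv r_inv inv_closed)
    ultimately show "(if y = z then e r (y \<otimes> inv x) else 0) = e r (y \<otimes> inv x) * delta (y \<otimes> inv z)"
      by (simp add: delta_def)
  qed
  also have "\<dots> = (\<Sum>y\<in>carrier G. \<Sum>s\<in>S. e r (y \<otimes> inv x) * e s (y \<otimes> inv z))"
    using assms(3) by (intro sum.cong) (auto simp: sum_e simp flip: sum_distrib_left)
  also have "\<dots> = (\<Sum>s\<in>S. \<Sum>y\<in>carrier G. e r (y \<otimes> inv x) * e s (y \<otimes> inv z))"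
    by (rule sum.swap)
  also have "\<dots> = (\<Sum>s\<in>S. if s = r then (\<Sum>y\<in>carrier G. e r (y \<otimes> inv x) * e r (y \<otimes> inv z)) else 0)"
  proof (rule sum.cong[OF refl])
    fix s assume "s \<in> S"
    then show "(\<Sum>y\<in>carrier G. e r (y \<otimes> inv x) * e s (y \<otimes> inv z)) =
       (if s = r then (\<Sum>y\<in>carrier G. e r (y \<otimes> inv x) * e r (y \<otimes> inv z)) else 0)"
      using eig_orthogonal[OF eig_shift[OF assms(1,2)] eig_shift[OF _ assms(3)]] by auto
  qed
  also have "\<dots> = (\<Sum>y\<in>carrier G. e r (y \<otimes> inv x) * e r (y \<otimes> inv z))"
    using finite_S assms(1) by simp
  also have "\<dots> = (\<Sum>y\<in>carrier G. e r (x \<otimes> inv y) * e r (y \<otimes> inv z))"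
    using assms(2) by (intro sum.cong) (auto simp: flip)
  finally show ?thesis using flip assms by simp
qed

lemma e_one: "r \<in> S \<Longrightarrow> e r \<one> = (\<Sum>y\<in>carrier G. (e r y)\<^sup>2)"
  using e_idempotent[of r \<one> \<one>] e_inv by (simp add: power2_eq_square)

lemma e_one_pos: "r \<in> S \<Longrightarrow> e r \<one> > 0"
proof -
  assume r: "r \<in> S"
  then obtain x where "x \<in> carrier G" "e r x \<noteq> 0" using e_nonzero by blast
  then show ?thesis unfolding e_one[OF r] using finite_carrier
    by (intro sum_pos2[of _ x]) auto
qed

text \<open>The map x \<mapsto> u x w squares to the identity and commutes with the projection given
  by \<open>e r\<close>, because \<open>e r\<close> is a class function. The pairs (u, w) used later
  are (1, 1), (g, 1) and (g, g).\<close>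

lemma trace_Ints:
  assumes r: "r \<in> S" and u: "u \<in> carrier G" "u \<otimes> u = \<one>" and w: "w \<in> carrier G" "w \<otimes> w = \<one>"
  shows "(\<Sum>x\<in>carrier G. e r (u \<otimes> x \<otimes> w \<otimes> inv x)) \<in> \<int>"
proof -
  define P where "P = (\<lambda>x y. e r (x \<otimes> inv y))"
  define Q where "Q = (\<lambda>x y. e r (u \<otimes> x \<otimes> w \<otimes> inv y))"
  have iu: "inv u = u" and iw: "inv w = w" using u w by (auto intro: inv_equality)
  have uc: "u \<otimes> (u \<otimes> x) = x" if "x \<in> carrier G" for x using u that by (simp flip: m_assoc)
  have wc: "w \<otimes> (w \<otimes> x) = x" if "x \<in> carrier G" for x using w that by (simp flip: m_assoc)
  have sub: "(\<Sum>y\<in>carrier G. f y) = (\<Sum>y\<in>carrier G. f (u \<otimes> y \<otimes> w))" for f :: "'a \<Rightarrow> real"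
    using sum_left[OF u(1), of "\<lambda>y. f (y \<otimes> w)"] sum_right[OF w(1), of f] by simp
  have PP: "(\<Sum>y\<in>carrier G. P x y * P y z) = P x z" if "x \<in> carrier G" "z \<in> carrier G" for x z
    using e_idempotent[OF r that] by (simp add: P_def)
  have QP: "(\<Sum>y\<in>carrier G. Q x y * P y z) = Q x z" if "x \<in> carrier G" "z \<in> carrier G" for x z
    using e_idempotent[OF r, of "u \<otimes> x \<otimes> w" z] that u w by (simp add: P_def Q_def)
  have Pu: "P x (u \<otimes> y \<otimes> w) = Q x y" if "x \<in> carrier G" "y \<in> carrier G" for x y
  proof -
    have "P x (u \<otimes> y \<otimes> w) = e r ((x \<otimes> w \<otimes> inv y) \<otimes> u)"
      using that u(1) w(1) by (simp add: P_def inv_mult_group iu iw m_assoc)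
    also have "\<dots> = e r (u \<otimes> (x \<otimes> w \<otimes> inv y))" using that u(1) w(1) r by (intro e_commute) auto
    finally show ?thesis using that u(1) w(1) by (simp add: Q_def m_assoc)
  qed
  have uPw: "P (u \<otimes> y \<otimes> w) z = Q y z" for y z by (simp add: P_def Q_def)
  have Quw: "Q (u \<otimes> y \<otimes> w) z = P y z" if "y \<in> carrier G" "z \<in> carrier G" for y z
    using that u(1) w by (simp add: P_def Q_def m_assoc uc wc)
  have PQ: "(\<Sum>y\<in>carrier G. P x y * Q y z) = Q x z" if "x \<in> carrier G" "z \<in> carrier G" for x z
    using QP[OF that] sub[of "\<lambda>y. P x y * Q y z"] that by (simp add: Pu Quw)
  have Qu: "Q x (u \<otimes> y \<otimes> w) = P x y" if "x \<in> carrier G" "y \<in> carrier G" for x y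
    using Pu[of "u \<otimes> x \<otimes> w" y] Quw[of x y] that u(1) w(1) by (simp add: uPw)
  have QQ: "(\<Sum>y\<in>carrier G. Q x y * Q y z) = P x z" if "x \<in> carrier G" "z \<in> carrier G" for x z
    using PP[OF that] sub[of "\<lambda>y. Q x y * Q y z"] that by (simp add: Qu Quw)
  \<comment> \<open>\<open>Q\<close> is the projection \<open>P\<close> followed by a commuting involution, so its trace is that of an
    idempotent up to integers.\<close>
  have "(\<Sum>x\<in>carrier G. (P x x + Q x x) / 2) \<in> \<nat>"
  proof (rule idempotent_trace_Nats[where P="\<lambda>x y. (P x y + Q x y) / 2", OF finite_carrier])
    fix x z assume xz: "x \<in> carrier G" "z \<in> carrier G"
    have "(\<Sum>y\<in>carrier G. (P x y + Q x y) / 2 * ((P y z + Q y z) / 2)) =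
      ((\<Sum>y\<in>carrier G. P x y * P y z) + (\<Sum>y\<in>carrier G. P x y * Q y z)
      + (\<Sum>y\<in>carrier G. Q x y * P y z) + (\<Sum>y\<in>carrier G. Q x y * Q y z)) / 4"
      by (simp add: algebra_simps sum.distrib sum_divide_distrib add_divide_distrib)
    also have "\<dots> = (P x z + Q x z) / 2" using xz by (simp add: PP PQ QP QQ)
    finally show "(\<Sum>y\<in>carrier G. (P x y + Q x y) / 2 * ((P y z + Q y z) / 2)) = (P x z + Q x z) / 2" .
  qed
  moreover have "(\<Sum>x\<in>carrier G. P x x) \<in> \<nat>"
    by (rule idempotent_trace_Nats[OF finite_carrier PP])
  ultimately have "2 * (\<Sum>x\<in>carrier G. (P x x + Q x x) / 2) - (\<Sum>x\<in>carrier G. P x x) \<in> \<int>"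
    by (intro Ints_diff Ints_mult) (auto simp: Nats_subset_Ints[THEN subsetD])
  also have "2 * (\<Sum>x\<in>carrier G. (P x x + Q x x) / 2) - (\<Sum>x\<in>carrier G. P x x) = (\<Sum>x\<in>carrier G. Q x x)"
    by (simp add: sum.distrib add_divide_distrib flip: sum_divide_distrib)
  finally show ?thesis by (simp add: Q_def)
qed

definition t :: "real \<Rightarrow> real" where "t r = real (card (carrier G)) * e r g"

lemma card_G_pos: "real (card (carrier G)) > 0"
  using finite_carrier one_closed card_gt_0_iff by fastforce

lemma e_on_C: "r \<in> S \<Longrightarrow> c \<in> C \<Longrightarrow> e r c = e r g"
  using e_conj g_closed by (auto simp: C_def)

text \<open>This is the eigenvalue equation at \<open>\<one>\<close>; for characters it reads r =
  |C|\<chi>(g)/\<chi>(1).\<close>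

lemma e_g: "r \<in> S \<Longrightarrow> q * e r g = r * e r \<one>"
  using eigD[of r \<one>] e_on_C C_closed by simp

lemma t_Ints: "r \<in> S \<Longrightarrow> t r \<in> \<int>"
  using trace_Ints[of r g \<one>] g_closed g_square by (simp add: t_def m_assoc)

lemma eigenvalue_Rats: "r \<in> S \<Longrightarrow> r \<in> \<rat>"
proof -
  assume r: "r \<in> S"
  define d where "d = real (card (carrier G)) * e r \<one>"
  have "d \<in> \<int>" using trace_Ints[of r \<one> \<one>] r by (simp add: d_def)
  moreover have "d \<noteq> 0" using e_one_pos[OF r] card_G_pos by (simp add: d_def)
  moreover have "r = q * t r / d"
    using e_g[OF r] \<open>d \<noteq> 0\<close> by (simp add: d_def t_def field_simps)
  ultimately show ?thesis using t_Ints[OF r]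
    by (metis Ints_subset_Rats Rats_divide Rats_mult Rats_of_nat subsetD)
qed

text \<open>Some nonzero multiple D of \<open>e r\<close> has integer values. Applying the operator
  m times keeps the values integral and multiplies them by the m-th power of r, so the powers of r
  have a common denominator.\<close>

lemma eigenvalue_Ints:
  assumes r: "r \<in> S"
  shows "r \<in> \<int>"
proof -
  have "e r x \<in> \<rat>" if "x \<in> carrier G" for x
    by (rule eig_rational[OF finite_S]) (use eigenvalue_Rats eig_e r that in \<open>auto simp: sum_e delta_def\<close>)
  then obtain D where D: "D \<in> \<int>" "D \<noteq> 0" "\<And>x. x \<in> carrier G \<Longrightarrow> D * e r x \<in> \<int>"
    using common_denominator[OF finite_carrier, of "e r"] by blast
  have "r ^ m * (D * e r x) \<in> \<int>" if "x \<in> carrier G" for m x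
    using that
  proof (induction m arbitrary: x)
    case (Suc m)
    have "r ^ Suc m * (D * e r x) = r ^ m * D * (\<Sum>c\<in>C. e r (c \<otimes> x))"
      using eigD[OF r Suc.prems] by simp
    also have "\<dots> = (\<Sum>c\<in>C. r ^ m * (D * e r (c \<otimes> x)))" by (simp add: sum_distrib_left algebra_simps)
    also have "\<dots> \<in> \<int>" using Suc C_closed by (intro Ints_sum) auto
    finally show ?case .
  qed (use D in auto)
  then show ?thesis
    using Ints_of_bounded_denominator_powers[of r "D * e r \<one>"] eigenvalue_Rats[OF r] D e_one_pos[OF r] by auto
qed

text \<open>Used for \<epsilon> = 1 and \<epsilon> = -1: the sum of squares being nonnegative bounds
  |r| by \<open>q\<close>, and equality makes every c in \<open>C\<close> act on \<open>e r\<close>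
  as the sign \<epsilon>.\<close>

lemma square_deviation:
  assumes r: "r \<in> S" and "\<epsilon>\<^sup>2 = (1::real)"
  shows "(\<Sum>x\<in>carrier G. \<Sum>c\<in>C. (e r (c \<otimes> x) - \<epsilon> * e r x)\<^sup>2) = 2 * (q - \<epsilon> * r) * e r \<one>"
proof -
  have "(\<Sum>x\<in>carrier G. \<Sum>c\<in>C. (e r (c \<otimes> x) - \<epsilon> * e r x)\<^sup>2) =
    (\<Sum>x\<in>carrier G. \<Sum>c\<in>C. (e r (c \<otimes> x))\<^sup>2) + (\<Sum>x\<in>carrier G. \<Sum>c\<in>C. (e r x)\<^sup>2)
     - 2 * \<epsilon> * (\<Sum>x\<in>carrier G. e r x * (\<Sum>c\<in>C. e r (c \<otimes> x)))"
    using assms(2) by (simp add: power2_diff power_mult_distrib sum.distrib sum_subtractf sum_distrib_left algebra_simps)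
  also have "(\<Sum>x\<in>carrier G. \<Sum>c\<in>C. (e r (c \<otimes> x))\<^sup>2) = (\<Sum>c\<in>C. \<Sum>x\<in>carrier G. (e r (c \<otimes> x))\<^sup>2)"
    by (rule sum.swap)
  also have "\<dots> = q * e r \<one>"
    using sum_left[of _ "\<lambda>x. (e r x)\<^sup>2"] C_closed by (simp add: e_one[OF r])
  also have "(\<Sum>x\<in>carrier G. \<Sum>c\<in>C. (e r x)\<^sup>2) = q * e r \<one>"
    by (simp add: e_one[OF r] sum_distrib_left)
  also have "(\<Sum>x\<in>carrier G. e r x * (\<Sum>c\<in>C. e r (c \<otimes> x))) = r * e r \<one>"
    using eigD[OF r] by (simp add: e_one[OF r] sum_distrib_left power2_eq_square algebra_simps)
  finally show ?thesis by (simp add: algebra_simps)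
qed

lemma eigenvalue_bound: "r \<in> S \<Longrightarrow> \<bar>r\<bar> \<le> q"
proof -
  assume r: "r \<in> S"
  have "0 \<le> 2 * (q - \<epsilon> * r) * e r \<one>" if "\<epsilon>\<^sup>2 = 1" for \<epsilon>
    using square_deviation[OF r that] by (metis (no_types, lifting) sum_nonneg zero_le_power2)
  from this[of 1] this[of "-1"] e_one_pos[OF r] show ?thesis
    by (auto simp: zero_le_mult_iff abs_le_iff)
qed

lemma extreme_eigenfunction:
  assumes r: "r \<in> S" "r = \<epsilon> * q" "\<epsilon>\<^sup>2 = 1" "c \<in> C" "x \<in> carrier G"
  shows "e r (c \<otimes> x) = \<epsilon> * e r x"
proof -
  have "(\<Sum>x\<in>carrier G. \<Sum>c\<in>C. (e r (c \<otimes> x) - \<epsilon> * e r x)\<^sup>2) = 0"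
    using square_deviation[OF r(1,3)] r(2,3) by (simp add: power2_eq_square mult.assoc[symmetric])
  then have "(\<Sum>c\<in>C. (e r (c \<otimes> x) - \<epsilon> * e r x)\<^sup>2) = 0"
    using finite_carrier assms(5) by (subst (asm) sum_nonneg_eq_0_iff) (auto intro: sum_nonneg)
  then have "(e r (c \<otimes> x) - \<epsilon> * e r x)\<^sup>2 = 0"
    using finite_C assms(4) by (subst (asm) sum_nonneg_eq_0_iff) auto
  then show ?thesis by simp
qed

text \<open>In character language the periods are the common kernel of the characters that make up
  \<open>e r\<close>. Normality comes from \<open>e r\<close> being a class function.\<close>

lemma period_normal:
  assumes r: "r \<in> S"
  shows "{x\<in>carrier G. \<forall>y\<in>carrier G. e r (x \<otimes> y) = e r y} \<lhd> G" (is "?H \<lhd> G")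
proof -
  have "subgroup ?H G"
  proof (rule subgroupI)
    show "?H \<noteq> {}" by (auto intro!: exI[of _ \<one>])
    show "inv a \<in> ?H" if "a \<in> ?H" for a
    proof -
      have a: "a \<in> carrier G" "\<And>y. y \<in> carrier G \<Longrightarrow> e r (a \<otimes> y) = e r y" using that by auto
      have "e r (inv a \<otimes> y) = e r y" if "y \<in> carrier G" for y
        using a(2)[of "inv a \<otimes> y"] a(1) that by (simp add: cancel_left)
      then show ?thesis using a by simp
    qed
    show "a \<otimes> b \<in> ?H" if "a \<in> ?H" "b \<in> ?H" for a b
      using that by (auto simp: m_assoc)
  qed auto
  then show ?thesis unfolding normal_inv_iff
  proof safe
    fix x h y assume x: "x \<in> carrier G" and h: "h \<in> carrier G" "\<forall>y\<in>carrier G. e r (h \<otimes> y) = e r y"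
      and y: "y \<in> carrier G"
    have "e r (x \<otimes> h \<otimes> inv x \<otimes> y) = e r (x \<otimes> (h \<otimes> (inv x \<otimes> y \<otimes> x)) \<otimes> inv x)"
      using x h y by (simp add: m_assoc)
    also have "\<dots> = e r (h \<otimes> (inv x \<otimes> y \<otimes> x))" using x h y r by (intro e_conj) auto
    also have "\<dots> = e r (inv x \<otimes> y \<otimes> x)" using h x y by auto
    also have "\<dots> = e r y" using e_conj[OF r y inv_closed[OF x]] x by simp
    finally show "e r (x \<otimes> h \<otimes> inv x \<otimes> y) = e r y" .
  qed auto
qed

end

text \<open>The values \<open>t r\<close> add up to |G| delta(g) = 0. In a simple group the term at
  r = \<open>q\<close> is 1 and all other terms are divisible by p, so p would divide 1.\<close>

theorem (in involution_class) prime_power_class_not_simple: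
  assumes p: "prime p" "card C = p ^ k" "k > 0"
  shows "\<exists>H. H \<lhd> G \<and> H \<noteq> {\<one>} \<and> H \<noteq> carrier G"
proof (rule ccontr)
  assume "\<not> ?thesis"
  then have simple: "H = {\<one>} \<or> H = carrier G" if "H \<lhd> G" for H using that by blast
  obtain S e where "finite S" "\<And>r. r \<in> S \<Longrightarrow> eig r (e r)"
    "\<And>x. x \<in> carrier G \<Longrightarrow> (\<Sum>r\<in>S. e r x) = delta x"
    "\<And>r. r \<in> S \<Longrightarrow> \<exists>x\<in>carrier G. e r x \<noteq> 0" using eig_decomposition[of delta] by blast
  then interpret central_decomposition G g S e by unfold_locales auto
  have q_gt_1: "q > 1" using p prime_gt_1_nat[of p] by (simp add: one_less_power)
  have g_neq: "g \<noteq> \<one>"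
  proof
    assume "g = \<one>"
    then have "C \<subseteq> {\<one>}" unfolding C_def by auto
    then have "card C \<le> 1" using card_mono[of "{\<one>}" C] by simp
    then show False using q_gt_1 by simp
  qed
  \<comment> \<open>The element g is a period of \<open>e q\<close>, so simplicity makes every
    element one and \<open>e q\<close> is constant. Idempotency then fixes the constant.\<close>
  have top: "e q x = 1 / real (card (carrier G))" if "q \<in> S" "x \<in> carrier G" for x
  proof -
    let ?H = "{x\<in>carrier G. \<forall>y\<in>carrier G. e q (x \<otimes> y) = e q y}"
    have "g \<in> ?H" using extreme_eigenfunction[OF that(1), of 1 g] g_in_C g_closed by simp
    then have "?H = carrier G" using simple[OF period_normal[OF that(1)]] g_neq by blast
    then have const: "e q x = e q \<one>" if "x \<in> carrier G" for x
      using that by (metis (mono_tags, lifting) mem_Collect_eq one_closed r_one)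
    have "e q \<one> = (\<Sum>y\<in>carrier G. (e q y)\<^sup>2)" by (rule e_one[OF that(1)])
    also have "\<dots> = (\<Sum>y\<in>carrier G. (e q \<one>)\<^sup>2)"
    proof (rule sum.cong[OF refl])
      fix y assume "y \<in> carrier G"
      then show "(e q y)\<^sup>2 = (e q \<one>)\<^sup>2" by (simp only: const)
    qed
    finally have "1 = real (card (carrier G)) * e q \<one>"
      using e_one_pos[OF that(1)] by (simp add: power2_eq_square)
    then show ?thesis using const[OF that(2)] card_G_pos by (simp add: field_simps)
  qed
  \<comment> \<open>The constant function 1 has eigenvalue \<open>q\<close>. If \<open>q\<close>
    were missing from \<open>S\<close>, it would be orthogonal to every component and hence to
    \<open>delta\<close>, whose values add up to 1.\<close>
  have q_in: "q \<in> S"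
  proof (rule ccontr)
    assume "q \<notin> S"
    have "eig q (\<lambda>_. 1)" by (simp add: eig_def)
    then have "(\<Sum>x\<in>carrier G. e r x) = 0" if "r \<in> S" for r
      using eig_orthogonal[OF eig_e[OF that], of q "\<lambda>_. 1"] \<open>q \<notin> S\<close> that by auto
    then have "(\<Sum>r\<in>S. \<Sum>x\<in>carrier G. e r x) = 0" by simp
    moreover have "(\<Sum>x\<in>carrier G. \<Sum>r\<in>S. e r x) = (\<Sum>r\<in>S. \<Sum>x\<in>carrier G. e r x)"
      by (rule sum.swap)
    ultimately have "(\<Sum>x\<in>carrier G. \<Sum>r\<in>S. e r x) = 0" by simp
    then have "(\<Sum>x\<in>carrier G. delta x) = 0" by (simp add: sum_e)
    then show False using finite_carrier by (simp add: delta_def)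
  qed
  \<comment> \<open>For eigenvalue -q each element of \<open>C\<close> acts as -1, so g is not a
    period but every product g c is. Simplicity leaves only the trivial period, whence c =
    g.\<close>
  have bottom: "- q \<notin> S"
  proof
    assume m: "- q \<in> S"
    let ?r = "- q"
    have flip: "e ?r (c \<otimes> x) = - e ?r x" if "c \<in> C" "x \<in> carrier G" for c x
      using extreme_eigenfunction[OF m, of "-1" c x] that by simp
    let ?H = "{x\<in>carrier G. \<forall>y\<in>carrier G. e ?r (x \<otimes> y) = e ?r y}"
    have "?H \<noteq> carrier G"
    proof
      assume "?H = carrier G"
      then have "e ?r (g \<otimes> \<one>) = e ?r \<one>" using g_closed by blast
      then show False using flip[OF g_in_C one_closed] e_one_pos[OF m] by simp
    qed
    then have H1: "?H = {\<one>}" using simple[OF period_normal[OF m]] by blast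
    have "c = g" if c: "c \<in> C" for c
    proof -
      have "g \<otimes> c \<in> ?H" using flip g_in_C c C_closed by (auto simp: m_assoc)
      then have "g \<otimes> c = \<one>" using H1 by blast
      then show ?thesis using C_inv[OF g_in_C] C_closed[OF c] g_closed
        by (metis inv_equality inv_inv)
    qed
    then have "C \<subseteq> {g}" by blast
    then have "card C \<le> 1" using card_mono[of "{g}" C] by simp
    then show False using q_gt_1 by simp
  qed
  have p_dvd: "\<exists>m::int. t r = of_int (int p * m)" if r: "r \<in> S - {q}" for r
  proof -
    have rS: "r \<in> S" "r \<noteq> q" "r \<noteq> - q" using r bottom by auto
    obtain l :: int where l: "r = of_int l" using eigenvalue_Ints[OF rS(1)] by (elim Ints_cases)
    obtain n :: int where n: "t r = of_int n" using t_Ints[OF rS(1)] by (elim Ints_cases)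
    define s where "s = (\<Sum>x\<in>carrier G. e r (g \<otimes> x \<otimes> g \<otimes> inv x))"
    obtain i :: int where i: "s = of_int i"
      using trace_Ints[OF rS(1) g_closed g_square g_closed g_square] unfolding s_def by (elim Ints_cases)
    have "q * s = real (card (carrier G)) * (\<Sum>c\<in>C. e r (g \<otimes> c))"
      using sum_conj[of "\<lambda>c. e r (g \<otimes> c)"] g_closed by (simp add: s_def m_assoc)
    also have "(\<Sum>c\<in>C. e r (g \<otimes> c)) = (\<Sum>c\<in>C. e r (c \<otimes> g))"
      using e_commute rS g_closed C_closed by (intro sum.cong) auto
    also have "\<dots> = r * e r g" using eigD rS g_closed by simp
    \<comment> \<open>All three of \<open>s\<close>, \<open>r\<close>, \<open>t r\<close> are integers and \<open>\<bar>r\<bar> < q\<close>, which forces \<open>p\<close> into \<open>t r\<close>.\<close>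
    finally have "q * s = r * t r" by (simp add: t_def)
    then have "of_int (int (p ^ k) * i) = (of_int (l * n) :: real)" using p i l n by simp
    then have eq: "int (p ^ k) * i = l * n" using of_int_eq_iff by blast
    show ?thesis
    proof (cases "int p dvd n")
      case True then show ?thesis using n by (auto elim!: dvdE)
    next
      case False
      have "prime (int p)" using p by simp
      then have "coprime (int p ^ k) n" using False by (simp add: prime_imp_coprime)
      moreover have "int p ^ k dvd l * n" using eq by (metis dvd_triv_left of_nat_power)
      ultimately have "int p ^ k dvd l" by (simp add: coprime_dvd_mult_left_iff)
      moreover have "\<bar>l\<bar> < int p ^ k"
      proof -
        have "\<bar>r\<bar> < q" using eigenvalue_bound[OF rS(1)] rS by linarith
        then have "of_int \<bar>l\<bar> < (of_int (int p ^ k) :: real)" using p l by simp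
        then show ?thesis by linarith
      qed
      ultimately have "l = 0" by (meson dvd_imp_le_int linorder_not_le abs_ge_self order_trans)
      then have "t r = 0" using e_g[OF rS(1)] l q_gt_1 by (simp add: t_def)
      then show ?thesis by (intro exI[of _ 0]) simp
    qed
  qed
  then obtain m where m: "\<And>r. r \<in> S - {q} \<Longrightarrow> t r = of_int (int p * m r)" by metis
  have "0 = real (card (carrier G)) * delta g" using g_neq by (simp add: delta_def)
  also have "\<dots> = (\<Sum>r\<in>S. t r)" using g_closed by (simp add: t_def sum_e flip: sum_distrib_left)
  also have "\<dots> = t q + (\<Sum>r\<in>S-{q}. t r)" using finite_S q_in by (simp add: sum.remove)
  also have "\<dots> = 1 + (\<Sum>r\<in>S-{q}. of_int (int p * m r))"
    using top[OF q_in g_closed] card_G_pos m by (simp add: t_def)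
  also have "\<dots> = of_int (1 + int p * (\<Sum>r\<in>S-{q}. m r))" by (simp add: sum_distrib_left)
  finally have "1 + int p * (\<Sum>r\<in>S-{q}. m r) = 0" by (metis of_int_eq_0_iff)
  then have "int p dvd 1" by (metis add.commute add_eq_0_iff dvd_minus_iff dvd_triv_left)
  then show False using p(1) by (simp add: prime_nat_iff)
qed

section \<open>Groups of order $2^a 3^b$\<close>

locale finite_action = group G for G (structure) +
  fixes act :: "'a \<Rightarrow> 'x \<Rightarrow> 'x" and X :: "'x set"
  assumes finite_carrier: "finite (carrier G)" and finite_X: "finite X"
    and act_closed: "\<lbrakk>g \<in> carrier G; x \<in> X\<rbrakk> \<Longrightarrow> act g x \<in> X"
    and act_one: "x \<in> X \<Longrightarrow> act \<one> x = x"
    and act_mult: "\<lbrakk>g \<in> carrier G; h \<in> carrier G; x \<in> X\<rbrakk> \<Longrightarrow> act (g \<otimes> h) x = act g (act h x)"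
begin

definition orb :: "'x \<Rightarrow> 'x set" where "orb x = (\<lambda>g. act g x) ` carrier G"

definition stab :: "'x \<Rightarrow> 'a set" where "stab x = {g \<in> carrier G. act g x = x}"

lemma act_inv: "\<lbrakk>g \<in> carrier G; x \<in> X\<rbrakk> \<Longrightarrow> act (inv g) (act g x) = x"
  by (metis act_mult act_one inv_closed l_inv)

lemma subgroup_stab: "x \<in> X \<Longrightarrow> subgroup (stab x) G"
proof (rule subgroupI)
  assume x: "x \<in> X"
  show "inv a \<in> stab x" if "a \<in> stab x" for a
    using that act_inv[of a x] x by (auto simp: stab_def)
  show "a \<otimes> b \<in> stab x" if "a \<in> stab x" "b \<in> stab x" for a b
    using that x by (auto simp: stab_def act_mult)
  show "stab x \<noteq> {}" using act_one x by (auto simp: stab_def)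
qed (auto simp: stab_def)

lemma orb_subset: "x \<in> X \<Longrightarrow> orb x \<subseteq> X"
  by (auto simp: orb_def act_closed)

lemma orb_self: "x \<in> X \<Longrightarrow> x \<in> orb x"
  unfolding orb_def by (rule image_eqI[of _ _ \<one>]) (auto simp: act_one)

lemma orb_eq: "x \<in> X \<Longrightarrow> y \<in> orb x \<Longrightarrow> orb y = orb x"
proof -
  assume x: "x \<in> X" and "y \<in> orb x"
  then obtain g where g: "g \<in> carrier G" "y = act g x" by (auto simp: orb_def)
  show "orb y = orb x"
  proof
    show "orb y \<subseteq> orb x" using g x by (auto simp: orb_def simp flip: act_mult)
    have "act h x = act (h \<otimes> inv g) y" if "h \<in> carrier G" for h
      using g x that by (simp add: act_mult act_inv act_closed)
    then show "orb x \<subseteq> orb y" unfolding orb_def using g(1) by (metis image_subsetI inv_closed m_closed rev_image_eqI)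
  qed
qed

lemma orb_disjoint: "x \<in> X \<Longrightarrow> y \<in> X \<Longrightarrow> orb x \<noteq> orb y \<Longrightarrow> orb x \<inter> orb y = {}"
  using orb_eq by blast

lemma orbit_stabilizer: "x \<in> X \<Longrightarrow> card (orb x) * card (stab x) = card (carrier G)"
proof -
  assume x: "x \<in> X"
  have "card {g \<in> carrier G. act g x = y} = card (stab x)" if "y \<in> orb x" for y
  proof -
    obtain u where u: "u \<in> carrier G" "y = act u x" using \<open>y \<in> orb x\<close> by (auto simp: orb_def)
    have "bij_betw (\<lambda>g. u \<otimes> g) (stab x) {g \<in> carrier G. act g x = y}"
    proof (rule bij_betw_byWitness[where f'="\<lambda>g. inv u \<otimes> g"])
      show "\<forall>a\<in>stab x. inv u \<otimes> (u \<otimes> a) = a" using u by (auto simp: stab_def simp flip: m_assoc)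
      show "\<forall>a\<in>{g \<in> carrier G. act g x = y}. u \<otimes> (inv u \<otimes> a) = a"
        using u by (auto simp flip: m_assoc)
      show "(\<otimes>) u ` stab x \<subseteq> {g \<in> carrier G. act g x = y}" using u x by (auto simp: stab_def act_mult)
      show "(\<otimes>) (inv u) ` {g \<in> carrier G. act g x = y} \<subseteq> stab x"
        using u x act_inv by (auto simp: stab_def act_mult)
    qed
    then show ?thesis by (metis bij_betw_same_card)
  qed
  moreover have "card (carrier G) = (\<Sum>y\<in>orb x. card {g \<in> carrier G. act g x = y})"
    using sum.image_gen[OF finite_carrier, of "\<lambda>_. 1::nat" "\<lambda>g. act g x"] by (simp add: orb_def)
  ultimately show ?thesis by simp
qed

lemma subgroup_action: "subgroup H G \<Longrightarrow> finite_action (G\<lparr>carrier := H\<rparr>) act X"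
proof -
  assume H: "subgroup H G"
  interpret H: group "G\<lparr>carrier := H\<rparr>" using H subgroup.subgroup_is_group group_axioms by blast
  show ?thesis
    by unfold_locales (use subgroup.subset[OF H] finite_carrier finite_X in
        \<open>auto simp: act_closed act_one act_mult finite_subset subset_iff\<close>)
qed

text \<open>The moved points split into orbits whose sizes are powers of p greater than 1.\<close>

lemma p_group_fixed_points:
  assumes "prime p" "card (carrier G) = p ^ n"
  shows "p dvd card (X - {x\<in>X. \<forall>g\<in>carrier G. act g x = x})" (is "p dvd card (X - ?F)")
proof -
  let ?O = "orb ` (X - ?F)"
  have "X - ?F \<subseteq> \<Union>?O" using orb_self by blast
  moreover have "\<Union>?O \<subseteq> X - ?F"
  proof
    fix y assume "y \<in> \<Union>?O"
    then obtain x where x: "x \<in> X" "y \<in> orb x" and nf: "\<not> (\<forall>g\<in>carrier G. act g x = x)" by blast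
    have "y \<in> X" using x orb_subset by blast
    moreover have False if "\<forall>g\<in>carrier G. act g y = y"
    proof -
      have "orb y = {y}" using that by (auto simp: orb_def)
      then have "orb x = {y}" using orb_eq x by blast
      then have "\<forall>g\<in>carrier G. act g x = x" using orb_self[OF x(1)] by (auto simp: orb_def)
      then show False using nf x by blast
    qed
    ultimately show "y \<in> X - {x \<in> X. \<forall>g\<in>carrier G. act g x = x}" by blast
  qed
  ultimately have U: "\<Union>?O = X - ?F" by blast
  have "p dvd card (\<Union>?O)"
  proof (rule dvd_partition)
    show "finite (\<Union>?O)" using U finite_X by simp
    show "\<forall>c\<in>?O. p dvd card c"
    proof
      fix c assume "c \<in> ?O"
      then obtain x where x: "x \<in> X" "\<not> (\<forall>g\<in>carrier G. act g x = x)" "c = orb x" by blast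
      then obtain g where "g \<in> carrier G" "act g x \<noteq> x" by blast
      moreover from this have "act g x \<in> orb x" by (auto simp: orb_def)
      ultimately have "card (orb x) \<noteq> 1" using orb_self[OF x(1)] by (metis card_1_singletonE singletonD)
      moreover have "card (orb x) dvd p ^ n"
        using orbit_stabilizer[OF x(1)] assms(2) by (metis dvd_triv_left)
      ultimately show "p dvd card c" using x(3) assms(1)
        by (metis divides_primepow_nat dvd_power power_0 neq0_conv)
    qed
    show "\<forall>c1\<in>?O. \<forall>c2\<in>?O. c1 \<noteq> c2 \<longrightarrow> c1 \<inter> c2 = {}" using orb_disjoint by blast
  qed
  then show ?thesis using U by simp
qed

text \<open>If the stabiliser of x in T has order p^j, then p^(i+j) divides the group order, hence
  also p^a = |T|. So the orbit of x under T has at least p^i points, which is the whole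
  orbit.\<close>

lemma sylow_orbit:
  assumes p: "prime p" "card (carrier G) = p ^ a * m" "\<not> p dvd m"
    and T: "subgroup T G" "card T = p ^ a" and x: "x \<in> X" "card (orb x) = p ^ i"
  shows "orb x = (\<lambda>g. act g x) ` T"
proof -
  interpret T: finite_action "G\<lparr>carrier := T\<rparr>" act X using subgroup_action[OF T(1)] .
  have TG: "T \<subseteq> carrier G" using subgroup.subset[OF T(1)] .
  have orbT: "T.orb x = (\<lambda>g. act g x) ` T" and stT: "T.stab x = T \<inter> stab x"
    using TG by (auto simp: T.orb_def T.stab_def stab_def)
  have p0: "p > 0" using p(1) prime_gt_0_nat by blast
  have os: "p ^ i * card (stab x) = p ^ a * m" using orbit_stabilizer[OF x(1)] x(2) p(2) by simp
  have oT: "card (T.orb x) * card (T.stab x) = p ^ a" using T.orbit_stabilizer[OF x(1)] T(2) by simp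
  then obtain j where j: "card (T.stab x) = p ^ j" using p(1) by (metis divides_primepow_nat dvd_triv_right)
  have "subgroup (T \<inter> stab x) G" using T(1) subgroup_stab[OF x(1)] by (rule subgroups_Inter_pair)
  then have "subgroup (T \<inter> stab x) (G\<lparr>carrier := stab x\<rparr>)"
    using subgroup_stab[OF x(1)] by (intro subgroup_incl) auto
  moreover have "group (G\<lparr>carrier := stab x\<rparr>)"
    using subgroup_stab[OF x(1)] subgroup.subgroup_is_group group_axioms by blast
  ultimately have "card (T \<inter> stab x) dvd card (stab x)"
    using group.lagrange[of "G\<lparr>carrier := stab x\<rparr>" "T \<inter> stab x"] by (simp add: order_def) (metis dvd_triv_right)
  then have "p ^ i * p ^ j dvd p ^ a * m" using os j stT by (metis mult_dvd_mono dvd_refl)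
  moreover have "coprime (p ^ (i + j)) m" using p by (simp add: prime_imp_coprime)
  ultimately have "p ^ (i + j) dvd p ^ a" by (simp add: coprime_dvd_mult_left_iff power_add)
  then have "p ^ i * p ^ j \<le> p ^ a" using p0 by (simp add: dvd_imp_le power_add)
  then have "p ^ i * p ^ j \<le> card (T.orb x) * p ^ j" using oT j by simp
  then have "p ^ i \<le> card (T.orb x)" using p0 by simp
  moreover have "T.orb x \<subseteq> orb x" using TG by (auto simp: orbT orb_def)
  moreover have "finite (orb x)" using finite_carrier by (simp add: orb_def)
  ultimately have "T.orb x = orb x" using x(2) card_seteq by metis
  then show ?thesis by (simp add: orbT)
qed

end

lemma dvd_two_three_power:
  assumes "(n::nat) dvd 2 ^ a * 3 ^ b"
  obtains i j where "n = 2 ^ i * 3 ^ j"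
proof -
  obtain u w where "n = u * w" "u dvd 2 ^ a" "w dvd 3 ^ b" using division_decomp[OF assms] by blast
  then show thesis using that divides_primepow_nat[of 2 u a] divides_primepow_nat[of 3 w b] by auto
qed

section \<open>Sylow subgroups and normal p-subgroups\<close>

context group
begin

lemma subgroup_card_dvd:
  assumes "subgroup H G" shows "card H dvd card (carrier G)"
  using lagrange[OF assms] by (metis dvd_triv_right order_def)

lemma subgroup_card_dvd_subgroup:
  assumes "subgroup H G" "subgroup K G" "H \<subseteq> K" shows "card H dvd card K"
proof -
  interpret K: group "G\<lparr>carrier := K\<rparr>" using assms(2) subgroup.subgroup_is_group group_axioms by blast
  show ?thesis using K.subgroup_card_dvd[OF subgroup_incl[OF assms]] by simp
qed

lemma cauchy:
  assumes "finite (carrier G)" "prime p" "p dvd card (carrier G)"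
  obtains x where "x \<in> carrier G" "x \<noteq> \<one>" "x [^] p = \<one>"
proof -
  \<comment> \<open>The exponent 1 gives a subgroup of order exactly p, even when higher powers of p
    divide the group order.\<close>
  obtain m where "order G = p ^ 1 * m" using assms(3) by (auto simp: order_def)
  then obtain H where H: "subgroup H G" "card H = p"
    using sylow_thm[of p G 1 m] assms group_axioms by auto
  have "card H > 1" using H assms(2) prime_gt_1_nat by simp
  then obtain x where x: "x \<in> H" "x \<noteq> \<one>"
    by (metis One_nat_def card.empty card.insert card_gt_0_iff equals0D finite.emptyI insertCI
        less_nat_zero_code not_less_iff_gr_or_eq subsetI subset_singletonD)
  interpret H: group "G\<lparr>carrier := H\<rparr>" using H(1) subgroup.subgroup_is_group group_axioms by blast
  have "x [^]\<^bsub>G\<lparr>carrier := H\<rparr>\<^esub> p = \<one>"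
    using H.pow_order_eq_1[of x] x H by (simp add: order_def)
  then have "x [^] p = \<one>" by (simp flip: nat_pow_consistent)
  moreover have "x \<in> carrier G" using x(1) subgroup.subset[OF H(1)] by blast
  ultimately show thesis using that x(2) by blast
qed

lemma conjugation_action:
  assumes "finite (carrier G)"
  shows "finite_action G (\<lambda>x y. x \<otimes> y \<otimes> inv x) (carrier G)"
  by unfold_locales (use assms in \<open>auto simp: m_assoc inv_mult_group\<close>)

text \<open>The centre is the fixed point set of conjugation, so p divides its order, and Cauchy's
  theorem is applied inside the centre.\<close>

lemma p_group_central_element:
  assumes "finite (carrier G)" "prime p" "card (carrier G) = p ^ n" "n > 0"
  obtains z where "z \<in> carrier G" "z \<noteq> \<one>" "z [^] p = \<one>" "\<And>x. x \<in> carrier G \<Longrightarrow> x \<otimes> z = z \<otimes> x"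
proof -
  interpret conj: finite_action G "\<lambda>x y. x \<otimes> y \<otimes> inv x" "carrier G"
    using conjugation_action[OF assms(1)] .
  define Z where "Z = {z \<in> carrier G. \<forall>x\<in>carrier G. x \<otimes> z = z \<otimes> x}"
  have "x \<otimes> z \<otimes> inv x = z \<longleftrightarrow> x \<otimes> z = z \<otimes> x" if "x \<in> carrier G" "z \<in> carrier G" for x z
    using that by (metis inv_closed inv_solve_right m_closed)
  then have Z_alt: "Z = {z \<in> carrier G. \<forall>x\<in>carrier G. x \<otimes> z \<otimes> inv x = z}" unfolding Z_def by blast
  have "subgroup Z G"
  proof (rule subgroupI)
    show "inv z \<in> Z" if "z \<in> Z" for z
    proof -
      have z: "z \<in> carrier G" "\<And>x. x \<in> carrier G \<Longrightarrow> x \<otimes> z = z \<otimes> x" using that by (auto simp: Z_def)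
      have "x \<otimes> inv z = inv z \<otimes> x" if "x \<in> carrier G" for x
        using z(2)[of "inv x"] z(1) that by (metis inv_closed inv_inv inv_mult_group)
      then show ?thesis using z(1) by (simp add: Z_def)
    qed
    show "y \<otimes> z \<in> Z" if "y \<in> Z" "z \<in> Z" for y z
    proof -
      have yz: "y \<in> carrier G" "z \<in> carrier G" "\<And>x. x \<in> carrier G \<Longrightarrow> x \<otimes> y = y \<otimes> x"
        "\<And>x. x \<in> carrier G \<Longrightarrow> x \<otimes> z = z \<otimes> x" using that by (auto simp: Z_def)
      have "x \<otimes> (y \<otimes> z) = y \<otimes> z \<otimes> x" if "x \<in> carrier G" for x
        using that yz by (metis m_assoc)
      then show ?thesis using yz(1,2) by (simp add: Z_def)
    qed
    show "Z \<noteq> {}" by (auto simp: Z_def intro!: exI[of _ \<one>])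
  qed (auto simp: Z_def)
  have "p dvd card (carrier G - Z)" using conj.p_group_fixed_points[OF assms(2,3)] by (simp add: Z_alt)
  moreover have "card (carrier G) = card (carrier G - Z) + card Z"
    using assms(1) \<open>subgroup Z G\<close> subgroup.subset
    by (metis add.commute card_Diff_subset card_mono finite_subset le_add_diff_inverse)
  moreover have "p dvd card (carrier G)" using assms by simp
  ultimately have "p dvd card Z" by (metis dvd_add_right_iff)
  interpret Z: group "G\<lparr>carrier := Z\<rparr>" using \<open>subgroup Z G\<close> subgroup.subgroup_is_group group_axioms by blast
  have "finite Z" using assms(1) by (simp add: Z_def)
  then obtain z where "z \<in> Z" "z \<noteq> \<one>" "z [^]\<^bsub>G\<lparr>carrier := Z\<rparr>\<^esub> p = \<one>"
    using Z.cauchy[of p] assms(2) \<open>p dvd card Z\<close> by auto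
  moreover from this have "z [^] p = \<one>" by (simp flip: nat_pow_consistent)
  ultimately show thesis using that[of z] unfolding Z_def by blast
qed

text \<open>Q acts on the left cosets of P. Their number m is prime to p, so Q fixes some coset hP,
  which means that h^-1 Q h lies in P.\<close>

lemma p_subgroup_conjugate_in_sylow:
  assumes fin: "finite (carrier G)" and p: "prime p" "card (carrier G) = p ^ c * m" "\<not> p dvd m"
    and P: "subgroup P G" "card P = p ^ c" and Q: "subgroup Q G" "card Q = p ^ n"
  obtains h where "h \<in> carrier G" "\<And>q. q \<in> Q \<Longrightarrow> inv h \<otimes> q \<otimes> h \<in> P"
proof -
  define X where "X = (\<lambda>h. h <# P) ` carrier G"
  have PG: "P \<subseteq> carrier G" using P subgroup.subset by blast
  have XG: "x \<subseteq> carrier G" if "x \<in> X" for x using that PG by (auto simp: X_def l_coset_def)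
  interpret X: finite_action G "l_coset G" X
    by unfold_locales (use fin XG PG in \<open>auto simp: X_def lcos_m_assoc lcos_mult_one\<close>)
  interpret Q: finite_action "G\<lparr>carrier := Q\<rparr>" "l_coset G" X using X.subgroup_action[OF Q(1)] .
  have PX: "P \<in> X" unfolding X_def using lcos_mult_one[OF PG] by (metis imageI one_closed)
  have stabP: "X.stab P = P"
  proof -
    have "h \<in> P" if "h \<in> carrier G" "h <# P = P" for h
    proof -
      have "h \<otimes> \<one> \<in> h <# P" using subgroup.one_closed[OF P(1)] by (auto simp: l_coset_def)
      then show ?thesis using that by simp
    qed
    moreover have "h <# P = P" if "h \<in> P" for h using that P(1) PG by (intro coset_join3) auto
    ultimately show ?thesis using PG by (auto simp: X.stab_def)
  qed
  have "X.orb P = X" by (auto simp: X.orb_def X_def)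
  then have "card X * p ^ c = p ^ c * m" using X.orbit_stabilizer[OF PX] stabP P(2) p(2) by simp
  then have cX: "card X = m" using p(1) prime_gt_0_nat[of p] by simp
  let ?F = "{x \<in> X. \<forall>g\<in>Q. g <# x = x}"
  have "p dvd card (X - ?F)" using Q.p_group_fixed_points[OF p(1)] Q(2) by simp
  then have "?F \<noteq> {}" using cX p(3) by force
  then obtain h where h: "h \<in> carrier G" "\<And>g. g \<in> Q \<Longrightarrow> g <# (h <# P) = h <# P" by (auto simp: X_def)
  show thesis
  proof (rule that[OF h(1)])
    fix q assume q: "q \<in> Q"
    then have qG: "q \<in> carrier G" using Q(1) subgroup.subset by blast
    have "(q \<otimes> h) <# P = h <# P" using h(2)[OF q] PG qG h(1) by (simp add: lcos_m_assoc)
    moreover have "q \<otimes> h \<in> (q \<otimes> h) <# P"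
      using subgroup.one_closed[OF P(1)] h qG by (auto simp: l_coset_def intro!: bexI[of _ \<one>])
    ultimately obtain y where y: "y \<in> P" "q \<otimes> h = h \<otimes> y" by (auto simp: l_coset_def)
    moreover have "y \<in> carrier G" using y(1) PG by blast
    ultimately have "inv h \<otimes> q \<otimes> h = y" using h(1) qG by (simp add: m_assoc) (simp flip: m_assoc)
    then show "inv h \<otimes> q \<otimes> h \<in> P" using y by simp
  qed
qed

lemma normal_p_subgroup_in_sylow:
  assumes fin: "finite (carrier G)" and p: "prime p" "card (carrier G) = p ^ c * m" "\<not> p dvd m"
    and P: "subgroup P G" "card P = p ^ c" and Q: "Q \<lhd> G" "card Q = p ^ n"
  shows "Q \<subseteq> P"
proof
  fix q assume q: "q \<in> Q"
  have Q': "subgroup Q G" using Q(1) normal_imp_subgroup by blast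
  obtain h where h: "h \<in> carrier G" "\<And>q. q \<in> Q \<Longrightarrow> inv h \<otimes> q \<otimes> h \<in> P"
    using p_subgroup_conjugate_in_sylow[OF fin p P Q' Q(2)] by blast
  have qG: "q \<in> carrier G" using q subgroup.subset[OF Q'] by blast
  have "h \<otimes> q \<otimes> inv h \<in> Q" using Q(1) normal_inv_iff q h(1) by blast
  then have "inv h \<otimes> (h \<otimes> q \<otimes> inv h) \<otimes> h \<in> P" by (rule h(2))
  moreover have "inv h \<otimes> (h \<otimes> q \<otimes> inv h) \<otimes> h = q"
    using h(1) qG by (simp add: m_assoc) (simp flip: m_assoc)
  ultimately show "q \<in> P" by simp
qed

lemma p_subgroup_in_normal_sylow:
  assumes fin: "finite (carrier G)" and p: "prime p" "card (carrier G) = p ^ c * m" "\<not> p dvd m"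
    and P: "P \<lhd> G" "card P = p ^ c" and Q: "subgroup Q G" "card Q = p ^ n"
  shows "Q \<subseteq> P"
proof
  fix q assume q: "q \<in> Q"
  obtain h where h: "h \<in> carrier G" "\<And>q. q \<in> Q \<Longrightarrow> inv h \<otimes> q \<otimes> h \<in> P"
    using p_subgroup_conjugate_in_sylow[OF fin p normal_imp_subgroup[OF P(1)] P(2) Q] by blast
  have qG: "q \<in> carrier G" using q subgroup.subset[OF Q(1)] by blast
  have "h \<otimes> (inv h \<otimes> q \<otimes> h) \<otimes> inv h \<in> P" using P(1) normal_inv_iff h(2)[OF q] h(1) by blast
  moreover have "h \<otimes> (inv h \<otimes> q \<otimes> h) \<otimes> inv h = q"
    using h(1) qG by (simp add: m_assoc) (simp flip: m_assoc)
  ultimately show "q \<in> P" by simp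
qed

text \<open>The witness is the intersection of all Sylow p-subgroups of H. It contains Q, and it is
  normal in the whole group because conjugation preserves H and permutes these subgroups.\<close>

lemma normal_p_subgroup_of_normal:
  assumes fin: "finite (carrier G)" and p: "prime p" and H: "H \<lhd> G"
    and Q: "Q \<lhd> G\<lparr>carrier := H\<rparr>" "card Q = p ^ n" "Q \<noteq> {\<one>}"
  shows "\<exists>N k. N \<lhd> G \<and> N \<noteq> {\<one>} \<and> card N = p ^ k"
proof -
  have H': "subgroup H G" using H normal_imp_subgroup by blast
  have HG: "H \<subseteq> carrier G" using H' subgroup.subset by blast
  interpret H: group "G\<lparr>carrier := H\<rparr>" using H' subgroup.subgroup_is_group group_axioms by blast
  have finH: "finite H" using fin HG finite_subset by blast
  have "card H \<noteq> 0" using finH subgroup.one_closed[OF H'] by auto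
  then obtain c m where cm: "card H = p ^ c * m" "\<not> p dvd m"
    using multiplicity_decompose'[of "card H" p] p prime_elem_not_unit by (metis not_prime_unit)
  define F where "F = {P. subgroup P G \<and> P \<subseteq> H \<and> card P = p ^ c}"
  obtain P0 where "subgroup P0 (G\<lparr>carrier := H\<rparr>)" "card P0 = p ^ c"
    using sylow_thm[of p "G\<lparr>carrier := H\<rparr>" c m] p H.group_axioms cm finH by (auto simp: order_def)
  then have P0: "P0 \<in> F"
    using incl_subgroup[OF H'] subgroup.subset[of P0 "G\<lparr>carrier := H\<rparr>"] by (auto simp: F_def)
  define J where "J = \<Inter>F"
  have J: "subgroup J G" unfolding J_def using P0 by (intro subgroups_Inter) (auto simp: F_def)
  have "J \<subseteq> P0" using P0 by (auto simp: J_def)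
  then have "card J dvd p ^ c" using subgroup_card_dvd_subgroup[OF J, of P0] P0 by (auto simp: F_def)
  then obtain k where k: "card J = p ^ k" using p divides_primepow_nat by blast
  have "Q \<subseteq> P" if "P \<in> F" for P
  proof (rule H.normal_p_subgroup_in_sylow)
    show "subgroup P (G\<lparr>carrier := H\<rparr>)" using that H' by (intro subgroup_incl) (auto simp: F_def)
  qed (use that p Q finH cm in \<open>auto simp: F_def\<close>)
  then have "Q \<subseteq> J" by (auto simp: J_def)
  moreover have "\<one> \<in> Q" using Q(1) normal_imp_subgroup subgroup.one_closed by fastforce
  ultimately have "J \<noteq> {\<one>}" using Q(3) by blast
  have "J \<lhd> G"
  proof (rule normal_invI[OF J])
    fix x h assume x: "x \<in> carrier G" and h: "h \<in> J"
    show "x \<otimes> h \<otimes> inv x \<in> J" unfolding J_def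
    proof
      fix P assume P: "P \<in> F"
      then have PG: "subgroup P G" "P \<subseteq> H" "card P = p ^ c" by (auto simp: F_def)
      have Pc: "P \<subseteq> carrier G" using PG(1) subgroup.subset by blast
      let ?R = "(\<lambda>y. inv x \<otimes> y \<otimes> x) ` P"
      have "?R \<in> F" unfolding F_def
      proof (intro CollectI conjI)
        show "subgroup ?R G"
        proof (rule subgroupI)
          show "?R \<subseteq> carrier G" using Pc x by auto
          show "?R \<noteq> {}" using subgroup.one_closed[OF PG(1)] by auto
          show "inv a \<in> ?R" if aR: "a \<in> ?R" for a
          proof -
            obtain y where y: "y \<in> P" "a = inv x \<otimes> y \<otimes> x" using aR by blast
            then have "inv a = inv x \<otimes> inv y \<otimes> x" using x Pc by (simp add: inv_mult_group m_assoc subset_iff)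
            then show ?thesis using y subgroup.m_inv_closed[OF PG(1)] by blast
          qed
          show "a \<otimes> b \<in> ?R" if abR: "a \<in> ?R" "b \<in> ?R" for a b
          proof -
            obtain y z where yz: "y \<in> P" "a = inv x \<otimes> y \<otimes> x" "z \<in> P" "b = inv x \<otimes> z \<otimes> x"
              using abR by blast
            then have "y \<in> carrier G" "z \<in> carrier G" using Pc by auto
            then have "x \<otimes> (inv x \<otimes> (z \<otimes> x)) = z \<otimes> x" using x by (simp flip: m_assoc)
            then have "a \<otimes> b = inv x \<otimes> (y \<otimes> z) \<otimes> x"
              using x \<open>y \<in> carrier G\<close> \<open>z \<in> carrier G\<close> yz by (simp add: m_assoc)
            then show ?thesis using yz subgroup.m_closed[OF PG(1)] by blast
          qed
        qed
        show "?R \<subseteq> H"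
        proof
          fix a assume "a \<in> ?R"
          then obtain y where "y \<in> P" "a = inv x \<otimes> y \<otimes> inv (inv x)" unfolding inv_inv[OF x] by blast
          then show "a \<in> H" using H normal_inv_iff x PG(2) by blast
        qed
        have "inj_on (\<lambda>y. inv x \<otimes> y \<otimes> x) P" using x Pc by (auto simp: inj_on_def subset_iff)
        then show "card ?R = p ^ c" using PG(3) by (simp add: card_image)
      qed
      then have "h \<in> ?R" using h by (auto simp: J_def)
      then obtain y where y: "y \<in> P" "h = inv x \<otimes> y \<otimes> x" by blast
      then have "y \<in> carrier G" using Pc by auto
      then have "x \<otimes> h \<otimes> inv x = y" using y(2) x by (simp add: m_assoc) (simp flip: m_assoc)
      then show "x \<otimes> h \<otimes> inv x \<in> P" using y by simp
    qed
  qed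
  then show ?thesis using \<open>J \<noteq> {\<one>}\<close> k by blast
qed

end

text \<open>The centraliser of a central involution of a Sylow 2-subgroup contains that subgroup, so
  the class of the involution has size 3^k. If k = 0 the involution generates a normal subgroup;
  otherwise there is a proper nontrivial normal subgroup, and a normal p-subgroup found in it by
  induction leads to one of the whole group.\<close>

theorem two_three_group_normal_p_subgroup:
  fixes G :: "('a, 'b) monoid_scheme" (structure)
  assumes "group G" "finite (carrier G)" "card (carrier G) = 2 ^ a * 3 ^ b" "card (carrier G) > 1"
  shows "\<exists>p N k. p \<in> {2, 3} \<and> N \<lhd> G \<and> N \<noteq> {\<one>} \<and> card N = p ^ k"
  using assms
proof (induction "card (carrier G)" arbitrary: G a b rule: less_induct)
  case (less G)
  interpret group G by fact
  show ?case
  proof (cases "a = 0 \<or> b = 0")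
    case True
    have "carrier G \<noteq> {\<one>\<^bsub>G\<^esub>}" using less.prems(4) by auto
    moreover have "carrier G \<lhd> G" using subgroup_self by (intro normal_invI) auto
    ultimately show ?thesis using True less.prems(3)
      by (intro exI[of _ "if a = 0 then 3 else 2"] exI[of _ "carrier G"] exI[of _ "if a = 0 then b else a"]) auto
  next
    case False
    obtain S where S: "subgroup S G" "card S = 2 ^ a"
      using sylow_thm[of 2 G a "3 ^ b"] less.prems by (auto simp: order_def)
    have SG: "S \<subseteq> carrier G" using S(1) subgroup.subset by blast
    interpret S: group "G\<lparr>carrier := S\<rparr>" using S(1) subgroup.subgroup_is_group group_axioms by blast
    obtain g where g: "g \<in> S" "g \<noteq> \<one>\<^bsub>G\<^esub>" "g [^]\<^bsub>G\<lparr>carrier := S\<rparr>\<^esub> (2::nat) = \<one>\<^bsub>G\<^esub>"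
      "\<And>x. x \<in> S \<Longrightarrow> x \<otimes>\<^bsub>G\<^esub> g = g \<otimes>\<^bsub>G\<^esub> x"
      using S.p_group_central_element[of 2 a] S False finite_subset[OF SG less.prems(2)] by auto
    have gG: "g \<in> carrier G" using g SG by blast
    have gg: "g \<otimes>\<^bsub>G\<^esub> g = \<one>\<^bsub>G\<^esub>" using g(3) gG by (simp add: numeral_2_eq_2 flip: nat_pow_consistent)
    interpret involution_class G g by unfold_locales (use less.prems gG gg in auto)
    interpret conj: finite_action G "\<lambda>x y. x \<otimes>\<^bsub>G\<^esub> y \<otimes>\<^bsub>G\<^esub> inv\<^bsub>G\<^esub> x" "carrier G"
      using conjugation_action[OF less.prems(2)] .
    have CO: "C = conj.orb g" by (simp add: C_def conj.orb_def)
    have "S \<subseteq> conj.stab g" using SG g(4) gG by (auto simp: conj.stab_def m_assoc subset_iff)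
    then have "2 ^ a dvd card (conj.stab g)"
      using subgroup_card_dvd_subgroup[OF S(1) conj.subgroup_stab[OF gG]] S(2) by simp
    then obtain l where "card (conj.stab g) = 2 ^ a * l" by blast
    then have "card C * l = 3 ^ b" using conj.orbit_stabilizer[OF gG] less.prems(3) by (simp add: CO)
    then have "card C dvd 3 ^ b" by (metis dvd_triv_left)
    then obtain k where k: "card C = 3 ^ k" using divides_primepow_nat[of 3] by auto
    show ?thesis
    proof (cases "k = 0")
      case True
      then have "card C = 1" using k by simp
      then have C: "C = {g}" using g_in_C by (auto simp: card_1_singleton_iff)
      have "{\<one>\<^bsub>G\<^esub>, g} \<lhd> G"
      proof (rule normal_invI)
        show "subgroup {\<one>\<^bsub>G\<^esub>, g} G"
          by (rule subgroupI) (use gG gg C_inv[OF g_in_C] in auto)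
        show "x \<otimes>\<^bsub>G\<^esub> h \<otimes>\<^bsub>G\<^esub> inv\<^bsub>G\<^esub> x \<in> {\<one>\<^bsub>G\<^esub>, g}" if "x \<in> carrier G" "h \<in> {\<one>\<^bsub>G\<^esub>, g}" for x h
          using that C_conj[OF that(1) g_in_C] unfolding C by (elim insertE) simp_all
      qed
      moreover have "card {\<one>\<^bsub>G\<^esub>, g} = 2 ^ 1" using g(2) by simp
      moreover have "{\<one>\<^bsub>G\<^esub>, g} \<noteq> {\<one>\<^bsub>G\<^esub>}" using g(2) by auto
      ultimately show ?thesis by blast
    next
      case False
      then obtain H where H: "H \<lhd> G" "H \<noteq> {\<one>\<^bsub>G\<^esub>}" "H \<noteq> carrier G"
        using prime_power_class_not_simple[of 3 k] k by auto
      have H': "subgroup H G" using H normal_imp_subgroup by blast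
      have HG: "H \<subset> carrier G" using H(3) H' subgroup.subset by blast
      then have lt: "card H < card (carrier G)" using less.prems(2) by (simp add: psubset_card_mono)
      have finH: "finite H" using HG less.prems(2) finite_subset by blast
      have gt: "card H > 1"
      proof (rule ccontr)
        assume "\<not> card H > 1"
        moreover have "card H \<noteq> 0" using finH subgroup.one_closed[OF H'] by auto
        ultimately have "card H = 1" by linarith
        then show False using subgroup.one_closed[OF H'] H(2) by (auto simp: card_1_singleton_iff)
      qed
      obtain i j where "card H = 2 ^ i * 3 ^ j"
        using dvd_two_three_power subgroup_card_dvd[OF H'] less.prems(3) by metis
      moreover have "group (G\<lparr>carrier := H\<rparr>)" using H' subgroup.subgroup_is_group group_axioms by blast
      ultimately obtain p Q n where pQ: "p \<in> {2,3::nat}" "Q \<lhd> G\<lparr>carrier := H\<rparr>" "Q \<noteq> {\<one>\<^bsub>G\<^esub>}" "card Q = p ^ n"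
        using less.hyps[of "G\<lparr>carrier := H\<rparr>" i j] lt gt finH by auto
      have "prime p" using pQ(1) by auto
      then show ?thesis
        using normal_p_subgroup_of_normal[OF less.prems(2) _ H(1) pQ(2,4,3)] pQ(1) by blast
    qed
  qed
qed

text \<open>N is a largest normal 2-subgroup, and M is the preimage of a nontrivial normal
  p-subgroup of the quotient by N, which is nontrivial because b > 0.\<close>

theorem (in group) two_three_group_layer:
  assumes fin: "finite (carrier G)" and ord: "card (carrier G) = 2 ^ a * 3 ^ b" "b > 0"
  obtains N M i j where "N \<lhd> G" "M \<lhd> G" "N \<subseteq> M" "card N = 2 ^ i" "card M = 2 ^ i * 3 ^ j" "j > 0"
proof -
  let ?A = "{N. N \<lhd> G \<and> (\<exists>i. card N = 2 ^ i)}"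
  have "{\<one>} \<in> ?A" using one_is_normal by (auto intro!: exI[of _ 0])
  moreover have "finite ?A"
  proof (rule finite_subset)
    show "?A \<subseteq> Pow (carrier G)" using normal_imp_subgroup subgroup.subset by blast
  qed (use fin in simp)
  ultimately have "Max (card ` ?A) \<in> card ` ?A" and Max: "\<And>N'. N' \<in> ?A \<Longrightarrow> card N' \<le> Max (card ` ?A)"
    by (blast intro: Max_in Max_ge finite_imageI)+
  then obtain N where N: "N \<in> ?A" "Max (card ` ?A) = card N" by blast
  have max: "card N' \<le> card N" if "N' \<in> ?A" for N' using Max[OF that] N(2) by simp
  from N(1) obtain i where i: "card N = 2 ^ i" and NG: "N \<lhd> G" by blast
  interpret normal N G by fact
  interpret Q: group "G Mod N" by (rule factorgroup_is_group)
  have cQ: "card (carrier (G Mod N)) * 2 ^ i = 2 ^ a * 3 ^ b"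
    using lagrange[OF subgroup_axioms] i ord by (simp add: FactGroup_def order_def)
  have finQ: "finite (carrier (G Mod N))" using fin by (simp add: FactGroup_def RCOSETS_def)
  have "card (carrier (G Mod N)) > 1"
  proof (rule ccontr)
    assume "\<not> card (carrier (G Mod N)) > 1"
    then have "card (carrier (G Mod N)) = 0 \<or> card (carrier (G Mod N)) = 1" by linarith
    then have "2 ^ i = 2 ^ a * (3::nat) ^ b" using cQ by auto
    then have "3 dvd (2::nat) ^ i" using ord(2) by (metis dvd_mult dvd_power dvd_refl)
    then have "3 dvd (2::nat)" using prime_dvd_power_nat[of 3 2 i] by simp
    then show False by simp
  qed
  moreover obtain i' j' where "card (carrier (G Mod N)) = 2 ^ i' * 3 ^ j'"
    using dvd_two_three_power cQ by (metis dvd_triv_left)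
  ultimately obtain p K k where K: "p \<in> {2,3::nat}" "K \<lhd> G Mod N" "K \<noteq> {\<one>\<^bsub>G Mod N\<^esub>}" "card K = p ^ k"
    using two_three_group_normal_p_subgroup[OF Q.group_axioms finQ] by blast
  have K': "subgroup K (G Mod N)" using K(2) normal_imp_subgroup by blast
  have KN: "K \<subseteq> rcosets N" using subgroup.subset[OF K'] by (simp add: FactGroup_def)
  have "k > 0"
  proof (rule ccontr)
    assume "\<not> k > 0"
    then have "card K = 1" using K(4) by simp
    then show False using subgroup.one_closed[OF K'] K(3) by (auto simp: card_1_singleton_iff)
  qed
  define M where "M = {x \<in> carrier G. N #> x \<in> K}"
  have hom: "N #> (x \<otimes> y) = (N #> x) \<otimes>\<^bsub>G Mod N\<^esub> (N #> y)" if "x \<in> carrier G" "y \<in> carrier G" for x y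
    using that by (simp add: rcos_sum FactGroup_def)
  have in_Mod: "N #> x \<in> carrier (G Mod N)" if "x \<in> carrier G" for x
    using that subset by (simp add: FactGroup_def rcosetsI)
  have hom_one: "N #> \<one> = \<one>\<^bsub>G Mod N\<^esub>" using subset by (simp add: FactGroup_def)
  have hom_inv: "N #> inv x = inv\<^bsub>G Mod N\<^esub> (N #> x)" if "x \<in> carrier G" for x
    by (rule Q.inv_equality[symmetric]) (use that hom[of "inv x" x] hom_one in_Mod in auto)
  have "M \<lhd> G"
  proof (rule normal_invI)
    show "subgroup M G"
    proof (rule subgroupI)
      have "\<one> \<in> M" using hom_one subgroup.one_closed[OF K'] by (simp add: M_def)
      then show "M \<noteq> {}" by blast
      show "inv y \<in> M" if "y \<in> M" for y
        using that subgroup.m_inv_closed[OF K', of "N #> y"] by (simp add: M_def hom_inv)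
      show "y \<otimes> z \<in> M" if "y \<in> M" "z \<in> M" for y z
        using that subgroup.m_closed[OF K', of "N #> y" "N #> z"] by (simp add: M_def hom)
    qed (auto simp: M_def)
    show "x \<otimes> h \<otimes> inv x \<in> M" if "x \<in> carrier G" "h \<in> M" for x h
    proof -
      have "h \<in> carrier G" "N #> h \<in> K" using that(2) by (auto simp: M_def)
      moreover from this have "(N #> x) \<otimes>\<^bsub>G Mod N\<^esub> (N #> h) \<otimes>\<^bsub>G Mod N\<^esub> inv\<^bsub>G Mod N\<^esub> (N #> x) \<in> K"
        using K(2) in_Mod[OF that(1)] unfolding Q.normal_inv_iff by blast
      ultimately show ?thesis using that(1) by (simp add: M_def hom hom_inv)
    qed
  qed
  moreover have "N \<subseteq> M"
  proof
    fix x assume "x \<in> N"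
    then have "x \<in> carrier G" "N #> x = \<one>\<^bsub>G Mod N\<^esub>"
      using rcos_const[OF group_axioms] subset by (auto simp: FactGroup_def)
    then show "x \<in> M" using subgroup.one_closed[OF K'] by (simp add: M_def)
  qed
  moreover have "card M = 2 ^ i * p ^ k"
  proof -
    have "\<Union>K = M"
    proof
      show "\<Union>K \<subseteq> M"
      proof
        fix x assume "x \<in> \<Union>K"
        then obtain R where R: "R \<in> K" "x \<in> R" by blast
        then obtain y where y: "y \<in> carrier G" "R = N #> y" using KN by (auto simp: RCOSETS_def)
        then have "x \<in> carrier G" using R subset r_coset_subset_G by blast
        moreover have "N #> x = N #> y" using repr_independence[OF R(2)[unfolded y(2)] y(1) subgroup_axioms] by simp
        ultimately show "x \<in> M" using R y by (simp add: M_def)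
      qed
      show "M \<subseteq> \<Union>K" using rcos_self[OF _ subgroup_axioms] by (auto simp: M_def)
    qed
    moreover have "2 ^ i * card K = card (\<Union>K)"
    proof (rule card_partition)
      show "finite K" using finite_subset[OF KN] finQ by (simp add: FactGroup_def)
      show "finite (\<Union>K)" using fin \<open>\<Union>K = M\<close> by (simp add: M_def)
      show "card c = 2 ^ i" if "c \<in> K" for c using card_rcosets_equal[of c N] that KN subset i by auto
      show "c1 \<inter> c2 = {}" if "c1 \<in> K" "c2 \<in> K" "c1 \<noteq> c2" for c1 c2
        using rcos_disjoint[OF subgroup_axioms] that KN unfolding pairwise_def disjnt_def by blast
    qed
    ultimately show ?thesis using K(4) by simp
  qed
  moreover have "p = 3"
  proof (rule ccontr)
    assume "p \<noteq> 3"
    then have "p = 2" using K(1) by simp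
    then have "card M = 2 ^ (i + k)" using \<open>card M = 2 ^ i * p ^ k\<close> by (simp add: power_add)
    then have "card M \<le> card N" using max[of M] \<open>M \<lhd> G\<close> by blast
    then show False using \<open>card M = 2 ^ (i + k)\<close> i \<open>k > 0\<close> by simp
  qed
  ultimately show thesis using that[OF NG, of M i k] i \<open>k > 0\<close> by simp
qed

section \<open>Edge-transitive graphs of valency four\<close>

text \<open>Some multiple of k is 1 modulo p, so h is a power of its k-th iterate.\<close>

lemma prime_period_fixed_point:
  assumes "prime p" "h ^^ p = id" "\<not> p dvd k" "(h ^^ k) w = w"
  shows "h w = w"
proof -
  have "coprime k p" using assms(1,3) by (metis coprime_commute prime_imp_coprime)
  then obtain m l where ml: "k * m = 1 + p * l"
    using coprime_bezout_strong[of k p] prime_gt_1_nat[OF assms(1)] by auto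
  have "(h ^^ (1 + p * l)) w = h w"
    by (simp add: funpow_mult[symmetric] assms(2) id_funpow)
  moreover have "(h ^^ (k * m)) w = w"
    using assms(4) by (simp add: funpow_mult[symmetric]) (induction m; simp)
  ultimately show ?thesis using ml by simp
qed

text \<open>The first p iterates of w are distinct: a coincidence would make a power with exponent
  prime to p fix w. Applied with neighbourhoods as X, the bound limits the primes that can act
  there.\<close>

lemma prime_period_orbit:
  assumes "prime p" "h ^^ p = id" "h w \<noteq> w" "w \<in> X" "\<And>x. x \<in> X \<Longrightarrow> h x \<in> X" "finite X"
  shows "p \<le> card X"
proof -
  have "inj_on (\<lambda>i. (h ^^ i) w) {..<p}"
  proof (rule linorder_inj_onI)
    fix i j assume ij: "i < j" "i \<in> {..<p}" "j \<in> {..<p}"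
    show "(h ^^ i) w \<noteq> (h ^^ j) w"
    proof
      assume eq: "(h ^^ i) w = (h ^^ j) w"
      have "(h ^^ (p - i)) ((h ^^ i) w) = (h ^^ (p - i)) ((h ^^ j) w)" using eq by (rule arg_cong)
      then have "(h ^^ (p - i + i)) w = (h ^^ (p - i + j)) w" by (simp only: funpow_add comp_apply)
      moreover have "p - i + i = p" using ij by simp
      moreover have "p - i + j = (j - i) + p" using ij by simp
      ultimately have "(h ^^ p) w = (h ^^ ((j - i) + p)) w" by (simp only:)
      then have "(h ^^ (j - i)) w = w" unfolding funpow_add assms(2) by simp
      moreover have "\<not> p dvd (j - i)" using ij by (auto dest: dvd_imp_le)
      ultimately show False using prime_period_fixed_point[OF assms(1,2)] assms(3) by blast
    qed
  qed auto
  moreover have "(h ^^ i) w \<in> X" for i using assms(4,5) by (induction i) auto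
  ultimately show ?thesis using card_inj_on_le[of "\<lambda>i. (h ^^ i) w" "{..<p}" X] assms(6) by auto
qed

locale edge_transitive =
  fixes V :: "'a set" and E :: "'a \<Rightarrow> 'a \<Rightarrow> bool" and G :: "('a \<Rightarrow> 'a) set"
  assumes simple: "simple_graph V E" and conn: "connected_graph V E" and reg: "regular_graph 4 V E"
    and grp: "aut_subgroup V E G" and etrans: "edge_transitive_on V E G"
begin

abbreviation \<G> :: "('a \<Rightarrow> 'a) monoid" where
  "\<G> \<equiv> \<lparr>carrier = G, mult = (\<circ>), one = id\<rparr>"

abbreviation nbrs :: "'a \<Rightarrow> 'a set" where "nbrs v \<equiv> {u. E v u}"

lemma finite_V: "finite V" and E_V: "E x y \<Longrightarrow> x \<in> V \<and> y \<in> V" and E_sym: "E x y \<Longrightarrow> E y x"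
  and E_irrefl: "\<not> E x x"
  using simple by (auto simp: simple_graph_def)

lemma card_nbrs: "v \<in> V \<Longrightarrow> card (nbrs v) = 4"
  using reg by (simp add: regular_graph_def)

lemma finite_nbrs: "finite (nbrs v)"
  using finite_subset[OF _ finite_V, of "nbrs v"] E_V by blast

lemma ex_nbr: "v \<in> V \<Longrightarrow> \<exists>w. E v w"
  using card_nbrs[of v] by (metis (mono_tags, lifting) card.empty empty_Collect_eq zero_neq_numeral)

lemma G_permutes: "g \<in> G \<Longrightarrow> g permutes V"
  using grp by (auto simp: aut_subgroup_def automorphism_def)

lemma G_V: "g \<in> G \<Longrightarrow> g x \<in> V \<longleftrightarrow> x \<in> V"
  using G_permutes permutes_in_image by metis

lemma G_E: "g \<in> G \<Longrightarrow> E (g x) (g y) \<longleftrightarrow> E x y"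
proof -
  assume g: "g \<in> G"
  then have "automorphism V E g" using grp by (auto simp: aut_subgroup_def)
  then show ?thesis unfolding automorphism_def using E_V G_V[OF g] by metis
qed

lemma G_comp: "g \<in> G \<Longrightarrow> h \<in> G \<Longrightarrow> g \<circ> h \<in> G" and id_G: "id \<in> G"
  using grp by (auto simp: aut_subgroup_def)

lemma G_inj: "g \<in> G \<Longrightarrow> g x = g y \<longleftrightarrow> x = y"
  using permutes_inj[OF G_permutes] by (auto simp: inj_def)

lemma finite_G: "finite G"
  using finite_subset[OF _ finite_permutations[OF finite_V]] G_permutes by blast

sublocale \<G>: group \<G>
proof (rule groupI)
  fix x assume x: "x \<in> carrier \<G>"
  then have "Hilbert_Choice.inv x \<in> G" using grp by (auto simp: aut_subgroup_def)
  moreover have "Hilbert_Choice.inv x \<circ> x = id" using permutes_inv_o(2)[OF G_permutes] x by simp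
  ultimately show "\<exists>y\<in>carrier \<G>. y \<otimes>\<^bsub>\<G>\<^esub> x = \<one>\<^bsub>\<G>\<^esub>" by auto
qed (auto simp: G_comp id_G)

sublocale act: finite_action \<G> "\<lambda>g x. g x" V
  by unfold_locales (auto simp: finite_G finite_V G_V)

text \<open>Keeps the group inverse apart from the inverse of functions and gives it pointwise
  rewrite rules.\<close>

definition ginv :: "('a \<Rightarrow> 'a) \<Rightarrow> 'a \<Rightarrow> 'a" where "ginv g = inv\<^bsub>\<G>\<^esub> g"

lemma ginv_G: "g \<in> G \<Longrightarrow> ginv g \<in> G"
  using \<G>.inv_closed by (auto simp: ginv_def)

lemma ginv_left [simp]: "g \<in> G \<Longrightarrow> ginv g (g x) = x"
  using \<G>.l_inv[of g] by (simp add: ginv_def fun_eq_iff)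

lemma ginv_right [simp]: "g \<in> G \<Longrightarrow> g (ginv g x) = x"
  using \<G>.r_inv[of g] by (simp add: ginv_def fun_eq_iff)

lemma ginv_eq: "g \<in> G \<Longrightarrow> g x = y \<Longrightarrow> ginv g y = x"
  by auto

lemma pow_G: "g [^]\<^bsub>\<G>\<^esub> n = g ^^ n"
  by (induction n) (auto simp: funpow_swap1 fun_eq_iff)

lemma semiregularI:
  assumes g: "g \<in> G" and "prime p" "g ^^ p = id" "g \<noteq> id" "\<And>v. v \<in> V \<Longrightarrow> g v \<noteq> v"
  shows "semiregular_element V g"
  unfolding semiregular_element_def
proof (intro conjI allI impI ballI)
  fix k v assume k: "g ^^ k \<noteq> id" and v: "v \<in> V"
  have "\<not> p dvd k"
  proof
    assume "p dvd k"
    then obtain l where "k = p * l" by blast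
    then have "g ^^ k = id" using assms(3) by (simp add: funpow_mult[symmetric] id_funpow)
    with k show False by simp
  qed
  then show "(g ^^ k) v \<noteq> v" using prime_period_fixed_point[OF assms(2,3)] assms(5)[OF v] by blast
qed fact

text \<open>Otherwise the fixed vertices would be closed under adjacency, and connectedness would
  make g the identity.\<close>

lemma fixed_point_propagates:
  assumes g: "g \<in> G" "g \<noteq> id" and v: "v \<in> V" "g v = v"
  shows "\<exists>u w. u \<in> V \<and> g u = u \<and> E u w \<and> g w \<noteq> w"
proof (rule ccontr)
  assume "\<not> ?thesis"
  then have step: "g w = w" if "g u = u" "E u w" for u w using that E_V by metis
  have "g y = y" if "y \<in> V" for y
  proof -
    have "E\<^sup>*\<^sup>* v y" using conn v(1) that by (auto simp: connected_graph_def)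
    then show ?thesis by (induction rule: rtranclp_induct) (use v step in auto)
  qed
  moreover have "g y = y" if "y \<notin> V" for y using permutes_not_in[OF G_permutes[OF g(1)] that] .
  ultimately have "g = id" by (auto simp: fun_eq_iff)
  with g show False by simp
qed

lemma nbrs_invariant: "g \<in> G \<Longrightarrow> g v = v \<Longrightarrow> x \<in> nbrs v \<Longrightarrow> g x \<in> nbrs v"
  using G_E[of g v x] by simp

lemma large_prime_semiregular:
  assumes g: "g \<in> G" "g \<noteq> id" "g ^^ p = id" and p: "prime p" "p > 4"
  shows "semiregular_element V g"
proof (rule semiregularI[OF g(1) p(1) g(3,2)])
  fix v assume v: "v \<in> V"
  show "g v \<noteq> v"
  proof
    assume "g v = v"
    then obtain u w where uw: "u \<in> V" "g u = u" "E u w" "g w \<noteq> w"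
      using fixed_point_propagates[OF g(1,2) v] by blast
    have "p \<le> card (nbrs u)"
      using uw by (intro prime_period_orbit[OF p(1) g(3) uw(4)] finite_nbrs nbrs_invariant[OF g(1)]) auto
    then show False using card_nbrs[OF uw(1)] p(2) by simp
  qed
qed

lemma ex_prime_order:
  assumes "prime p" "p dvd card G"
  obtains g where "g \<in> G" "g \<noteq> id" "g ^^ p = id"
  using \<G>.cauchy[of p] assms finite_G by (auto simp: pow_G)

lemma two_three_order:
  assumes "\<And>g. g \<in> G \<Longrightarrow> \<not> semiregular_element V g"
  obtains a b where "card G = 2 ^ a * 3 ^ b"
proof -
  have G0: "card G \<noteq> 0" using finite_G id_G by auto
  have "p \<in> {2,3}" if "p \<in> prime_factors (card G)" for p
  proof (rule ccontr)
    assume "p \<notin> {2,3}"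
    have p: "prime p" "p dvd card G" using that by auto
    have "p \<noteq> 4" using p(1) by (auto simp: prime_nat_iff dest!: spec[of _ 2])
    moreover have "p \<ge> 2" using p(1) prime_ge_2_nat by blast
    ultimately have "p > 4" using \<open>p \<notin> {2,3}\<close> by auto
    then show False using ex_prime_order[OF p] large_prime_semiregular p(1) assms by metis
  qed
  then have sub: "prime_factors (card G) \<subseteq> {2,3}" by blast
  have "card G = (\<Prod>p\<in>prime_factors (card G). p ^ multiplicity p (card G))"
    using G0 by (simp add: prime_factorization_nat)
  also have "\<dots> = (\<Prod>p\<in>{2,3}. p ^ multiplicity p (card G))"
    using sub by (intro prod.mono_neutral_left) (auto simp: prime_factors_multiplicity)
  finally show thesis using that by simp
qed

section \<open>Transitivity on vertices and on neighbourhoods\<close>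

definition vertex_transitive :: bool where
  "vertex_transitive \<longleftrightarrow> (\<forall>u\<in>V. \<forall>v\<in>V. \<exists>g\<in>G. g u = v)"

definition locally_transitive :: "'a \<Rightarrow> bool" where
  "locally_transitive v \<longleftrightarrow> (\<forall>w w'. E v w \<longrightarrow> E v w' \<longrightarrow> (\<exists>g\<in>G. g v = v \<and> g w = w'))"

lemma edge_map:
  assumes "E u w" "E x y"
  obtains g where "g \<in> G" "g u = x" "g w = y" | g where "g \<in> G" "g u = y" "g w = x"
proof -
  have "{u, w} \<in> edges V E" "{x, y} \<in> edges V E" using assms E_V by (auto simp: edges_def)
  then obtain g where g: "g \<in> G" "g ` {u, w} = {x, y}" using etrans unfolding edge_transitive_on_def by blast
  then show thesis using that by (auto simp: doubleton_eq_iff)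
qed

lemma orb_mem: "y \<in> act.orb x \<longleftrightarrow> (\<exists>g\<in>G. g x = y)"
  by (auto simp: act.orb_def)

text \<open>Any vertex lies on an edge, and that edge is an image of the given one. If both ends of
  the given edge were in one orbit, every vertex would be in it.\<close>

lemma edge_crosses:
  assumes "\<not> vertex_transitive" "E u w"
  shows "w \<notin> act.orb u"
proof
  assume w: "w \<in> act.orb u"
  have uV: "u \<in> V" "w \<in> V" using assms(2) E_V by auto
  have all: "y \<in> act.orb u" if yV: "y \<in> V" for y
  proof -
    obtain y' where "E y y'" using ex_nbr yV by blast
    from edge_map[OF assms(2) this] obtain g where "g \<in> G" "g u = y \<or> g w = y" by metis
    then have "y \<in> act.orb u \<or> y \<in> act.orb w" unfolding orb_mem by blast
    then show ?thesis using act.orb_eq[OF uV(1) w] by blast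
  qed
  have "vertex_transitive" unfolding vertex_transitive_def
  proof (intro ballI)
    fix x y assume "x \<in> V" "y \<in> V"
    then have "y \<in> act.orb x" using all act.orb_eq[OF uV(1)] by blast
    then show "\<exists>g\<in>G. g x = y" by (simp add: orb_mem)
  qed
  with assms(1) show False by blast
qed

lemma locally_transitive_if_not_vertex_transitive:
  assumes "\<not> vertex_transitive"
  shows "locally_transitive v"
  unfolding locally_transitive_def
proof (intro allI impI)
  fix w w' assume "E v w" "E v w'"
  from edge_map[OF this] show "\<exists>g\<in>G. g v = v \<and> g w = w'"
  proof cases
    case (2 g)
    then have "v \<in> act.orb w" by (auto simp: orb_mem)
    then show ?thesis using edge_crosses[OF assms E_sym[OF \<open>E v w\<close>]] by blast
  qed blast
qed

text \<open>The orbit D of one arc contains each edge in exactly one direction. This orientation has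
  in- and out-valency 2 everywhere, and an element of order 3 cannot move anything in an invariant
  set of two points.\<close>

lemma half_arc_transitive_fixes_nbrs:
  assumes vt: vertex_transitive and nl: "\<not> locally_transitive v"
    and g: "g \<in> G" "g ^^ 3 = id" "g u = u" "E u y"
  shows "g y = y"
proof -
  obtain w w' where ww: "E v w" "E v w'" and no: "\<And>g. g \<in> G \<Longrightarrow> g v = v \<Longrightarrow> g w \<noteq> w'"
    using nl by (auto simp: locally_transitive_def)
  obtain k where k: "k \<in> G" "k v = w'" "k w = v" using edge_map[OF ww] no by metis
  define D where "D = (\<lambda>x y. \<exists>g\<in>G. g v = x \<and> g w = y)"
  have D_E: "E x y" if "D x y" for x y using that G_E ww(1) by (auto simp: D_def)
  have D_or: "D x y \<or> D y x" if "E x y" for x y using edge_map[OF ww(1) that] unfolding D_def by metis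
  have D_asym: "\<not> D y x" if "D x y" for x y
  proof
    assume "D y x"
    with that obtain g h where gh: "g \<in> G" "g v = x" "g w = y" "h \<in> G" "h v = y" "h w = x"
      unfolding D_def by blast
    \<comment> \<open>Here \<open>ginv g \<circ> h\<close> swaps v and w, and k takes w to v and v
      to w', so \<open>?f\<close> fixes v and takes w to w'.\<close>
    let ?f = "k \<circ> (ginv g \<circ> h)"
    have "?f \<in> G" using gh k by (intro G_comp ginv_G)
    moreover have "ginv g y = w" "ginv g x = v" using gh by (auto intro: ginv_eq)
    then have "?f v = v" "?f w = w'" using gh k by auto
    ultimately show False using no by blast
  qed
  have D_inv: "D (h x) (h y) \<longleftrightarrow> D x y" if h: "h \<in> G" for h x y
  proof
    assume "D x y" then show "D (h x) (h y)" unfolding D_def using G_comp[OF h] by (metis comp_apply)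
  next
    assume "D (h x) (h y)"
    then obtain f where f: "f \<in> G" "f v = h x" "f w = h y" unfolding D_def by blast
    then have "(ginv h \<circ> f) v = x" "(ginv h \<circ> f) w = y" using h by auto
    then show "D x y" unfolding D_def using G_comp[OF ginv_G[OF h] f(1)] by blast
  qed
  let ?out = "\<lambda>x. {y. D x y}" and ?in = "\<lambda>x. {y. D y x}"
  have vV: "v \<in> V" using ww E_V by blast
  have fin: "finite (?out x)" "finite (?in x)" for x
    by (rule finite_subset[OF _ finite_nbrs[of x]], use D_E E_sym in blast)+
  have sum4: "card (?out x) + card (?in x) = 4" if "x \<in> V" for x
  proof -
    have "nbrs x = ?out x \<union> ?in x" using D_E D_or E_sym by blast
    moreover have "?out x \<inter> ?in x = {}" using D_asym by blast
    ultimately show ?thesis using card_nbrs[OF that] card_Un_disjoint[OF fin] by simp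
  qed
  have const: "card (?out x) = card (?out v)" if "x \<in> V" for x
  proof -
    obtain h where h: "h \<in> G" "h v = x" using vt vV \<open>x \<in> V\<close> by (auto simp: vertex_transitive_def)
    have "bij_betw h (?out v) (?out x)"
      by (rule bij_betw_byWitness[where f'="ginv h"])
        (use h D_inv[OF h(1)] in \<open>auto simp flip: h(2)\<close>, metis D_inv ginv_right)
    then show ?thesis by (metis bij_betw_same_card)
  qed
  \<comment> \<open>Arcs of D counted by tails and by heads. The out-valency d is constant by
    vertex-transitivity and the in-valency is 4 - d, so d = 2.\<close>
  have "(\<Sum>x\<in>V. card (?out x)) = (\<Sum>x\<in>V. card (?in x))"
  proof -
    have "(\<Sum>x\<in>V. card (?out x)) = (\<Sum>x\<in>V. \<Sum>y\<in>V. of_bool (D x y))"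
      using finite_V D_E E_V by (intro sum.cong refl) (auto simp: of_bool_def sum.If_cases intro!: arg_cong[where f=card])
    also have "\<dots> = (\<Sum>y\<in>V. \<Sum>x\<in>V. of_bool (D x y))" by (rule sum.swap)
    also have "\<dots> = (\<Sum>x\<in>V. card (?in x))"
      using finite_V D_E E_V by (intro sum.cong refl) (auto simp: of_bool_def sum.If_cases intro!: arg_cong[where f=card])
    finally show ?thesis .
  qed
  moreover have "(\<Sum>x\<in>V. card (?in x)) = (\<Sum>x\<in>V. 4 - card (?out v))"
    using sum4 const by (intro sum.cong refl) (metis add_diff_cancel_left')
  moreover have "(\<Sum>x\<in>V. card (?out x)) = (\<Sum>x\<in>V. card (?out v))"
    using const by (intro sum.cong refl)
  ultimately have "card V * card (?out v) = card V * (4 - card (?out v))" by simp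
  moreover have "card V \<noteq> 0" using finite_V vV by auto
  ultimately have "card (?out v) = 2" by simp
  then have two: "card (?out x) = 2" "card (?in x) = 2" if "x \<in> V" for x
    using const[OF that] sum4[OF that] by auto
  have uV: "u \<in> V" using g(4) E_V by blast
  show ?thesis
  proof (rule ccontr)
    assume ne: "g y \<noteq> y"
    have inv_out: "g x \<in> ?out u" if "x \<in> ?out u" for x using D_inv[OF g(1), of u x] that g(3) by simp
    have inv_in: "g x \<in> ?in u" if "x \<in> ?in u" for x using D_inv[OF g(1), of x u] that g(3) by simp
    have p3: "prime (3::nat)" by simp
    from D_or[OF g(4)] have "3 \<le> card (?out u) \<or> 3 \<le> card (?in u)"
      using prime_period_orbit[OF p3 g(2) ne _ inv_out fin(1)] prime_period_orbit[OF p3 g(2) ne _ inv_in fin(2)]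
      by blast
    then show False using two[OF uV] by simp
  qed
qed

end

section \<open>Orbits of 2-power length\<close>

context edge_transitive
begin

lemma ginv_ginv: "g \<in> G \<Longrightarrow> ginv (ginv g) = g"
  by (simp add: ginv_def)

lemma subgroup_G: "subgroup K \<G> \<Longrightarrow> k \<in> K \<Longrightarrow> k \<in> G"
  using subgroup.subset by fastforce

lemma subgroup_comp: "subgroup K \<G> \<Longrightarrow> k \<in> K \<Longrightarrow> l \<in> K \<Longrightarrow> k \<circ> l \<in> K"
  using subgroup.m_closed[of K \<G> k l] by simp

lemma subgroup_ginv: "subgroup K \<G> \<Longrightarrow> k \<in> K \<Longrightarrow> ginv k \<in> K"
  using subgroup.m_inv_closed[of K \<G> k] by (simp add: ginv_def)

lemma normal_conj:
  assumes "K \<lhd> \<G>" "k \<in> K" "h \<in> G"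
  shows "h \<circ> k \<circ> ginv h \<in> K"
  using assms by (auto simp: \<G>.normal_inv_iff ginv_def)

lemma normal_layer_locally_transitive:
  assumes loc: "\<And>v. locally_transitive v"
    and NM: "N \<lhd> \<G>" "M \<lhd> \<G>" "N \<subseteq> M" "card N = 2 ^ i" "card M = 2 ^ i * 3 ^ j"
    and x: "x \<in> M" "x ^^ 3 = id" "x \<noteq> id" "v0 \<in> V" "x v0 = v0"
  shows "\<exists>v\<in>V. \<forall>w w'. E v w \<longrightarrow> E v w' \<longrightarrow> (\<exists>n\<in>N. n v = v \<and> n w = w')"
proof -
  have M': "subgroup M \<G>" and N': "subgroup N \<G>" using NM normal_imp_subgroup by auto
  obtain v w0 where vw: "v \<in> V" "x v = v" "E v w0" "x w0 \<noteq> w0"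
    using fixed_point_propagates[OF subgroup_G[OF M' x(1)] x(3-5)] by blast
  define H where "H = M \<inter> act.stab v"
  have H_iff: "m \<in> H \<longleftrightarrow> m \<in> M \<and> m v = v" for m
    using subgroup_G[OF M'] by (auto simp: H_def act.stab_def)
  have H': "subgroup H \<G>" unfolding H_def
    by (rule \<G>.subgroups_Inter_pair[OF M' act.subgroup_stab[OF vw(1)]])
  interpret H: group "\<G>\<lparr>carrier := H\<rparr>" using H' subgroup.subgroup_is_group \<G>.group_axioms by blast
  have finH: "finite H" using finite_subset[OF subgroup.subset[OF H']] finite_G by simp
  interpret Ha: finite_action "\<G>\<lparr>carrier := H\<rparr>" "\<lambda>g x. g x" "nbrs v"
  proof unfold_locales
    show "g y \<in> nbrs v" if "g \<in> carrier (\<G>\<lparr>carrier := H\<rparr>)" "y \<in> nbrs v" for g y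
      using that nbrs_invariant[of g v y] subgroup_G[OF H'] by (simp add: H_iff)
  qed (use finH finite_nbrs in auto)
  have orb: "Ha.orb w = (\<lambda>g. g w) ` H" for w unfolding Ha.orb_def by simp
  have conjH: "h \<circ> m \<circ> ginv h \<in> H" if "m \<in> H" "h \<in> G" "h v = v" for h m
    using normal_conj[OF NM(2) _ that(2)] that ginv_eq[OF that(2,3)] by (simp add: H_iff)
  \<comment> \<open>H is normalised by the stabiliser of v in G, which is transitive on the
    neighbours of v, so the orbits of H there are translates of one another.\<close>
  have eqcard: "card (Ha.orb w) = card (Ha.orb w0)" if w: "w \<in> nbrs v" for w
  proof -
    obtain h where h: "h \<in> G" "h v = v" "h w0 = w"
      using loc[of v] vw(3) w unfolding locally_transitive_def by blast
    have "h ` Ha.orb w0 = Ha.orb w"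
    proof
      show "h ` Ha.orb w0 \<subseteq> Ha.orb w"
      proof
        fix y assume "y \<in> h ` Ha.orb w0"
        then obtain m where m: "m \<in> H" "y = h (m w0)" unfolding orb by blast
        then have "y = (h \<circ> m \<circ> ginv h) w" using h(1) by (simp flip: h(3))
        then show "y \<in> Ha.orb w" unfolding orb using conjH[OF m(1) h(1,2)] by blast
      qed
      show "Ha.orb w \<subseteq> h ` Ha.orb w0"
      proof
        fix y assume "y \<in> Ha.orb w"
        then obtain m where m: "m \<in> H" "y = m w" unfolding orb by blast
        have "ginv h \<circ> m \<circ> h \<in> H"
          using conjH[OF m(1) ginv_G[OF h(1)] ginv_eq[OF h(1,2)]] by (simp add: ginv_ginv h(1))
        moreover have "y = h ((ginv h \<circ> m \<circ> h) w0)" using h m by simp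
        ultimately show "y \<in> h ` Ha.orb w0" unfolding orb by blast
      qed
    qed
    moreover have "inj_on h (Ha.orb w0)" using G_inj[OF h(1)] by (auto simp: inj_on_def)
    ultimately show ?thesis using card_image by metis
  qed
  let ?c = "card (Ha.orb w0)"
  have w0: "w0 \<in> nbrs v" using vw(3) by simp
  have "?c * card (Ha.orb ` nbrs v) = card (\<Union>(Ha.orb ` nbrs v))"
  proof (rule card_partition)
    show "finite (\<Union>(Ha.orb ` nbrs v))" unfolding orb using finite_nbrs finH by auto
    show "c1 \<inter> c2 = {}" if "c1 \<in> Ha.orb ` nbrs v" "c2 \<in> Ha.orb ` nbrs v" "c1 \<noteq> c2" for c1 c2
      using that Ha.orb_disjoint by blast
  qed (use eqcard finite_nbrs in auto)
  moreover have "\<Union>(Ha.orb ` nbrs v) = nbrs v" using Ha.orb_self Ha.orb_subset by blast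
  ultimately have dvd4: "?c dvd 4" using card_nbrs[OF vw(1)] by (metis dvd_triv_left)
  \<comment> \<open>The element x lies in H and moves w0, which puts at least three points into this
    orbit; a divisor of 4 that is at least 3 is 4.\<close>
  have "3 \<le> ?c"
  proof (rule prime_period_orbit[OF _ x(2) vw(4) Ha.orb_self[OF w0]])
    show "x y \<in> Ha.orb w0" if "y \<in> Ha.orb w0" for y
    proof -
      obtain m where "m \<in> H" "y = m w0" using \<open>y \<in> Ha.orb w0\<close> unfolding orb by blast
      moreover have "x \<in> H" using x(1) vw(2) by (simp add: H_iff)
      ultimately show ?thesis unfolding orb
        by (intro image_eqI[of _ _ "x \<circ> m"]) (auto intro: subgroup_comp[OF H'])
    qed
  qed (unfold orb, use finH in auto)
  moreover have "?c \<le> 4" using dvd4 by (simp add: dvd_imp_le)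
  moreover have "?c \<noteq> 3" using dvd4 by auto
  ultimately have c4: "?c = 2 ^ 2" by simp
  then have orb_all: "Ha.orb w0 = nbrs v"
    using card_subset_eq[OF finite_nbrs Ha.orb_subset[OF w0]] card_nbrs[OF vw(1)] by simp
  have "card H \<noteq> 0" using finH subgroup.one_closed[OF H'] by auto
  then obtain \<alpha> m where m: "card H = 2 ^ \<alpha> * m" "\<not> 2 dvd m"
    using multiplicity_decompose'[of "card H" 2] not_prime_unit two_is_prime_nat by metis
  then obtain T where T: "subgroup T (\<G>\<lparr>carrier := H\<rparr>)" "card T = 2 ^ \<alpha>"
    using sylow_thm[of 2 "\<G>\<lparr>carrier := H\<rparr>" \<alpha> m] H.group_axioms finH by (auto simp: order_def)
  have trans: "nbrs v = (\<lambda>g. g w0) ` T"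
    using Ha.sylow_orbit[of 2 \<alpha> m T w0 2] m T w0 c4 orb_all by simp
  have T': "subgroup T \<G>" using \<G>.incl_subgroup[OF H' T(1)] .
  have TH: "T \<subseteq> H" using subgroup.subset[OF T(1)] by simp
  interpret M: group "\<G>\<lparr>carrier := M\<rparr>" using M' subgroup.subgroup_is_group \<G>.group_axioms by blast
  have finM: "finite M" using finite_subset[OF subgroup.subset[OF M']] finite_G by simp
  \<comment> \<open>The index of N in M is a power of 3, so N is a normal Sylow 2-subgroup of M and
    contains every 2-subgroup of M.\<close>
  have "T \<subseteq> N"
  proof (rule M.p_subgroup_in_normal_sylow)
    show "N \<lhd> \<G>\<lparr>carrier := M\<rparr>" by (rule \<G>.normal_restrict_supergroup[OF M' NM(1,3)])
    show "subgroup T (\<G>\<lparr>carrier := M\<rparr>)"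
      using T' M' TH by (intro \<G>.subgroup_incl) (auto simp: H_def)
    show "card (carrier (\<G>\<lparr>carrier := M\<rparr>)) = 2 ^ i * 3 ^ j" using NM(5) by simp
  qed (use finM NM(4) T(2) in auto)
  show ?thesis
  proof (intro bexI[of _ v] allI impI)
    fix w w' assume "E v w" "E v w'"
    then have "w \<in> (\<lambda>g. g w0) ` T" "w' \<in> (\<lambda>g. g w0) ` T" unfolding trans[symmetric] by auto
    then obtain t t' where t: "t \<in> T" "t w0 = w" "t' \<in> T" "t' w0 = w'" by blast
    have tG: "t \<in> G" using t(1) subgroup_G[OF T'] by blast
    have fx: "t v = v" "t' v = v" using t TH by (auto simp: H_iff subset_iff)
    have "t' \<circ> ginv t \<in> N" using t subgroup_comp[OF T'] subgroup_ginv[OF T'] \<open>T \<subseteq> N\<close> by blast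
    moreover have "(t' \<circ> ginv t) v = v" using fx ginv_eq[OF tG fx(1)] by simp
    moreover have "(t' \<circ> ginv t) w = w'" using t ginv_eq[OF tG t(2)] by simp
    ultimately show "\<exists>n\<in>N. n v = v \<and> n w = w'" by blast
  qed (use vw in simp)
qed

lemma orb_if_vertex_transitive: "vertex_transitive \<Longrightarrow> u \<in> V \<Longrightarrow> act.orb u = V"
  using act.orb_subset by (auto simp: orb_mem vertex_transitive_def)

lemma not_both_in_orbit:
  assumes nvt: "\<not> vertex_transitive" and "v \<in> V" "E x y"
  shows "x \<in> act.orb v \<longleftrightarrow> y \<notin> act.orb v"
proof
  assume "x \<in> act.orb v"
  then show "y \<notin> act.orb v" using edge_crosses[OF nvt assms(3)] act.orb_eq[OF assms(2)] by blast
next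
  assume y: "y \<notin> act.orb v"
  obtain w where w: "E v w" using ex_nbr assms(2) by blast
  show "x \<in> act.orb v"
    using edge_map[OF w assms(3)] y by (metis orb_mem)
qed

lemma orb_complement:
  assumes nvt: "\<not> vertex_transitive" and uw: "u \<in> V" "w \<in> V" "w \<notin> act.orb u"
  shows "act.orb w = V - act.orb u"
proof
  show "act.orb w \<subseteq> V - act.orb u"
    using act.orb_disjoint[OF uw(1,2)] uw act.orb_self act.orb_subset by blast
  show "V - act.orb u \<subseteq> act.orb w"
  proof
    fix y assume y: "y \<in> V - act.orb u"
    then obtain y' where y': "E y y'" using ex_nbr by blast
    obtain w' where w': "E w w'" using ex_nbr uw(2) by blast
    have in_u: "y' \<in> act.orb u" "w' \<in> act.orb u"
      using not_both_in_orbit[OF nvt uw(1)] y' w' y uw(3) by blast+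
    show "y \<in> act.orb w"
      using edge_map[OF w' y']
    proof cases
      case (1 g) then show ?thesis by (auto simp: orb_mem)
    next
      case (2 g)
      then have "y \<in> act.orb w'" by (auto simp: orb_mem)
      then show ?thesis using in_u y act.orb_eq[OF uw(1)] by blast
    qed
  qed
qed

text \<open>The edges between the halves are counted from both sides, four at each vertex.\<close>

lemma card_halves:
  assumes nvt: "\<not> vertex_transitive" and v: "v \<in> V"
  shows "card (V - act.orb v) = card (act.orb v)"
proof -
  let ?A = "act.orb v" and ?B = "V - act.orb v"
  have AV: "?A \<subseteq> V" using act.orb_subset[OF v] .
  have fin: "finite ?A" "finite ?B" using finite_V AV finite_subset by auto
  have A: "(\<Sum>b\<in>?B. of_bool (E a b)) = (4::nat)" if "a \<in> ?A" for a
  proof -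
    have "nbrs a = ?B \<inter> {b. E a b}" using not_both_in_orbit[OF nvt v] that E_V by blast
    then show ?thesis using card_nbrs[of a] AV that fin by (auto simp: of_bool_def sum.If_cases)
  qed
  have B: "(\<Sum>a\<in>?A. of_bool (E a b)) = (4::nat)" if "b \<in> ?B" for b
  proof -
    have "nbrs b = ?A \<inter> {a. E a b}" using not_both_in_orbit[OF nvt v] that E_V E_sym by blast
    then show ?thesis using card_nbrs[of b] that fin by (auto simp: of_bool_def sum.If_cases)
  qed
  have "4 * card ?A = (\<Sum>a\<in>?A. \<Sum>b\<in>?B. of_bool (E a b))" using A by simp
  also have "\<dots> = (\<Sum>b\<in>?B. \<Sum>a\<in>?A. of_bool (E a b))" by (rule sum.swap)
  also have "\<dots> = 4 * card ?B" using B by simp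
  finally show ?thesis by simp
qed

text \<open>Since N is normal, the neighbours of any vertex in the G-orbit of v lie in a single
  N-orbit, whose size is a power of 2. If G is vertex-transitive, there are at most two N-orbits,
  and they are translates of each other. Otherwise the half without v is one N-orbit, and the half
  of v has the same size.\<close>

lemma orbits_two_power:
  assumes N: "N \<lhd> \<G>" "card N = 2 ^ i" and v: "v \<in> V"
    and tr: "\<forall>w w'. E v w \<longrightarrow> E v w' \<longrightarrow> (\<exists>n\<in>N. n v = v \<and> n w = w')"
    and u: "u \<in> V"
  shows "\<exists>k. card (act.orb u) = 2 ^ k"
proof -
  have N': "subgroup N \<G>" using N(1) normal_imp_subgroup by blast
  have idN: "id \<in> N" using subgroup.one_closed[OF N'] by simp
  let ?o = "\<lambda>x. (\<lambda>n. n x) ` N"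
  have self: "x \<in> ?o x" for x using idN by (intro image_eqI[of _ _ id]) auto
  interpret Na: finite_action "\<G>\<lparr>carrier := N\<rparr>" "\<lambda>g x. g x" V using act.subgroup_action[OF N'] .
  have o: "Na.orb x = ?o x" for x unfolding Na.orb_def by simp
  have o_pow: "\<exists>k. card (?o x) = 2 ^ k" if "x \<in> V" for x
  proof -
    have "card (?o x) dvd 2 ^ i" using Na.orbit_stabilizer[OF that] N(2) unfolding o by (metis dvd_triv_left monoid.select_convs partial_object.update_convs(1) partial_object.select_convs(1))
    then show ?thesis using divides_primepow_nat[of 2 "card (?o x)" i] by auto
  qed
  have tr': "?o y' = ?o y" if x: "x \<in> act.orb v" and E: "E x y" "E x y'" for x y y'
  proof -
    obtain g where g: "g \<in> G" "g v = x" using x by (auto simp: orb_mem)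
    have "E v (ginv g y)" "E v (ginv g y')"
      using E G_E[OF g(1), of v "ginv g y"] G_E[OF g(1), of v "ginv g y'"] g by auto
    then obtain n where n: "n \<in> N" "n v = v" "n (ginv g y) = ginv g y'" using tr by blast
    have "(g \<circ> n \<circ> ginv g) y = y'" using n g by simp
    moreover have "g \<circ> n \<circ> ginv g \<in> N" using normal_conj[OF N(1) n(1) g(1)] .
    ultimately have "y' \<in> Na.orb y" unfolding o by blast
    then show ?thesis using Na.orb_eq[of y y'] E_V[OF E(1)] unfolding o by blast
  qed
  obtain w where w: "E v w" using ex_nbr v by blast
  have wV: "w \<in> V" using w E_V by blast
  have reach: "E\<^sup>*\<^sup>* w y" if "y \<in> V" for y using conn wV that by (auto simp: connected_graph_def)
  show ?thesis
  proof (cases vertex_transitive)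
    case True
    have all: "x \<in> act.orb v" if "x \<in> V" for x using orb_if_vertex_transitive[OF True v] that by simp
    \<comment> \<open>Moving the edge from a to b by n gives a neighbour \<open>n b\<close> of x,
      and all neighbours of x share an N-orbit.\<close>
    have step: "E x y \<Longrightarrow> x \<in> ?o a \<Longrightarrow> E a b \<Longrightarrow> y \<in> ?o b" for x y a b
    proof -
      assume xy: "E x y" and "x \<in> ?o a" and ab: "E a b"
      then obtain n where n: "n \<in> N" "n a = x" by blast
      have "E x (n b)" using G_E[OF subgroup_G[OF N' n(1)], of a b] ab n by simp
      then have "?o y = ?o (n b)" using tr'[OF all, of x "n b" y] xy E_V by blast
      moreover have "?o (n b) = ?o b" using Na.orb_eq[of b "n b"] n(1) E_V[OF ab] unfolding o by blast
      moreover have "y \<in> ?o y" by (rule self)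
      ultimately show "y \<in> ?o b" by simp
    qed
    have "V \<subseteq> ?o v \<union> ?o w"
    proof
      fix y assume "y \<in> V"
      from reach[OF this] show "y \<in> ?o v \<union> ?o w"
      proof (induction rule: rtranclp_induct)
        case base then show ?case using self by blast
      next
        case (step y z)
        then show ?case using \<open>\<And>x y a b. E x y \<Longrightarrow> x \<in> ?o a \<Longrightarrow> E a b \<Longrightarrow> y \<in> ?o b\<close>[of y z] w E_sym[OF w] by blast
      qed
    qed
    then have V: "V = ?o v \<union> ?o w" using Na.orb_subset[OF v] Na.orb_subset[OF wV] unfolding o by blast
    obtain k where k: "card (?o v) = 2 ^ k" using o_pow[OF v] by blast
    show ?thesis
    proof (cases "?o v = ?o w")
      case True
      then have "card V = 2 ^ k" using V k by simp
      then show ?thesis using orb_if_vertex_transitive[OF \<open>vertex_transitive\<close> u] by auto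
    next
      case False
      obtain g where g: "g \<in> G" "g v = w" using True v wV by (auto simp: vertex_transitive_def)
      have "g ` ?o v = ?o w"
      proof
        show "g ` ?o v \<subseteq> ?o w"
        proof clarify
          fix n assume n: "n \<in> N"
          have "g (n v) = (g \<circ> n \<circ> ginv g) w" using g by auto
          then show "g (n v) \<in> ?o w" using normal_conj[OF N(1) n g(1)] by blast
        qed
        show "?o w \<subseteq> g ` ?o v"
        proof clarify
          fix n assume n: "n \<in> N"
          have "ginv g \<circ> n \<circ> g \<in> N"
            using normal_conj[OF N(1) n ginv_G[OF g(1)]] by (simp add: ginv_ginv g(1))
          moreover have "n w = g ((ginv g \<circ> n \<circ> g) v)" using g by simp
          ultimately show "n w \<in> g ` ?o v" by blast
        qed
      qed
      moreover have "inj_on g (?o v)" using G_inj[OF g(1)] by (auto simp: inj_on_def)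
      ultimately have "card (?o w) = 2 ^ k" using k card_image by metis
      moreover have "?o v \<inter> ?o w = {}" using False Na.orb_disjoint[OF v wV] unfolding o by blast
      moreover have "finite N" using finite_subset[OF subgroup.subset[OF N']] finite_G by simp
      ultimately have "card V = 2 ^ k + 2 ^ k" using k by (subst V, subst card_Un_disjoint) auto
      then have "card V = 2 ^ Suc k" by simp
      then show ?thesis using orb_if_vertex_transitive[OF \<open>vertex_transitive\<close> u] by metis
    qed
  next
    case nvt: False
    let ?A = "act.orb v"
    have wA: "w \<notin> ?A" using edge_crosses[OF nvt w] .
    \<comment> \<open>Invariant for walking along a path from w: the first clause at a vertex of
      \<open>?A\<close> hands membership in \<open>?o w\<close> on to the next vertex.\<close>
    have P: "(y \<in> ?A \<longrightarrow> (\<forall>z. E y z \<longrightarrow> z \<in> ?o w)) \<and> (y \<notin> ?A \<longrightarrow> y \<in> ?o w)" if "y \<in> V" for y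
      using reach[OF that]
    proof (induction rule: rtranclp_induct)
      case base show ?case using wA self by blast
    next
      case (step y z)
      show ?case
      proof (cases "y \<in> ?A")
        case True
        then have "z \<notin> ?A" "z \<in> ?o w" using not_both_in_orbit[OF nvt v step.hyps(2)] step by blast+
        then show ?thesis by blast
      next
        case False
        then have zA: "z \<in> ?A" and y: "y \<in> ?o w"
          using not_both_in_orbit[OF nvt v E_sym[OF step.hyps(2)]] step.IH by blast+
        have "x \<in> ?o w" if "E z x" for x
        proof -
          have "?o x = ?o y" using tr'[OF zA E_sym[OF step.hyps(2)] that] .
          moreover have "?o y = ?o w" using Na.orb_eq[OF wV, of y] y unfolding o by blast
          moreover have "x \<in> ?o x" by (rule self)
          ultimately show ?thesis by simp
        qed
        then show ?thesis using zA by blast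
      qed
    qed
    have B: "act.orb w = V - ?A" using orb_complement[OF nvt v wV wA] .
    moreover have "V - ?A = ?o w"
    proof
      show "V - ?A \<subseteq> ?o w" using P by blast
      have "?o w \<subseteq> act.orb w" using subgroup_G[OF N'] orb_mem by blast
      then show "?o w \<subseteq> V - ?A" using B by simp
    qed
    ultimately obtain k where k: "card (V - ?A) = 2 ^ k" using o_pow[OF wV] by auto
    have kA: "card ?A = 2 ^ k" using card_halves[OF nvt v] k by simp
    show ?thesis
    proof (cases "u \<in> ?A")
      case True
      then show ?thesis using act.orb_eq[OF v] kA by metis
    next
      case False
      then show ?thesis using orb_complement[OF nvt v u] k by metis
    qed
  qed
qed

lemma orbits_two_power_if_no_semiregular:
  assumes no: "\<And>g. g \<in> G \<Longrightarrow> \<not> semiregular_element V g" and u: "u \<in> V"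
  shows "\<exists>k. card (act.orb u) = 2 ^ k"
proof -
  obtain a b where ab: "card G = 2 ^ a * 3 ^ b" using two_three_order[OF no] by blast
  have p3: "prime (3::nat)" by simp
  show ?thesis
  proof (cases "b = 0")
    case True
    have "card (act.orb u) dvd 2 ^ a" using act.orbit_stabilizer[OF u] ab True by (metis dvd_triv_left mult.right_neutral partial_object.select_convs(1) power_0)
    then show ?thesis using divides_primepow_nat[of 2] by auto
  next
    case False
    have fixing: "\<exists>v\<in>V. x v = v" if "x \<in> G" "x ^^ 3 = id" "x \<noteq> id" for x
      using semiregularI[OF that(1) p3 that(2,3)] no[OF that(1)] by blast
    \<comment> \<open>Since 3 divides |G|, there is an element of order 3, and it fixes a vertex.
      Without local transitivity it would fix all neighbours of its fixed vertices.\<close>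
    have loc: "locally_transitive v" for v
    proof (rule ccontr)
      assume nl: "\<not> locally_transitive v"
      then have vt: vertex_transitive using locally_transitive_if_not_vertex_transitive by blast
      have "3 dvd card G" using ab False by simp
      then obtain x where x: "x \<in> G" "x \<noteq> id" "x ^^ 3 = id" using ex_prime_order[OF p3] by blast
      obtain v' where "v' \<in> V" "x v' = v'" using fixing x by blast
      then show False using fixed_point_propagates[OF x(1,2)] half_arc_transitive_fixes_nbrs[OF vt nl x(1,3)] by blast
    qed
    have "finite (carrier \<G>)" "card (carrier \<G>) = 2 ^ a * 3 ^ b" "b > 0" using ab False finite_G by auto
    then obtain N M i j where NM: "N \<lhd> \<G>" "M \<lhd> \<G>" "N \<subseteq> M" "card N = 2 ^ i" "card M = 2 ^ i * 3 ^ j" "j > 0"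
      by (rule \<G>.two_three_group_layer)
    have M': "subgroup M \<G>" using NM normal_imp_subgroup by blast
    interpret M: group "\<G>\<lparr>carrier := M\<rparr>" using M' subgroup.subgroup_is_group \<G>.group_axioms by blast
    have "finite M" using finite_subset[OF subgroup.subset[OF M']] finite_G by simp
    moreover have "3 dvd card M" using NM by simp
    ultimately obtain x where "x \<in> M" "x \<noteq> id" "x [^]\<^bsub>\<G>\<lparr>carrier := M\<rparr>\<^esub> (3::nat) = id"
      using M.cauchy[of 3] p3 by auto
    then have x: "x \<in> M" "x \<noteq> id" "x ^^ 3 = id" using \<G>.nat_pow_consistent[of x 3 M] pow_G[of x 3] by auto
    obtain v0 where v0: "v0 \<in> V" "x v0 = v0" using fixing[OF subgroup_G[OF M' x(1)] x(3,2)] by blast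
    obtain v where "v \<in> V" "\<forall>w w'. E v w \<longrightarrow> E v w' \<longrightarrow> (\<exists>n\<in>N. n v = v \<and> n w = w')"
      using normal_layer_locally_transitive[OF loc NM(1-5) x(1,3,2) v0] by blast
    then show ?thesis using orbits_two_power[OF NM(1,4)] u by blast
  qed
qed

text \<open>The Sylow subgroup S is transitive on each G-orbit and commutes with z, so z fixes an
  orbit pointwise as soon as it fixes one of its vertices. As z is not semiregular it fixes some v;
  as z is not the identity, the orbit of v is not everything and z moves all vertices outside
  it.\<close>

lemma two_twisted_halves:
  assumes no: "\<And>g. g \<in> G \<Longrightarrow> \<not> semiregular_element V g"
  obtains v z k where "\<not> vertex_transitive" "v \<in> V" "z \<in> G" "z \<circ> z = id" "\<And>a. a \<in> act.orb v \<Longrightarrow> z a = a"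
    "\<And>b. b \<in> V - act.orb v \<Longrightarrow> z b \<noteq> b" "card (act.orb v) = 2 ^ k"
proof -
  have "card G \<noteq> 0" using finite_G id_G by auto
  then obtain a m where m: "card G = 2 ^ a * m" "\<not> 2 dvd m"
    using multiplicity_decompose'[of "card G" 2] not_prime_unit two_is_prime_nat by metis
  then obtain S where S: "subgroup S \<G>" "card S = 2 ^ a"
    using sylow_thm[of 2 \<G> a m] \<G>.group_axioms finite_G by (auto simp: order_def)
  have S_orb: "act.orb u = (\<lambda>g. g u) ` S" if u: "u \<in> V" for u
  proof -
    obtain i where "card (act.orb u) = 2 ^ i" using orbits_two_power_if_no_semiregular[OF no u] by blast
    then show ?thesis using act.sylow_orbit[of 2 a m S u i] m S u by simp
  qed
  interpret S: group "\<G>\<lparr>carrier := S\<rparr>" using S(1) subgroup.subgroup_is_group \<G>.group_axioms by blast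
  have finS: "finite S" using finite_subset[OF subgroup.subset[OF S(1)]] finite_G by simp
  \<comment> \<open>If S were trivial, all G-orbits would be singletons, and no element could map
    one edge at v to another.\<close>
  have "a > 0"
  proof (rule ccontr)
    assume "\<not> a > 0"
    then have "card S = 1" using S(2) by simp
    moreover have "id \<in> S" using subgroup.one_closed[OF S(1)] by simp
    ultimately have "S = {id}" by (auto simp: card_1_singleton_iff)
    then have triv: "g x = x" if "g \<in> G" "x \<in> V" for g x using S_orb[OF that(2)] that(1) orb_mem[of "g x" x] by auto
    obtain v where v: "v \<in> V" using conn by (auto simp: connected_graph_def)
    have "\<not> card (nbrs v) \<le> 1" using card_nbrs[OF v] by simp
    then obtain w w' where ww: "E v w" "E v w'" "w \<noteq> w'"
      using finite_nbrs[of v] by (auto simp: card_le_Suc0_iff_eq)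
    show False using edge_map[OF ww(1,2)] triv ww E_V E_irrefl by metis
  qed
  then obtain z where "z \<in> S" "z \<noteq> id" "z [^]\<^bsub>\<G>\<lparr>carrier := S\<rparr>\<^esub> (2::nat) = id"
    and comm: "\<And>x. x \<in> S \<Longrightarrow> x \<circ> z = z \<circ> x"
    using S.p_group_central_element[of 2 a] S(2) finS by auto
  then have z: "z \<in> S" "z \<noteq> id" "z ^^ 2 = id" using \<G>.nat_pow_consistent[of z 2 S] pow_G[of z 2] by auto
  have zG: "z \<in> G" using z(1) subgroup_G[OF S(1)] by blast
  have zz: "z \<circ> z = id" using z(3) by (simp add: numeral_2_eq_2)
  have two: "prime (2::nat)" by simp
  obtain v where v: "v \<in> V" "z v = v" using semiregularI[OF zG two z(3,2)] no[OF zG] by blast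
  have fix_orb: "z y = y" if u: "u \<in> V" "z u = u" "y \<in> act.orb u" for u y
  proof -
    obtain s where s: "s \<in> S" "y = s u" using S_orb[OF u(1)] u(3) by auto
    have "z (s u) = s (z u)" using comm[OF s(1)] by (metis comp_apply)
    then show ?thesis using u(2) s(2) by simp
  qed
  have not_all: "\<not> (\<forall>y\<in>V. z y = y)"
    using z(2) permutes_not_in[OF G_permutes[OF zG]] by (metis eq_id_iff)
  have nvt: "\<not> vertex_transitive"
    using orb_if_vertex_transitive[OF _ v(1)] fix_orb[OF v] not_all by blast
  have moved: "z b \<noteq> b" if b: "b \<in> V - act.orb v" for b
  proof
    assume "z b = b"
    then have "z y = y" if "y \<in> V - act.orb v" for y
      using fix_orb[of b y] orb_complement[OF nvt v(1), of b] b that by blast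
    then show False using fix_orb[OF v] not_all by blast
  qed
  obtain k where "card (act.orb v) = 2 ^ k" using orbits_two_power_if_no_semiregular[OF no v(1)] by blast
  then show thesis using that[OF nvt v(1) zG zz] fix_orb[OF v] moved by blast
qed

end

section \<open>Twins\<close>

text \<open>A walk that never turns back must repeat a vertex, and its first repetition is a return
  to the start. The closed walk is then closed under adjacency, so by connectedness it covers
  \<open>Q\<close>.\<close>

lemma connected_two_regular_cycle:
  fixes R :: "'q \<Rightarrow> 'q \<Rightarrow> bool" and Q :: "'q set"
  assumes fin: "finite Q" and Q0: "x0 \<in> Q" and R_sym: "\<And>x y. R x y \<Longrightarrow> R y x" and R_irr: "\<And>x. \<not> R x x"
    and R_Q: "\<And>x y. R x y \<Longrightarrow> x \<in> Q \<and> y \<in> Q" and deg: "\<And>x. x \<in> Q \<Longrightarrow> card {y. R x y} = 2"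
    and reach: "\<And>y. y \<in> Q \<Longrightarrow> R\<^sup>*\<^sup>* x0 y"
  obtains f where "bij_betw f {0..<card Q} Q"
    "\<And>i j. i < card Q \<Longrightarrow> j < card Q \<Longrightarrow> R (f i) (f j) \<longleftrightarrow> (i + 1) mod card Q = j \<or> (j + 1) mod card Q = i"
proof -
  have other: "\<exists>y'. R x y' \<and> y' \<noteq> y" if "x \<in> Q" for x y
  proof (rule ccontr)
    assume "\<not> ?thesis"
    then have "{y. R x y} \<subseteq> {y}" by blast
    then have "card {y. R x y} \<le> 1" using card_mono[of "{y}"] by fastforce
    then show False using deg[OF that] by simp
  qed
  define nx where "nx = (\<lambda>x y. SOME y'. R x y' \<and> y' \<noteq> y)"
  have nx: "R x (nx x y)" "nx x y \<noteq> y" if "x \<in> Q" for x y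
    using someI_ex[OF other[OF that, of y]] by (auto simp: nx_def)
  obtain x1 where x1: "R x0 x1" using other[OF Q0] by blast
  \<comment> \<open>The state is the pair of current and next vertex, so that the step knows which
    neighbour to avoid.\<close>
  define s where "s = (\<lambda>i. ((\<lambda>(x, y). (y, nx y x)) ^^ i) (x0, x1))"
  define f where "f = (\<lambda>i. fst (s i))"
  have s_Suc: "s (Suc i) = (snd (s i), nx (snd (s i)) (fst (s i)))" for i
    by (simp add: s_def case_prod_beta)
  have f0: "f 0 = x0" by (simp add: f_def s_def)
  have s_R: "R (fst (s i)) (snd (s i))" for i
  proof (induction i)
    case 0 then show ?case using x1 by (simp add: s_def)
  next
    case (Suc i) then show ?case using nx(1) R_Q by (simp add: s_Suc)
  qed
  have f_R: "R (f i) (f (Suc i))" for i using s_R[of i] by (simp add: f_def s_Suc)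
  have f_Q: "f i \<in> Q" for i using f_R R_Q by blast
  have f_ne: "f (Suc (Suc i)) \<noteq> f i" for i
    using nx(2) R_Q[OF s_R[of i]] by (simp add: f_def s_Suc)
  have nb: "{y. R x y} = {y1, y2}" if "R x y1" "R x y2" "y1 \<noteq> y2" for x y1 y2
  proof (rule card_seteq[symmetric])
    show "finite {y. R x y}" using finite_subset[OF _ fin] R_Q by blast
    show "card {y. R x y} \<le> card {y1, y2}" using deg[of x] R_Q[OF that(1)] that(3) by simp
  qed (use that in auto)
  have nb_f: "{y. R (f (Suc i)) y} = {f i, f (Suc (Suc i))}" for i
    using nb[OF R_sym[OF f_R[of i]] f_R[of "Suc i"]] f_ne[of i] by auto
  have "\<not> inj f" using fin f_Q finite_subset[of "range f" Q] finite_imageD[of f UNIV] by auto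
  then have "\<exists>m. \<exists>j<m. f m = f j" by (metis injI linorder_neqE_nat)
  then obtain m where m: "\<exists>j<m. f m = f j" and least: "\<And>i. i < m \<Longrightarrow> \<not> (\<exists>j<i. f i = f j)"
    using exists_least_iff[of "\<lambda>m. \<exists>j<m. f m = f j"] by blast
  have inj: "inj_on f {0..<m}"
    by (rule linorder_inj_onI) (use least in \<open>auto, metis\<close>)
  obtain j where j: "j < m" "f m = f j" using m by blast
  \<comment> \<open>The predecessor of the repeated vertex is adjacent to \<open>f j\<close>. For j
    > 0 both neighbours of \<open>f j\<close> are already known, namely its predecessor and
    successor on the walk, and neither can occur there.\<close>
  have j0: "j = 0"
  proof (rule ccontr)
    assume "j \<noteq> 0"
    then obtain j' where j': "j = Suc j'" by (cases j) auto
    obtain m' where m': "m = Suc m'" using j by (cases m) auto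
    have "R (f j) (f m')" using R_sym[OF f_R[of m']] j m' by simp
    then have "f m' = f j' \<or> f m' = f (Suc j)" using nb_f[of j'] j' by blast
    then show False
    proof
      assume "f m' = f j'"
      then have "m' = j'" using inj j j' m' by (auto simp: inj_on_def)
      then show False using j j' m' by simp
    next
      assume eq: "f m' = f (Suc j)"
      show False
      proof (cases "Suc j < m")
        case True
        then have "m' = Suc j" using eq inj m' by (auto simp: inj_on_def)
        then show False using f_ne[of j] j m' by simp
      next
        case False
        then have "m = Suc j" using j by simp
        then show False using f_R[of j] R_irr j by metis
      qed
    qed
  qed
  have fm: "f m = f 0" using j j0 by simp
  have m3: "m \<ge> 3"
  proof -
    have "m \<noteq> 0" "m \<noteq> 1" "m \<noteq> 2"
      using j j0 f_R[of 0] R_irr fm f_ne[of 0] by (auto simp: numeral_2_eq_2)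
    then show ?thesis by simp
  qed
  \<comment> \<open>The index \<open>(i + m - 1) mod m\<close> is the cyclic predecessor of i,
    written without truncating subtraction at 0.\<close>
  have nb_all: "{y. R (f i) y} = {f ((i + 1) mod m), f ((i + m - 1) mod m)}" if "i < m" for i
  proof (cases i)
    case 0
    have "f (m - 1) \<noteq> f 1" using inj_onD[OF inj, of "m - 1" 1] m3 by auto
    moreover have "R (f 0) (f (m - 1))" using R_sym[OF f_R[of "m - 1"]] m3 fm by simp
    ultimately show ?thesis using nb[OF f_R[of 0], of "f (m - 1)"] 0 m3 by auto
  next
    case (Suc i')
    have "f (Suc i mod m) = f (Suc i)"
    proof (cases "Suc i = m")
      case True then show ?thesis using fm by simp
    next
      case False then show ?thesis using that by simp
    qed
    moreover have "(i + m - 1) mod m = i'" using Suc that by simp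
    ultimately show ?thesis using nb_f[of i'] Suc by auto
  qed
  have img: "f ` {0..<m} = Q"
  proof
    show "f ` {0..<m} \<subseteq> Q" using f_Q by blast
    show "Q \<subseteq> f ` {0..<m}"
    proof
      fix y assume "y \<in> Q"
      from reach[OF this] show "y \<in> f ` {0..<m}"
      proof (induction rule: rtranclp_induct)
        case base then show ?case using f0 m3 by force
      next
        case (step y z)
        then obtain i where i: "i < m" "y = f i" by auto
        then have "z = f ((i + 1) mod m) \<or> z = f ((i + m - 1) mod m)" using nb_all[OF i(1)] step(2) by blast
        then show ?case using m3 by auto
      qed
    qed
  qed
  have cQ: "card Q = m" using card_image[OF inj] img by simp
  show thesis
  proof
    show "bij_betw f {0..<card Q} Q" using inj img cQ by (simp add: bij_betw_def)
    fix i l assume il: "i < card Q" "l < card Q"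
    have mods: "(i + 1) mod m < m" "(i + m - 1) mod m < m" using m3 by auto
    have "R (f i) (f l) \<longleftrightarrow> f l = f ((i + 1) mod m) \<or> f l = f ((i + m - 1) mod m)"
      using nb_all[of i] il cQ by blast
    also have "\<dots> \<longleftrightarrow> l = (i + 1) mod m \<or> l = (i + m - 1) mod m"
      using inj il cQ mods by (auto simp: inj_on_def)
    also have "l = (i + m - 1) mod m \<longleftrightarrow> (l + 1) mod m = i"
    proof
      assume "l = (i + m - 1) mod m"
      then have "(l + 1) mod m = (i + m - 1 + 1) mod m" by (simp only: mod_add_left_eq)
      also have "\<dots> = i" using il cQ m3 by simp
      finally show "(l + 1) mod m = i" .
    next
      assume a: "(l + 1) mod m = i"
      show "l = (i + m - 1) mod m"
      proof (cases "l + 1 = m")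
        case True then show ?thesis using a by auto
      next
        case False
        then have "i = l + 1" using a il cQ by simp
        then show ?thesis using il cQ by simp
      qed
    qed
    finally show "R (f i) (f l) \<longleftrightarrow> (i + 1) mod card Q = l \<or> (l + 1) mod card Q = i" using cQ by auto
  qed
qed

text \<open>Modulo 4, differing by 1 or -1 is the same as having opposite parity; thus W(4,2) is the
  complete bipartite graph K_{4,4}.\<close>

lemma wreath_4_iff:
  "wreath_E 4 p q \<longleftrightarrow> p \<in> wreath_V 4 \<and> q \<in> wreath_V 4 \<and> (even (fst p) \<noteq> even (fst q))"
proof -
  have iff: "((i + 1) mod 4 = j \<or> (j + 1) mod 4 = i) \<longleftrightarrow> even i \<noteq> even j" if "i < 4" "j < 4" for i j :: nat
  proof -
    have "i = 0 \<or> i = 1 \<or> i = 2 \<or> i = 3" "j = 0 \<or> j = 1 \<or> j = 2 \<or> j = 3" using that by linarith+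
    then show ?thesis by (elim disjE) simp_all
  qed
  show ?thesis using iff[of "fst p" "fst q"] unfolding wreath_E_def
    by (auto simp: wreath_V_def mem_Times_iff simp del: One_nat_def)
qed

section \<open>Twin classes and wreath graphs\<close>

context edge_transitive
begin

definition cls :: "'a \<Rightarrow> 'a set" where "cls x = {y \<in> V. nbrs y = nbrs x}"

text \<open>True for one chosen representative of each twin class. In a class of size 2 it separates
  the twins, and so supplies the coordinate in Z_2 for both families of graphs.\<close>

definition mark :: "'a \<Rightarrow> bool" where "mark x \<longleftrightarrow> x = (SOME y. y \<in> cls x)"

lemma cls_self: "x \<in> V \<Longrightarrow> x \<in> cls x"
  by (simp add: cls_def)

lemma cls_eq: "y \<in> cls x \<Longrightarrow> cls y = cls x"
  by (auto simp: cls_def)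

lemma cls_V: "cls x \<subseteq> V"
  by (auto simp: cls_def)

lemma finite_cls: "finite (cls x)"
  using finite_V by (simp add: cls_def)

lemma E_cls: "y \<in> cls x \<Longrightarrow> E a x \<longleftrightarrow> E a y"
proof -
  assume "y \<in> cls x"
  then have "E x a \<longleftrightarrow> E y a" by (auto simp: cls_def)
  then show ?thesis using E_sym by blast
qed

lemma cls_subset_nbrs: "E a x \<Longrightarrow> cls x \<subseteq> nbrs a"
  using E_cls by blast

lemma cls_image:
  assumes "g \<in> G" "x \<in> V"
  shows "cls (g x) = g ` cls x"
proof -
  have nb: "nbrs (g u) = g ` nbrs u" if "g \<in> G" for u g
  proof
    show "g ` nbrs u \<subseteq> nbrs (g u)" using G_E[OF that] by auto
    show "nbrs (g u) \<subseteq> g ` nbrs u"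
    proof
      fix y assume "y \<in> nbrs (g u)"
      then have "E u (ginv g y)" using G_E[OF that, of u "ginv g y"] that by simp
      then show "y \<in> g ` nbrs u" using that by (intro image_eqI[of _ _ "ginv g y"]) auto
    qed
  qed
  have inj: "inj g" using permutes_inj[OF G_permutes[OF assms(1)]] .
  show ?thesis
  proof
    show "g ` cls x \<subseteq> cls (g x)"
    proof
      fix y assume "y \<in> g ` cls x"
      then obtain w where w: "y = g w" "w \<in> V" "nbrs w = nbrs x" by (auto simp: cls_def)
      then have "nbrs y = nbrs (g x)" using nb[OF assms(1), of w] nb[OF assms(1), of x] by simp
      then show "y \<in> cls (g x)" using w G_V[OF assms(1)] by (simp add: cls_def)
    qed
    show "cls (g x) \<subseteq> g ` cls x"
    proof
      fix y assume y: "y \<in> cls (g x)"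
      have gy: "g (ginv g y) = y" using assms(1) by simp
      have "g ` nbrs (ginv g y) = g ` nbrs x"
        using y nb[OF assms(1), of "ginv g y"] nb[OF assms(1), of x] gy by (simp add: cls_def)
      then have "nbrs (ginv g y) = nbrs x" using inj by (simp add: inj_image_eq_iff)
      moreover have "ginv g y \<in> V" using y G_V[OF ginv_G[OF assms(1)]] by (simp add: cls_def)
      ultimately have "ginv g y \<in> cls x" by (simp add: cls_def)
      then show "y \<in> g ` cls x" using gy by (metis imageI)
    qed
  qed
qed

lemma card_cls_image: "g \<in> G \<Longrightarrow> x \<in> V \<Longrightarrow> card (cls (g x)) = card (cls x)"
  using cls_image card_image[of g "cls x"] permutes_inj[OF G_permutes] inj_on_subset by (metis subset_UNIV)

lemma cls_le_4: "x \<in> V \<Longrightarrow> card (cls x) \<le> 4"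
proof -
  assume x: "x \<in> V"
  then obtain a where "E a x" using ex_nbr E_sym by blast
  then show ?thesis using card_mono[OF finite_nbrs cls_subset_nbrs] card_nbrs E_V by metis
qed

text \<open>G permutes the twin classes inside the orbit transitively, so they have equal size,
  which divides 2^k. The size is at most 4 because a class lies in the neighbourhood of any adjacent
  vertex.\<close>

lemma cls_orbit_power:
  assumes k: "card (act.orb u) = 2 ^ k" and u: "u \<in> V" and sub: "\<And>x. x \<in> act.orb u \<Longrightarrow> cls x \<subseteq> act.orb u"
  shows "card (cls u) \<in> {1, 2, 4}" "card (cls ` act.orb u) * card (cls u) = 2 ^ k"
proof -
  have orbV: "act.orb u \<subseteq> V" using act.orb_subset[OF u] .
  have eq: "card (cls x) = card (cls u)" if "x \<in> act.orb u" for x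
  proof -
    obtain g where "g \<in> G" "g u = x" using \<open>x \<in> act.orb u\<close> orb_mem by blast
    then show ?thesis using card_cls_image[OF _ u] by blast
  qed
  have "card (cls u) * card (cls ` act.orb u) = card (\<Union>(cls ` act.orb u))"
  proof (rule card_partition)
    show "finite (cls ` act.orb u)" using finite_subset[OF orbV finite_V] by simp
    show "finite (\<Union>(cls ` act.orb u))" using finite_subset[OF _ finite_V] cls_V by blast
    show "c1 \<inter> c2 = {}" if "c1 \<in> cls ` act.orb u" "c2 \<in> cls ` act.orb u" "c1 \<noteq> c2" for c1 c2
      using that cls_eq by blast
  qed (use eq in blast)
  moreover have "\<Union>(cls ` act.orb u) = act.orb u" using sub cls_self orbV by blast
  ultimately have prod: "card (cls u) * card (cls ` act.orb u) = 2 ^ k" using k by simp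
  then show "card (cls ` act.orb u) * card (cls u) = 2 ^ k" by (simp add: mult.commute)
  have "card (cls u) dvd 2 ^ k" using prod by (metis dvd_triv_left)
  then obtain i where i: "card (cls u) = 2 ^ i" using divides_primepow_nat[of 2] by auto
  have "i \<le> 2"
  proof (rule ccontr)
    assume "\<not> i \<le> 2"
    then have "(2::nat) ^ 3 \<le> 2 ^ i" by (intro power_increasing) auto
    then show False using cls_le_4[OF u] i by simp
  qed
  then have "i = 0 \<or> i = 1 \<or> i = 2" by auto
  then show "card (cls u) \<in> {1, 2, 4}" using i by auto
qed

lemma mark_inj:
  assumes "x \<in> V" "y \<in> V" "cls x = cls y" "mark x = mark y" "card (cls x) = 2"
  shows "x = y"
proof -
  have xy: "x \<in> cls x" "y \<in> cls x" using assms cls_self by auto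
  let ?r = "SOME y. y \<in> cls x"
  have r: "?r \<in> cls x" using someI[of "\<lambda>y. y \<in> cls x"] xy by blast
  show ?thesis
  proof (cases "mark x")
    case True
    then show ?thesis using assms(3,4) by (simp add: mark_def)
  next
    case False
    then have ne: "x \<noteq> ?r" "y \<noteq> ?r" using assms(3,4) by (auto simp: mark_def)
    obtain p q where "cls x = {p, q}" using assms(5) by (auto simp: card_2_iff)
    then show ?thesis using xy r ne by auto
  qed
qed

lemma mark_surj:
  assumes "x \<in> V" "card (cls x) = 2"
  shows "\<exists>y\<in>cls x. mark y = b"
proof -
  let ?r = "SOME y. y \<in> cls x"
  have r: "?r \<in> cls x" using someI[of "\<lambda>y. y \<in> cls x"] cls_self[OF assms(1)] by blast
  have mark: "mark y \<longleftrightarrow> y = ?r" if "y \<in> cls x" for y using cls_eq[OF that] by (simp add: mark_def)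
  obtain p q where pq: "cls x = {p, q}" "p \<noteq> q" using assms(2) by (auto simp: card_2_iff)
  show ?thesis
  proof (cases b)
    case True then show ?thesis using mark[OF r] r by blast
  next
    case False
    obtain y where "y \<in> cls x" "y \<noteq> ?r" using pq by (metis insertCI)
    then show ?thesis using mark False by blast
  qed
qed

text \<open>Four twins fill the neighbourhood of each of their neighbours, so by connectedness
  nothing else exists and the graph is K_{4,4}.\<close>

lemma wreath_if_four_twins:
  assumes u: "u \<in> V" "card (cls u) = 4"
  shows "graph_iso V E (wreath_V 4) (wreath_E 4)"
proof -
  let ?A = "cls u" and ?B = "nbrs u"
  have cB: "card ?B = 4" using card_nbrs[OF u(1)] .
  have nA: "nbrs x = ?B" if "x \<in> ?A" for x using that by (simp add: cls_def)
  have nB: "nbrs x = ?A" if "x \<in> ?B" for x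
  proof -
    have "?A \<subseteq> nbrs x" using cls_subset_nbrs E_sym that by blast
    moreover have "x \<in> V" using that E_V by blast
    ultimately show ?thesis using card_seteq[OF finite_nbrs, of ?A x] card_nbrs[of x] u(2) by simp
  qed
  have disj: "?A \<inter> ?B = {}" using nA E_irrefl by blast
  have V: "V = ?A \<union> ?B"
  proof
    show "?A \<union> ?B \<subseteq> V" using cls_V E_V by blast
    show "V \<subseteq> ?A \<union> ?B"
    proof
      fix y assume "y \<in> V"
      then have "E\<^sup>*\<^sup>* u y" using conn u(1) by (auto simp: connected_graph_def)
      then show "y \<in> ?A \<union> ?B"
      proof (induction rule: rtranclp_induct)
        case base then show ?case using cls_self u by blast
      next
        case (step y z) then show ?case using nA nB by blast
      qed
    qed
  qed
  have E_iff: "E x y \<longleftrightarrow> (x \<in> ?A) \<noteq> (y \<in> ?A)" if "x \<in> V" "y \<in> V" for x y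
    using that nA nB disj V by blast
  let ?W = "\<lambda>b. {p \<in> wreath_V 4. even (fst p) = b}"
  have cW: "card (?W b) = 4" for b
  proof -
    have "{0..<4} = {0, 1, 2, 3::nat}" by auto
    then have "wreath_V 4 = {0, 1, 2, 3} \<times> UNIV" by (simp only: wreath_V_def)
    then have "?W b = {i \<in> {0, 1, 2, 3}. even i = b} \<times> UNIV" by auto
    moreover have "{i \<in> {0, 1, 2, 3::nat}. even i = b} = (if b then {0, 2} else {1, 3})" by (cases b) auto
    ultimately have "?W b = (if b then {0, 2} else {1, 3}) \<times> UNIV" by (simp only:)
    then show ?thesis by (simp add: card_cartesian_product)
  qed
  have "finite (wreath_V 4)" by (simp add: wreath_V_def)
  then have fW: "finite (?W b)" for b by simp
  have "card ?A = card (?W True)" using u(2) by (simp only: cW)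
  from finite_same_card_bij[OF finite_cls fW this]
  obtain f1 where f1: "bij_betw f1 ?A (?W True)" by (elim exE)
  have "card ?B = card (?W False)" using cB by (simp only: cW)
  from finite_same_card_bij[OF finite_nbrs fW this]
  obtain f2 where f2: "bij_betw f2 ?B (?W False)" by (elim exE)
  define f where "f = (\<lambda>x. if x \<in> ?A then f1 x else f2 x)"
  have "f x = f1 x" if "x \<in> ?A" for x using that by (simp add: f_def)
  then have b1: "bij_betw f ?A (?W True)" using f1 bij_betw_cong[of ?A f f1 "?W True"] by blast
  have "f x = f2 x" if "x \<in> ?B" for x using that disj by (auto simp: f_def)
  then have b2: "bij_betw f ?B (?W False)" using f2 bij_betw_cong[of ?B f f2 "?W False"] by blast
  have "bij_betw f (?A \<union> ?B) (?W True \<union> ?W False)" using b1 b2 by (rule bij_betw_combine) auto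
  moreover have "?W True \<union> ?W False = wreath_V 4" by auto
  ultimately have bij: "bij_betw f V (wreath_V 4)" using V by simp
  have ev: "even (fst (f x)) \<longleftrightarrow> x \<in> ?A" if "x \<in> V" for x
    using bij_betw_apply[OF b1, of x] bij_betw_apply[OF b2, of x] that V by auto
  show ?thesis unfolding graph_iso_def
  proof (intro exI conjI ballI)
    fix x y assume xy: "x \<in> V" "y \<in> V"
    then show "wreath_E 4 (f x) (f y) \<longleftrightarrow> E x y"
      using bij_betw_apply[OF bij] ev E_iff by (simp add: wreath_4_iff)
  qed (rule bij)
qed

lemma card_nbr_classes:
  assumes "a \<in> V" and two: "\<And>x. E a x \<Longrightarrow> card (cls x) = 2"
  shows "card (cls ` nbrs a) = 2"
proof -
  have "2 * card (cls ` nbrs a) = card (\<Union>(cls ` nbrs a))"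
  proof (rule card_partition)
    show "finite (\<Union>(cls ` nbrs a))" using finite_nbrs finite_cls by blast
    show "c1 \<inter> c2 = {}" if "c1 \<in> cls ` nbrs a" "c2 \<in> cls ` nbrs a" "c1 \<noteq> c2" for c1 c2
      using that cls_eq by blast
  qed (use two finite_nbrs in auto)
  moreover have "\<Union>(cls ` nbrs a) = nbrs a" using cls_subset_nbrs cls_self E_V by blast
  ultimately show ?thesis using card_nbrs[OF assms(1)] by simp
qed

text \<open>Four neighbours form two classes, so the quotient by twin classes is connected of
  valency 2, a cycle. Its position and \<open>mark\<close> are the coordinates. The count of
  \<open>V\<close> is included so that the length of the cycle can be recovered.\<close>

lemma wreath_if_two_twins:
  assumes two: "\<And>x. x \<in> V \<Longrightarrow> card (cls x) = 2"
  shows "\<exists>m. card V = 2 * m \<and> graph_iso V E (wreath_V m) (wreath_E m)"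
proof -
  define Q where "Q = cls ` V"
  define R where "R = (\<lambda>c d. \<exists>x y. E x y \<and> c = cls x \<and> d = cls y)"
  have R_iff: "R (cls x) (cls y) \<longleftrightarrow> E x y" if "x \<in> V" "y \<in> V" for x y
  proof
    assume "R (cls x) (cls y)"
    then obtain x' y' where xy: "E x' y'" "cls x = cls x'" "cls y = cls y'" by (auto simp: R_def)
    then have "x' \<in> cls x" "y' \<in> cls y" using cls_self E_V by blast+
    then show "E x y" using xy(1) E_cls E_sym by blast
  qed (auto simp: R_def)
  obtain v where v: "v \<in> V" using conn by (auto simp: connected_graph_def)
  have nb: "{d. R (cls x) d} = cls ` nbrs x" if "x \<in> V" for x
  proof
    show "cls ` nbrs x \<subseteq> {d. R (cls x) d}" by (auto simp: R_def)
    show "{d. R (cls x) d} \<subseteq> cls ` nbrs x"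
    proof
      fix d assume "d \<in> {d. R (cls x) d}"
      then obtain y where "y \<in> V" "d = cls y" "R (cls x) (cls y)" using E_V by (auto simp: R_def)
      then show "d \<in> cls ` nbrs x" using R_iff[OF that] by blast
    qed
  qed
  obtain f where f: "bij_betw f {0..<card Q} Q"
    "\<And>i j. i < card Q \<Longrightarrow> j < card Q \<Longrightarrow> R (f i) (f j) \<longleftrightarrow> (i + 1) mod card Q = j \<or> (j + 1) mod card Q = i"
  proof (rule connected_two_regular_cycle[of Q "cls v" R])
    show "finite Q" using finite_V by (simp add: Q_def)
    show "cls v \<in> Q" using v by (simp add: Q_def)
    show "R y x" if "R x y" for x y using that E_sym by (auto simp: R_def)
    show "\<not> R x x" for x
    proof
      assume "R x x"
      then obtain u w where uw: "E u w" "x = cls u" "x = cls w" by (auto simp: R_def)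
      then show False using R_iff[of u u] E_V E_irrefl by (metis R_iff)
    qed
    show "x \<in> Q \<and> y \<in> Q" if "R x y" for x y using that E_V by (auto simp: R_def Q_def)
    show "card {y. R c y} = 2" if "c \<in> Q" for c
    proof -
      obtain x where x: "x \<in> V" "c = cls x" using \<open>c \<in> Q\<close> by (auto simp: Q_def)
      then show ?thesis using nb[OF x(1)] card_nbr_classes[OF x(1)] two E_V by auto
    qed
    show "R\<^sup>*\<^sup>* (cls v) c" if "c \<in> Q" for c
    proof -
      obtain x where x: "x \<in> V" "c = cls x" using \<open>c \<in> Q\<close> by (auto simp: Q_def)
      have "E\<^sup>*\<^sup>* v x" using conn v x(1) by (auto simp: connected_graph_def)
      then have "R\<^sup>*\<^sup>* (cls v) (cls x)"
      proof (induction rule: rtranclp_induct)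
        case (step y z)
        then have "R (cls y) (cls z)" by (auto simp: R_def)
        then show ?case using step.IH by (rule rtranclp.rtrancl_into_rtrancl[rotated])
      qed simp
      then show ?thesis using x(2) by simp
    qed
  qed blast
  let ?m = "card Q"
  define idx where "idx = (\<lambda>x. inv_into {0..<?m} f (cls x))"
  have clsQ: "cls x \<in> f ` {0..<?m}" if "x \<in> V" for x
    using f(1) that by (simp add: bij_betw_def Q_def)
  have idx: "f (idx x) = cls x" "idx x < ?m" if "x \<in> V" for x
    using f_inv_into_f[OF clsQ[OF that]] inv_into_into[OF clsQ[OF that]] by (auto simp: idx_def)
  define F where "F = (\<lambda>x. (idx x, mark x))"
  have "bij_betw F V (wreath_V ?m)"
  proof (rule bij_betw_imageI)
    show "inj_on F V"
    proof (rule inj_onI)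
      fix x y assume xy: "x \<in> V" "y \<in> V" "F x = F y"
      then have "cls x = cls y" "mark x = mark y" using idx by (auto simp: F_def) (metis idx(1))+
      then show "x = y" using mark_inj xy two by blast
    qed
    show "F ` V = wreath_V ?m"
    proof
      show "F ` V \<subseteq> wreath_V ?m" using idx by (auto simp: F_def wreath_V_def)
      show "wreath_V ?m \<subseteq> F ` V"
      proof
        fix p assume "p \<in> wreath_V ?m"
        then obtain i b where p: "p = (i, b)" "i < ?m" by (auto simp: wreath_V_def)
        then have "f i \<in> Q" using f(1) by (auto simp: bij_betw_def)
        then obtain x where x: "x \<in> V" "f i = cls x" by (auto simp: Q_def)
        obtain y where y: "y \<in> cls x" "mark y = b" using mark_surj[OF x(1) two[OF x(1)]] by blast
        have yV: "y \<in> V" using y(1) cls_V by blast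
        have "f (idx y) = f i" using idx(1)[OF yV] cls_eq[OF y(1)] x(2) by simp
        then have "idx y = i" using f(1) idx(2)[OF yV] p(2) by (auto simp: bij_betw_def inj_on_def)
        then show "p \<in> F ` V" using p y yV by (force simp: F_def)
      qed
    qed
  qed
  moreover have "wreath_E ?m (F x) (F y) \<longleftrightarrow> E x y" if "x \<in> V" "y \<in> V" for x y
  proof -
    have "wreath_E ?m (F x) (F y) \<longleftrightarrow> R (f (idx x)) (f (idx y))"
      using idx(2) that f(2) by (auto simp: wreath_E_def wreath_V_def F_def)
    then show ?thesis using idx(1) that R_iff by simp
  qed
  ultimately have "graph_iso V E (wreath_V ?m) (wreath_E ?m)" unfolding graph_iso_def by blast
  moreover have "card V = 2 * ?m"
    using bij_betw_same_card[OF \<open>bij_betw F V (wreath_V ?m)\<close>] by (simp add: wreath_V_def card_cartesian_product)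
  ultimately show ?thesis by blast
qed

end

section \<open>The subdivided double\<close>

context edge_transitive
begin

text \<open>The vertices of \<Lambda> are the twin classes in B, numbered by \<phi>. A vertex a of A
  meets exactly two of them, and this pair \<open>e a\<close> is an edge; singleton classes in A
  make \<open>e\<close> injective. Arc-transitivity is inherited from G, because an arc of \<Lambda>
  amounts to an edge of the given graph: the end in A is the edge of \<Lambda>, the class of the end
  in B its tail.\<close>

lemma subdivided_double:
  assumes AV: "A \<subseteq> V" and cross: "\<And>x y. E x y \<Longrightarrow> x \<in> A \<longleftrightarrow> y \<notin> A"
    and G_A: "\<And>g x. g \<in> G \<Longrightarrow> g x \<in> A \<longleftrightarrow> x \<in> A"
    and two: "\<And>b. b \<in> V - A \<Longrightarrow> card (cls b) = 2" and one: "\<And>a. a \<in> A \<Longrightarrow> card (cls a) = 1"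
    and cardB: "card (cls ` (V - A)) = 2 ^ k"
  shows "\<exists>(LV :: nat set) LE. simple_graph LV LE \<and> regular_graph 4 LV LE
     \<and> arc_transitive LV LE \<and> (\<exists>k::nat. card LV = 2 ^ k)
     \<and> graph_iso V E (sdouble_V LV LE) (sdouble_E LV LE)"
proof -
  define B where "B = V - A"
  have BV: "B \<subseteq> V" and V: "V = A \<union> B" and disj: "A \<inter> B = {}" using AV by (auto simp: B_def)
  have E_AB: "b \<in> B" if "E a b" "a \<in> A" for a b using that cross[of a b] E_V by (auto simp: B_def)
  have E_BA: "a \<in> A" if "E b a" "b \<in> B" for a b using that cross[of b a] E_V by (auto simp: B_def)
  have finB: "finite (cls ` B)" using finite_V by (simp add: B_def)
  obtain \<iota> :: "'a set \<Rightarrow> nat" where \<iota>: "bij_betw \<iota> (cls ` B) {0..<card (cls ` B)}"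
    using ex_bij_betw_finite_nat[OF finB] by blast
  define \<phi> where "\<phi> = (\<lambda>b. \<iota> (cls b))"
  have \<phi>_eq: "\<phi> x = \<phi> y \<longleftrightarrow> cls x = cls y" if "x \<in> B" "y \<in> B" for x y
    using \<iota> that by (auto simp: \<phi>_def bij_betw_def inj_on_def)
  define LV where "LV = \<phi> ` B"
  have LV: "LV = {0..<card (cls ` B)}" using \<iota> by (auto simp: LV_def \<phi>_def bij_betw_def image_image)
  define LE where "LE = (\<lambda>i j. i \<noteq> j \<and> (\<exists>x\<in>B. \<exists>y\<in>B. i = \<phi> x \<and> j = \<phi> y \<and> (\<exists>a. E a x \<and> E a y)))"
  have E_\<phi>: "E a x \<longleftrightarrow> E a y" if "x \<in> B" "y \<in> B" "\<phi> x = \<phi> y" for a x y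
  proof -
    have "y \<in> cls x" using \<phi>_eq that cls_self BV by blast
    then show ?thesis by (rule E_cls)
  qed
  have LE_\<phi>: "LE (\<phi> x) (\<phi> y) \<longleftrightarrow> \<phi> x \<noteq> \<phi> y \<and> (\<exists>a. E a x \<and> E a y)" if "x \<in> B" "y \<in> B" for x y
  proof
    assume "LE (\<phi> x) (\<phi> y)"
    then obtain x' y' a where "\<phi> x \<noteq> \<phi> y" "x' \<in> B" "y' \<in> B" "\<phi> x = \<phi> x'" "\<phi> y = \<phi> y'" "E a x'" "E a y'"
      unfolding LE_def by blast
    then show "\<phi> x \<noteq> \<phi> y \<and> (\<exists>a. E a x \<and> E a y)" using E_\<phi> that by blast
  next
    assume "\<phi> x \<noteq> \<phi> y \<and> (\<exists>a. E a x \<and> E a y)"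
    then show "LE (\<phi> x) (\<phi> y)" unfolding LE_def using that by blast
  qed
  define e where "e = (\<lambda>a. \<phi> ` nbrs a)"
  have nbrs_B: "nbrs a \<subseteq> B" if "a \<in> A" for a using E_AB that by blast
  have e_iff: "\<phi> b \<in> e a \<longleftrightarrow> E a b" if "a \<in> A" "b \<in> B" for a b
  proof
    assume "\<phi> b \<in> e a"
    then obtain b' where "E a b'" "\<phi> b = \<phi> b'" by (auto simp: e_def)
    then show "E a b" using E_\<phi>[of b b' a] that E_AB by blast
  qed (simp add: e_def)
  have e_LV: "e a \<subseteq> LV" if "a \<in> A" for a using nbrs_B[OF that] by (auto simp: e_def LV_def)
  have e_card: "card (e a) = 2" if "a \<in> A" for a
  proof -
    have "card (cls ` nbrs a) = 2"
      using that AV two nbrs_B[OF that] by (intro card_nbr_classes) (auto simp: B_def)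
    moreover have "inj_on \<iota> (cls ` nbrs a)"
      using \<iota> nbrs_B[OF that] by (meson bij_betw_imp_inj_on image_mono inj_on_subset)
    ultimately show ?thesis by (simp add: e_def \<phi>_def card_image flip: image_image)
  qed
  have e_inj: "a = a'" if "a \<in> A" "a' \<in> A" "e a = e a'" for a a'
  proof -
    have "nbrs a = nbrs a'" using e_iff that nbrs_B by blast
    then have "a' \<in> cls a" "a \<in> cls a" using that AV by (auto simp: cls_def)
    then show ?thesis using one[OF that(1)] by (auto simp: card_1_singleton_iff)
  qed
  have LE_e: "LE i j \<longleftrightarrow> i \<noteq> j \<and> (\<exists>a\<in>A. e a = {i, j})" for i j
  proof
    assume "LE i j"
    then obtain x y a where xy: "i \<noteq> j" "x \<in> B" "y \<in> B" "i = \<phi> x" "j = \<phi> y" "E a x" "E a y"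
      unfolding LE_def by blast
    have aA: "a \<in> A" using E_BA[OF E_sym[OF xy(6)] xy(2)] .
    have "{i, j} \<subseteq> e a" using xy by (auto simp: e_def)
    moreover have "finite (e a)" using finite_nbrs by (simp add: e_def)
    ultimately have "{i, j} = e a" using e_card[OF aA] xy(1) by (intro card_seteq) auto
    then show "i \<noteq> j \<and> (\<exists>a\<in>A. e a = {i, j})" using xy(1) aA by blast
  next
    assume "i \<noteq> j \<and> (\<exists>a\<in>A. e a = {i, j})"
    then obtain a where a: "i \<noteq> j" "a \<in> A" "e a = {i, j}" by blast
    then have "i \<in> \<phi> ` nbrs a" "j \<in> \<phi> ` nbrs a" by (auto simp: e_def)
    then obtain x y where "E a x" "i = \<phi> x" "E a y" "j = \<phi> y" by blast
    then show "LE i j" unfolding LE_def using a E_AB by blast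
  qed
  have LE_LV: "i \<in> LV \<and> j \<in> LV" if "LE i j" for i j using that by (auto simp: LE_def LV_def)
  have edges_e: "edges LV LE = e ` A"
  proof
    show "edges LV LE \<subseteq> e ` A" by (auto simp: edges_def LE_e)
    show "e ` A \<subseteq> edges LV LE"
    proof
      fix c assume "c \<in> e ` A"
      then obtain a where a: "a \<in> A" "c = e a" by blast
      then obtain i j where ij: "c = {i, j}" "i \<noteq> j" using e_card unfolding card_2_iff by blast
      then have "LE i j" using a LE_e by blast
      then show "c \<in> edges LV LE" using ij LE_LV by (auto simp: edges_def)
    qed
  qed
  have simpleL: "simple_graph LV LE"
    unfolding simple_graph_def
  proof (intro conjI allI impI)
    show "finite LV" by (simp add: LV)
    show "LE y x" if "LE x y" for x y using that by (auto simp: LE_e insert_commute)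
  qed (use LE_LV LE_e in auto)
  have regL: "regular_graph 4 LV LE"
    unfolding regular_graph_def
  proof
    fix i assume "i \<in> LV"
    then obtain b where b: "b \<in> B" "i = \<phi> b" by (auto simp: LV_def)
    have bA: "nbrs b \<subseteq> A" using E_BA b by blast
    \<comment> \<open>Neighbours j of i in \<Lambda> and neighbours a of b are matched through {i,
      j} = e a, so the valency 4 carries over.\<close>
    have "(\<lambda>j. {i, j}) ` {j. LE i j} = e ` nbrs b"
    proof
      show "(\<lambda>j. {i, j}) ` {j. LE i j} \<subseteq> e ` nbrs b"
      proof clarify
        fix j assume "LE i j"
        then obtain a where a: "a \<in> A" "e a = {i, j}" using LE_e by blast
        then have "E a b" using e_iff[OF a(1) b(1)] b(2) by simp
        then show "{i, j} \<in> e ` nbrs b" using a E_sym by blast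
      qed
      show "e ` nbrs b \<subseteq> (\<lambda>j. {i, j}) ` {j. LE i j}"
      proof clarify
        fix a assume a: "E b a"
        then have aA: "a \<in> A" using bA by blast
        have "i \<in> e a" using e_iff[OF aA b(1)] E_sym[OF a] b(2) by simp
        then obtain j where j: "e a = {i, j}" "i \<noteq> j"
          using e_card[OF aA] unfolding card_2_iff by (metis insertE insert_commute singletonD)
        then have "LE i j" using LE_e aA by blast
        then show "e a \<in> (\<lambda>j. {i, j}) ` {j. LE i j}" using j by blast
      qed
    qed
    moreover have "inj_on (\<lambda>j. {i, j}) {j. LE i j}" by (auto simp: inj_on_def doubleton_eq_iff)
    moreover have "inj_on e (nbrs b)" using e_inj bA by (auto simp: inj_on_def)
    ultimately have "card {j. LE i j} = card (nbrs b)" by (metis card_image)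
    then show "card {j. LE i j} = 4" using card_nbrs BV b by auto
  qed
  have arcL: "arc_transitive LV LE"
    unfolding arc_transitive_def
  proof (intro allI impI)
    fix i j i' j' assume ij: "LE i j" and ij': "LE i' j'"
    obtain a where a: "a \<in> A" "e a = {i, j}" "i \<noteq> j" using ij LE_e by blast
    obtain a' where a': "a' \<in> A" "e a' = {i', j'}" "i' \<noteq> j'" using ij' LE_e by blast
    have "i \<in> \<phi> ` nbrs a" "j \<in> \<phi> ` nbrs a" "i' \<in> \<phi> ` nbrs a'" using a(2) a'(2) by (auto simp: e_def)
    then obtain b b2 d where b: "E a b" "i = \<phi> b" "E a b2" "j = \<phi> b2" "E a' d" "i' = \<phi> d" by blast
    have bB: "b \<in> B" "b2 \<in> B" "d \<in> B" using b a(1) a'(1) E_AB by auto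
    \<comment> \<open>The other way to map the edge onto its image would take a to d, but G
      preserves A and d lies in B.\<close>
    obtain g where g: "g \<in> G" "g a = a'" "g b = d"
      using edge_map[OF b(1,5)]
    proof cases
      case (2 g)
      then have "d \<in> A" using G_A[OF 2(1), of a] a(1) by simp
      then show ?thesis using bB(3) disj by blast
    qed blast
    have gB: "g x \<in> B" if "x \<in> B" for x using that G_A[OF g(1)] G_V[OF g(1)] by (simp add: B_def)
    have g_\<phi>: "\<phi> (g x) = \<phi> (g y) \<longleftrightarrow> \<phi> x = \<phi> y" if "x \<in> B" "y \<in> B" for x y
    proof -
      have "x \<in> V" "y \<in> V" using that BV by auto
      then have "cls (g x) = cls (g y) \<longleftrightarrow> cls x = cls y"
        using cls_image[OF g(1)] permutes_inj[OF G_permutes[OF g(1)]] by (simp add: inj_image_eq_iff)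
      then show ?thesis using \<phi>_eq that gB by simp
    qed
    define rep where "rep = (\<lambda>l. SOME x. x \<in> B \<and> \<phi> x = l)"
    have rep: "rep l \<in> B" "\<phi> (rep l) = l" if "l \<in> LV" for l
      using someI_ex[of "\<lambda>x. x \<in> B \<and> \<phi> x = l"] that by (auto simp: rep_def LV_def)
    \<comment> \<open>The permutation of twin classes induced by g, transported along \<phi> and
      extended by the identity as \<open>permutes\<close> demands.\<close>
    define f where "f = (\<lambda>l. if l \<in> LV then \<phi> (g (rep l)) else l)"
    have f_\<phi>: "f (\<phi> x) = \<phi> (g x)" if "x \<in> B" for x
    proof -
      have "\<phi> x \<in> LV" using that by (simp add: LV_def)
      then show ?thesis using g_\<phi>[of "rep (\<phi> x)" x] rep that by (simp add: f_def)
    qed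
    have "f permutes LV"
    proof (rule bij_imp_permutes)
      have "f ` LV \<subseteq> LV" using f_\<phi> gB by (auto simp: LV_def)
      moreover have inj: "inj_on f LV" using f_\<phi> g_\<phi> by (auto simp: inj_on_def LV_def)
      ultimately show "bij_betw f LV LV"
        using endo_inj_surj[of LV f] by (simp add: bij_betw_def LV)
    qed (simp add: f_def)
    moreover have "LE (f l) (f l') \<longleftrightarrow> LE l l'" if ll: "l \<in> LV" "l' \<in> LV" for l l'
    proof -
      obtain x y where xy: "x \<in> B" "l = \<phi> x" "y \<in> B" "l' = \<phi> y" using ll unfolding LV_def by blast
      have "(\<exists>a. E a (g x) \<and> E a (g y)) \<longleftrightarrow> (\<exists>a. E a x \<and> E a y)"
      proof
        assume "\<exists>a. E a (g x) \<and> E a (g y)"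
        then obtain c where "E c (g x)" "E c (g y)" by blast
        then have "E (ginv g c) x" "E (ginv g c) y"
          using G_E[OF g(1), of "ginv g c" x] G_E[OF g(1), of "ginv g c" y] g(1) by auto
        then show "\<exists>a. E a x \<and> E a y" by blast
      next
        assume "\<exists>a. E a x \<and> E a y"
        then show "\<exists>a. E a (g x) \<and> E a (g y)" using G_E[OF g(1)] by blast
      qed
      then show ?thesis using xy f_\<phi> g_\<phi> LE_\<phi> gB by simp
    qed
    moreover have "f i = i'" using f_\<phi> b g(3) bB by simp
    \<comment> \<open>The image of j is an end of the edge \<open>e a'\<close> other than i', so it
      must be j'.\<close>
    moreover have "f j = j'"
    proof -
      have "E a' (g b2)" using G_E[OF g(1), of a b2] b(3) g(2) by simp
      then have "f j \<in> e a'" using f_\<phi>[OF bB(2)] b(4) by (simp add: e_def)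
      moreover have "f j \<noteq> i'" using f_\<phi>[OF bB(2)] g_\<phi>[OF bB(2,1)] b g(3) a(3) by auto
      ultimately show ?thesis using a'(2) by simp
    qed
    ultimately show "\<exists>f. automorphism LV LE f \<and> f i = i' \<and> f j = j'"
      unfolding automorphism_def by blast
  qed
  define F where "F = (\<lambda>x. if x \<in> A then Inl (e x) else Inr (\<phi> x, mark x))"
  have F_A: "F x = Inl (e x)" if "x \<in> A" for x using that by (simp add: F_def)
  have F_B: "F x = Inr (\<phi> x, mark x)" if "x \<in> B" for x using that disj by (auto simp: F_def)
  have "bij_betw F V (sdouble_V LV LE)"
  proof (rule bij_betw_imageI)
    show "inj_on F V"
    proof (rule inj_onI)
      fix x y assume xy: "x \<in> V" "y \<in> V" "F x = F y"
      then consider "x \<in> A" "y \<in> A" | "x \<in> B" "y \<in> B" | "x \<in> A" "y \<in> B" | "x \<in> B" "y \<in> A" using V by blast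
      then show "x = y"
      proof cases
        case 1 then show ?thesis using e_inj xy(3) by (simp add: F_A)
      next
        case 2
        then have "\<phi> x = \<phi> y" "mark x = mark y" using xy(3) by (auto simp: F_B)
        then show ?thesis using mark_inj[of x y] xy 2 \<phi>_eq two by (simp add: B_def)
      qed (use xy(3) in \<open>auto simp: F_A F_B\<close>)
    qed
    show "F ` V = sdouble_V LV LE"
    proof
      show "F ` V \<subseteq> sdouble_V LV LE"
      proof clarify
        fix x assume "x \<in> V"
        then consider "x \<in> A" | "x \<in> B" using V by blast
        then show "F x \<in> sdouble_V LV LE"
        proof cases
          case 1 then show ?thesis by (simp add: F_A sdouble_V_def edges_e)
        next
          case 2 then show ?thesis by (simp add: F_B sdouble_V_def LV_def)
        qed
      qed
      show "sdouble_V LV LE \<subseteq> F ` V"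
      proof
        fix p assume "p \<in> sdouble_V LV LE"
        then have "p \<in> Inl ` e ` A \<or> p \<in> Inr ` (\<phi> ` B \<times> UNIV)"
          unfolding sdouble_V_def edges_e by (simp add: LV_def)
        then consider a where "a \<in> A" "p = Inl (e a)" | b m where "b \<in> B" "p = Inr (\<phi> b, m)"
          by blast
        then show "p \<in> F ` V"
        proof cases
          case (1 a) then show ?thesis using F_A AV by (metis imageI subsetD)
        next
          case (2 b m)
          obtain y where y: "y \<in> cls b" "mark y = m"
            using mark_surj[of b m] 2(1) two BV by (auto simp: B_def)
          have bV: "b \<in> V" using 2(1) BV by blast
          then obtain a where ab: "E a b" using ex_nbr E_sym by blast
          have aA: "a \<in> A" using E_BA[OF E_sym[OF ab] 2(1)] .
          have "E a y" using E_cls[OF y(1), of a] ab by simp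
          then have yB: "y \<in> B" using E_AB aA by blast
          then have "\<phi> y = \<phi> b" using \<phi>_eq 2(1) cls_eq[OF y(1)] by simp
          then have "p = F y" using F_B[OF yB] 2 y by simp
          then show ?thesis using yB BV by blast
        qed
      qed
    qed
  qed
  moreover have "sdouble_E LV LE (F x) (F y) \<longleftrightarrow> E x y" if xy: "x \<in> V" "y \<in> V" for x y
  proof -
    have AB: "sdouble_E LV LE (F x) (F y) \<longleftrightarrow> E x y" "sdouble_E LV LE (F y) (F x) \<longleftrightarrow> E y x"
      if "x \<in> A" "y \<in> B" for x y
    proof -
      have "e x \<in> edges LV LE" using that edges_e by blast
      moreover have "\<phi> y \<in> LV" using that by (simp add: LV_def)
      ultimately have "sdouble_E LV LE (F x) (F y) \<longleftrightarrow> E x y" "sdouble_E LV LE (F y) (F x) \<longleftrightarrow> E x y"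
        using e_iff[OF that] by (auto simp: sdouble_E_def F_A[OF that(1)] F_B[OF that(2)])
      then show "sdouble_E LV LE (F x) (F y) \<longleftrightarrow> E x y" "sdouble_E LV LE (F y) (F x) \<longleftrightarrow> E y x"
        using E_sym by blast+
    qed
    consider "x \<in> A" "y \<in> A" | "x \<in> B" "y \<in> B" | "x \<in> A" "y \<in> B" | "x \<in> B" "y \<in> A" using V xy by blast
    then show ?thesis
    proof cases
      case 1 then show ?thesis using cross by (auto simp: sdouble_E_def F_A)
    next
      case 2 then show ?thesis using E_BA disj by (auto simp: sdouble_E_def F_B)
    next
      case 3 then show ?thesis by (rule AB(1))
    next
      case 4 then show ?thesis using AB(2) by blast
    qed
  qed
  ultimately have "graph_iso V E (sdouble_V LV LE) (sdouble_E LV LE)" unfolding graph_iso_def by blast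
  moreover have "card LV = 2 ^ k" using cardB by (simp add: LV B_def)
  ultimately show ?thesis using simpleL regL arcL by blast
qed

end

section \<open>The possible sizes of the twin classes in the two halves\<close>

theorem theorem1p3:
  fixes V :: "'a set" and E :: "'a \<Rightarrow> 'a \<Rightarrow> bool" and G :: "('a \<Rightarrow> 'a) set"
  assumes "simple_graph V E" and "connected_graph V E" and "regular_graph 4 V E"
    and "aut_subgroup V E G" and "edge_transitive_on V E G"
  shows "(\<exists>g\<in>G. semiregular_element V g)
    \<or> (\<exists>n::nat. n \<ge> 2 \<and> graph_iso V E (wreath_V (2 ^ n)) (wreath_E (2 ^ n)))
    \<or> (\<exists>(LV :: nat set) LE. simple_graph LV LE \<and> regular_graph 4 LV LE
         \<and> arc_transitive LV LE \<and> (\<exists>k::nat. card LV = 2 ^ k)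
         \<and> graph_iso V E (sdouble_V LV LE) (sdouble_E LV LE))"
proof -
  interpret edge_transitive V E G using assms by unfold_locales
  show ?thesis
  proof (cases "\<exists>g\<in>G. semiregular_element V g")
    case False
    then have no: "\<not> semiregular_element V g" if "g \<in> G" for g using that by blast
    obtain v z k where nvt: "\<not> vertex_transitive" and v: "v \<in> V" and z: "z \<in> G" "z \<circ> z = id"
      and z_fix: "\<And>a. a \<in> act.orb v \<Longrightarrow> z a = a" and z_move: "\<And>b. b \<in> V - act.orb v \<Longrightarrow> z b \<noteq> b"
      and k: "card (act.orb v) = 2 ^ k"
      using two_twisted_halves[OF no] by blast
    define A where "A = act.orb v"
    define B where "B = V - A"
    have AV: "A \<subseteq> V" using act.orb_subset[OF v] by (simp only: A_def)
    have vA: "v \<in> A" using act.orb_self[OF v] by (simp only: A_def)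
    obtain w where w: "E v w" using ex_nbr[OF v] by blast
    have wV: "w \<in> V" using w E_V by blast
    have wB: "w \<in> B" using edge_crosses[OF nvt w] wV unfolding A_def B_def by blast
    have orbB: "act.orb w = B" using orb_complement[OF nvt v wV] wB unfolding A_def B_def by blast
    have kB: "card B = 2 ^ k" using card_halves[OF nvt v] k unfolding A_def B_def by simp
    have cross: "x \<in> A \<longleftrightarrow> y \<notin> A" if "E x y" for x y
      using not_both_in_orbit[OF nvt v that] unfolding A_def .
    have G_A: "g x \<in> A \<longleftrightarrow> x \<in> A" if g: "g \<in> G" for g x
    proof -
      have "g x \<in> A" if "g \<in> G" "x \<in> A" for g x
      proof -
        obtain h where "h \<in> G" "h v = x" using \<open>x \<in> A\<close> unfolding A_def orb_mem by blast
        then have "(g \<circ> h) v = g x" "g \<circ> h \<in> G" using G_comp that(1) by auto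
        then show ?thesis unfolding A_def orb_mem by blast
      qed
      from this[OF g] this[OF ginv_G[OF g], of "g x"] show ?thesis using g by auto
    qed
    have cls_side: "y \<in> A \<longleftrightarrow> x \<in> A" if yx: "y \<in> cls x" "x \<in> V" for x y
    proof -
      obtain a where "E a x" using ex_nbr[OF yx(2)] E_sym by blast
      then show ?thesis using E_cls[OF yx(1), of a] cross by blast
    qed
    have subA: "cls x \<subseteq> A" if "x \<in> A" for x using cls_side that AV by blast
    have subB: "cls x \<subseteq> B" if "x \<in> B" for x using cls_side that cls_V unfolding B_def by blast
    have clsA: "card (cls v) \<in> {1, 2, 4}"
      using cls_orbit_power(1)[OF k v] subA unfolding A_def by blast
    have clsB: "card (cls w) \<in> {1, 2, 4}" "card (cls ` B) * card (cls w) = 2 ^ k"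
      using cls_orbit_power[of w k] kB wV subB unfolding orbB by blast+
    have eqA: "card (cls x) = card (cls v)" if "x \<in> A" for x
      using that card_cls_image[OF _ v] unfolding A_def orb_mem by blast
    have eqB: "card (cls x) = card (cls w)" if "x \<in> B" for x
      using that card_cls_image[OF _ wV] unfolding orbB[symmetric] orb_mem by blast
    \<comment> \<open>All neighbours of w lie in A, which z fixes pointwise, so w and
      \<open>z w\<close> are distinct twins.\<close>
    have "card (cls w) \<noteq> 1"
    proof
      assume one: "card (cls w) = 1"
      have "nbrs (z w) = nbrs w"
      proof -
        have "E (z w) a \<longleftrightarrow> E w a" for a
        proof (cases "a \<in> A")
          case True
          then have "z a = a" using z_fix unfolding A_def by blast
          then show ?thesis using G_E[OF z(1), of w a] by simp
        next
          case False
          have "w \<notin> A" "z w \<notin> A" using wB G_A[OF z(1), of w] by (auto simp: B_def)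
          then show ?thesis using False cross by blast
        qed
        then show ?thesis by simp
      qed
      then have "z w \<in> cls w" "w \<in> cls w" using wV G_V[OF z(1)] by (auto simp: cls_def)
      then have "z w = w" using one by (auto simp: card_1_singleton_iff)
      then show False using z_move[of w] wB unfolding A_def B_def by blast
    qed
    then consider "card (cls v) = 4 \<or> card (cls w) = 4" | "card (cls v) = 2" "card (cls w) = 2"
      | "card (cls v) = 1" "card (cls w) = 2" using clsA clsB(1) by auto
    then show ?thesis
    proof cases
      case 1
      then have "graph_iso V E (wreath_V (2 ^ 2)) (wreath_E (2 ^ 2))"
        using wreath_if_four_twins[OF v] wreath_if_four_twins[OF wV] by auto
      then show ?thesis by blast
    next
      case 2
      then have "card (cls x) = 2" if "x \<in> V" for x using eqA eqB that unfolding B_def by (cases "x \<in> A") auto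
      then obtain m where m: "card V = 2 * m" "graph_iso V E (wreath_V m) (wreath_E m)"
        using wreath_if_two_twins by blast
      have "card V = card A + card B"
        using finite_V AV by (simp add: B_def card_Diff_subset finite_subset card_mono)
      then have mk: "m = 2 ^ k" using m(1) kB k unfolding A_def by simp
      \<comment> \<open>B has 2^k elements and contains the four neighbours of v; this yields the
        bound k \<ge> 2 for the wreath graph.\<close>
      have "nbrs v \<subseteq> B" using cross vA E_V unfolding B_def by blast
      then have "4 \<le> card B" using card_mono[of B "nbrs v"] card_nbrs[OF v] finite_V by (simp add: B_def)
      then have "\<not> k < 2" using kB power_strict_increasing[of k 2 "2::nat"] by auto
      then show ?thesis using m(2) mk by (metis not_less)
    next
      case 3
      \<comment> \<open>The number of classes in B is the number of vertices of \<Lambda>, and it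
        must be shown to be a power of 2.\<close>
      have "card (cls ` B) dvd 2 ^ k" using clsB(2) by (metis dvd_triv_left)
      then obtain l where l: "card (cls ` B) = 2 ^ l" using divides_primepow_nat[of 2] by auto
      show ?thesis
      proof (intro disjI2, rule subdivided_double[where A=A and k=l])
        show "card (cls b) = 2" if "b \<in> V - A" for b using eqB 3 that unfolding B_def by simp
        show "card (cls a) = 1" if "a \<in> A" for a using eqA 3 that by simp
        show "card (cls ` (V - A)) = 2 ^ l" using l unfolding B_def .
      qed (use AV cross G_A in auto)
    qed
  qed simp
qed

end
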